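(* Let $F$ be a Borel approximating function and let $s=(s_i)_{i\in FN}$ be an approximating sequence of a Borel semiset whose (lower and upper) cut is nonadditive. Then $\mathscr{O}(s,F)=\mathscr{B}_s$, and $m_{s,F}$ is a nondecreasing and nonnegative measure.
   Context: Setting: Vopěnka's Alternative Set Theory (AST). Objects are classes; sets are the classes that are members of classes; $V$ is the class of all sets. Sets satisfy ZF with the axiom of infinity replaced by its negation (in particular induction for set-formulas); classes satisfy extensionality and full comprehension; a semiset is a subclass of a set (it need not be a set); prolongation axiom: every function with domain $FN$ is a subclass of a set function; the axiom of choice (extensional coding) is assumed; any two uncountable classes are equinumerous. $N$ is the class of (von Neumann) natural numbers and $FN=\{n\in N:\text{every subclass of }n\text{ is a set}\}$ the class of finite natural numbers; $Q$ is the class of rationals built from $N$, $Q^+$ the nonnegative ones, $FQ\subseteq Q$ the rationals $\pm x/y$ with $x,y\in FN$, and $BQ=\{x\in Q:(\exists i\in FN)\,|x|\le i\}$. Indices $i,j,k$ range over $FN$. Borel classes: $X$ is a $\sigma_0$-class iff it is a $\pi_0$-class iff it is set-theoretically definable (definable by a formula quantifying only over sets, with set parameters). For $a\in FN$, $a>0$, $X$ is a $\sigma_a$-class ($\pi_a$-class) iff $X=\bigcup_{i\in FN}X_i$ ($X=\bigcap_{i\in FN} X_i$) with each $X_i$ a $\pi_b$-class ($\sigma_b$-class) for some $b<a$. $X$ is Borel if it is a $\sigma_a$- or $\pi_a$-class for some $a\in FN$. $\mathscr{B}_s$ is the system of Borel semisets. Cuts: $A\subseteq Q^+$ is a cut if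 it is downward closed in $Q^+$ and has no greatest element; cuts are ordered by inclusion. For $q\in Q^+$, $Q\langle q\rangle=\{x\in Q^+:x<q\}$, often written simply $q$; it is a cut of a natural number if $q\in N$. $\frac{FN}{1}=\bigcup_{n\in FN}Q\langle n\rangle$ and $\frac1{FN}=\bigcap_{0<n\in FN}Q\langle 1/n\rangle$. External sum: $\{x\in Q^+:\forall a\notin A\,\forall b\notin B\ (x<a+b)\}$; internal sum: $\{x\in Q^+:\exists a\in A\,\exists b\in B\ (x<a+b)\}$ (with $a,b\in Q^+$). $A$ is additive if $A+A=A$ (for both sums), otherwise nonadditive. Internal difference: $A\ominus B=\{x\in Q^+:(\forall b\in B')\,x+b\in A\}$, where $B'=B\cup\{\min(Q^+\setminus B)\}$ ($B'=B$ if there is no minimum). Lower/upper cuts of a class $X$: for $n\in N$ and a set $u$, $n\,\widehat\prec\, u$ means there is an injective set function with domain $n$ and range a proper subset of $u$. $\underline X=\{q\in Q^+:(\exists n\in N)(\exists u)(u\subseteq X\wedge n\widehat\prec u\wedge q<n)\}$, $\overline X=\{q\in Q^+:(\exists n\in N)((\forall u)(u\supseteq X\Rightarrow n\widehat\prec u)\wedge q<n)\}$ ($u$ ranging over sets). $|X|$ denotes the common value if they agree. (For a Borel class, if one of $\underline X,\overline X$ is additive then they are equal.) An approximating sequence of a class $X$ is a sequence $(s_i)_{i\in FN}$ of cuts of natural numbers with $\bigcup_i\bigcap_{j\ge i}s_j=\underline X$ and $\bigcap_i\bigcup_{j\ge i}s_j=\overline X$. A Borel approximating function (BAF) is a map $F$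 assigning to each $A\in\mathscr{B}_s$ an approximating sequence of $A$. Ratios: cuts $Q\langle q\rangle$ of rationals are added, multiplied and divided as the rationals $q$ themselves. For sequences of such cuts, $\varliminf \frac{b_i}{s_i}=\bigcup_i\bigcap_{j\ge i}\frac{b_j}{s_j}$ and $\varlimsup\frac{b_i}{s_i}=\bigcap_i\bigcup_{j\ge i}\frac{b_j}{s_j}$. For cuts, $A\doteq B$ means $(A\ominus B)\cup(B\ominus A)\subseteq\frac1{FN}$ or $A\cap B\supseteq\frac{FN}{1}$. A semiset $B\in\mathscr{B}_s$ with $F(B)=(b_i)$ is $\langle s,F\rangle$-observable if $\varliminf\frac{b_i}{s_i}\doteq\varlimsup\frac{b_i}{s_i}$; $\mathscr{O}(s,F)$ is the system of all $\langle s,F\rangle$-observable semisets. Reals: for $p,q\in Q$, $p\doteq q$ iff ($p,q\in BQ$ and $|p-q|<1/i$ for all $0<i\in FN$), or $p,q$ are both greater than every $k\in FN$, or both less than $-k$ for every $k\in FN$. $\mathrm{mon}(q)=\{s\in Q:s\doteq q\}$, $R=BQ/\doteq$, and $\infty=\{q\in Q:(\forall i)\,q>i\}$. $\lim_{i}\mathrm{mon}(a_i)=\mathrm{mon}(x)$ means: for each nonzero $q\in FQ$ there is $i$ with $|a_j-x|<|q|$ for all $j>i$; or $x>q$ for all $q\in FQ$ and for each $q\in FQ$, eventually $a_j>q$; or the same with $<$. The Kalina measure $m_{s,F}:\mathscr{O}(s,F)\to R\cup\{\infty\}$ is $m_{s,F}(B)=\lim_{i\in FN}\mathrm{mon}\left(\frac{b_i}{s_i}\right)$,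 where $F(B)=(b_i)$. The word "measure" refers to this function (no $\sigma$-additivity is asserted); nondecreasing means $B\subseteq C$ implies $m_{s,F}(B)\le m_{s,F}(C)$. *)

theory Defs
  imports Main
begin

text \<open>
  Alternative Set Theory is embedded as follows. The sets are the elements of a type of
  class \<open>ast\<close>, with a membership relation; the classes are the HOL sets over that type, so
  that extensionality and full comprehension for classes, as well as the axiom of choice
  (extensional coding, see below), come from HOL. Functions and relations that are classes are
  HOL functions and relations; systems of classes are HOL sets of HOL sets.
\<close>

section \<open>Set formulas\<close>

text \<open>Formulas quantifying only over sets, with de Bruijn indices; the parameters sit in the
  environment.\<close>

datatype set_formula =
    FMem nat nat
  | FEq nat nat
  | FNeg set_formula
  | FConj set_formula set_formula
  | FAll set_formula

primrec sat :: "('a \<Rightarrow> 'a \<Rightarrow> bool) \<Rightarrow> (nat \<Rightarrow> 'a) \<Rightarrow> set_formula \<Rightarrow> bool" where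
  "sat E e (FMem i j) = E (e i) (e j)"
| "sat E e (FEq i j) = (e i = e j)"
| "sat E e (FNeg p) = (\<not> sat E e p)"
| "sat E e (FConj p q) = (sat E e p \<and> sat E e q)"
| "sat E e (FAll p) = (\<forall>x. sat E (case_nat x e) p)"


section \<open>The axioms\<close>

class membership =
  fixes mem :: "'a \<Rightarrow> 'a \<Rightarrow> bool"  (infix "\<in>\<^sub>V" 50)
begin

definition elts :: "'a \<Rightarrow> 'a set" where
  "elts x = {z. z \<in>\<^sub>V x}"

definition is_set :: "'a set \<Rightarrow> bool" where
  "is_set X \<longleftrightarrow> (\<exists>x. elts x = X)"

definition the_set :: "'a set \<Rightarrow> 'a" where
  "the_set X = (THE x. elts x = X)"

definition semiset :: "'a set \<Rightarrow> bool" where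
  "semiset X \<longleftrightarrow> (\<exists>u. X \<subseteq> elts u)"

definition set_definable :: "'a set \<Rightarrow> bool" where
  "set_definable X \<longleftrightarrow> (\<exists>\<phi> e. X = {x. sat mem (case_nat x e) \<phi>})"

definition vempty :: 'a where
  "vempty = the_set {}"

definition vsucc :: "'a \<Rightarrow> 'a" where
  "vsucc x = the_set (insert x (elts x))"

definition opair :: "'a \<Rightarrow> 'a \<Rightarrow> 'a" where
  "opair x y = the_set {the_set {x}, the_set {x, y}}"

definition set_fun :: "'a \<Rightarrow> bool" where
  "set_fun f \<longleftrightarrow> (\<forall>p \<in> elts f. \<exists>x y. p = opair x y) \<and>
     (\<forall>x y z. opair x y \<in>\<^sub>V f \<longrightarrow> opair x z \<in>\<^sub>V f \<longrightarrow> y = z)"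

definition set_inj :: "'a \<Rightarrow> bool" where
  "set_inj f \<longleftrightarrow> set_fun f \<and> (\<forall>x y z. opair x z \<in>\<^sub>V f \<longrightarrow> opair y z \<in>\<^sub>V f \<longrightarrow> x = y)"

definition vdom :: "'a \<Rightarrow> 'a set" where
  "vdom f = {x. \<exists>y. opair x y \<in>\<^sub>V f}"

definition vrng :: "'a \<Rightarrow> 'a set" where
  "vrng f = {y. \<exists>x. opair x y \<in>\<^sub>V f}"

text \<open>Transitive sets linearly ordered by membership are the von Neumann ordinals; as the axiom
  of infinity is negated, these are just the natural numbers.\<close>

definition NN :: "'a set" where
  "NN = {n. (\<forall>x \<in> elts n. elts x \<subseteq> elts n) \<and>
            (\<forall>x \<in> elts n. \<forall>y \<in> elts n. x \<in>\<^sub>V y \<or> x = y \<or> y \<in>\<^sub>V x)}"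

definition FN :: "'a set" where
  "FN = {n \<in> NN. \<forall>X. X \<subseteq> elts n \<longrightarrow> is_set X}"

definition ast_uncountable :: "'a set \<Rightarrow> bool" where
  "ast_uncountable X \<longleftrightarrow> \<not> (\<exists>f. inj_on f X \<and> f ` X \<subseteq> FN)"

end

text \<open>The induction schema follows from the preceding axioms; it is listed because it is the
  customary axiom of the theory.\<close>

class ast = membership +
  assumes set_ext: "elts x = elts y \<Longrightarrow> x = y"
    and empty_set: "is_set {}"
    and pairing: "is_set {x, y}"
    and union: "is_set (\<Union>y \<in> elts x. elts y)"
    and power_set: "is_set {y. elts y \<subseteq> elts x}"
    and replacement:
      "(\<And>x y z. x \<in>\<^sub>V a \<Longrightarrow> sat mem (case_nat x (case_nat y e)) \<phi> \<Longrightarrow>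
          sat mem (case_nat x (case_nat z e)) \<phi> \<Longrightarrow> y = z) \<Longrightarrow>
       is_set {y. \<exists>x. x \<in>\<^sub>V a \<and> sat mem (case_nat x (case_nat y e)) \<phi>}"
    and foundation: "elts x \<noteq> {} \<Longrightarrow> \<exists>y \<in> elts x. elts y \<inter> elts x = {}"
    and no_infinity: "\<not> (\<exists>x. vempty \<in>\<^sub>V x \<and> (\<forall>y \<in> elts x. vsucc y \<in>\<^sub>V x))"
    and set_induction:
      "sat mem (case_nat vempty e) \<phi> \<Longrightarrow>
       (\<And>x y. sat mem (case_nat x e) \<phi> \<Longrightarrow>
          sat mem (case_nat (the_set (insert y (elts x))) e) \<phi>) \<Longrightarrow>
       sat mem (case_nat x e) \<phi>"
    and prolongation: "\<exists>f. set_fun f \<and> (\<forall>n \<in> FN. opair n (g n) \<in>\<^sub>V f)"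
    and two_cardinalities:
      "ast_uncountable X \<Longrightarrow> ast_uncountable Y \<Longrightarrow> \<exists>h. bij_betw h X Y"

text \<open>Extensional coding holds outright: \<open>S\<close> codes the system \<open>S ` K\<close> of classes.\<close>

lemma extensional_coding:
  fixes S :: "'a::ast \<Rightarrow> 'a set"
  shows "\<exists>K' \<subseteq> K. inj_on S K' \<and> S ` K' = S ` K"
  by (metis subset_image_inj order_refl)


section \<open>Borel classes\<close>

inductive sigma_class :: "'a::ast \<Rightarrow> 'a set \<Rightarrow> bool"
  and pi_class :: "'a::ast \<Rightarrow> 'a set \<Rightarrow> bool"
where
  sigma_zero: "set_definable X \<Longrightarrow> sigma_class vempty X"
| pi_zero: "set_definable X \<Longrightarrow> pi_class vempty X"
| sigma_union:
    "a \<in> FN \<Longrightarrow> a \<noteq> vempty \<Longrightarrow> (\<forall>i \<in> (FN :: 'a set). \<exists>b. b \<in>\<^sub>V a \<and> pi_class b (Y i)) \<Longrightarrow>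
     sigma_class a (\<Union>i \<in> (FN :: 'a set). Y i)"
| pi_inter:
    "a \<in> FN \<Longrightarrow> a \<noteq> vempty \<Longrightarrow> (\<forall>i \<in> (FN :: 'a set). \<exists>b. b \<in>\<^sub>V a \<and> sigma_class b (Y i)) \<Longrightarrow>
     pi_class a (\<Inter>i \<in> (FN :: 'a set). Y i)"

definition borel_class :: "'a::ast set \<Rightarrow> bool" where
  "borel_class X \<longleftrightarrow> (\<exists>a \<in> FN. sigma_class a X \<or> pi_class a X)"

definition borel_semisets :: "'a::ast set set" where
  "borel_semisets = {X. borel_class X \<and> semiset X}"


section \<open>Natural and rational numbers\<close>

definition set_equinumerous :: "'a::ast \<Rightarrow> 'a \<Rightarrow> bool" where
  "set_equinumerous x y \<longleftrightarrow> (\<exists>f. set_inj f \<and> vdom f = elts x \<and> vrng f = elts y)"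

definition nat_add :: "'a::ast \<Rightarrow> 'a \<Rightarrow> 'a" where
  "nat_add m n = (THE k. k \<in> NN \<and> set_equinumerous k
     (the_set (opair vempty ` elts m \<union> opair (vsucc vempty) ` elts n)))"

definition nat_mult :: "'a::ast \<Rightarrow> 'a \<Rightarrow> 'a" where
  "nat_mult m n = (THE k. k \<in> NN \<and> set_equinumerous k
     (the_set {opair x y | x y. x \<in>\<^sub>V m \<and> y \<in>\<^sub>V n}))"

definition nat_le :: "'a::ast \<Rightarrow> 'a \<Rightarrow> bool" where
  "nat_le m n \<longleftrightarrow> m \<in>\<^sub>V n \<or> m = n"

text \<open>The triple \<open>(a, b, c)\<close> with \<open>c \<noteq> 0\<close> stands for \<open>(a - b) / c\<close>. Rationals are equivalence
  classes of such triples.\<close>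

definition frac_triples :: "('a::ast \<times> 'a \<times> 'a) set" where
  "frac_triples = {(a, b, c). a \<in> NN \<and> b \<in> NN \<and> c \<in> NN \<and> c \<noteq> vempty}"

definition frac_class :: "'a::ast \<times> 'a \<times> 'a \<Rightarrow> ('a \<times> 'a \<times> 'a) set" where
  "frac_class = (\<lambda>(a, b, c). {(a', b', c'). (a', b', c') \<in> frac_triples \<and>
     nat_add (nat_mult a c') (nat_mult b' c) = nat_add (nat_mult a' c) (nat_mult b c')})"

lemma vempty_in_NN: "(vempty :: 'a::ast) \<in> NN"
  and vone_in_NN: "vsucc (vempty :: 'a) \<in> NN"
  and vone_neq_vempty: "vsucc (vempty :: 'a) \<noteq> vempty"
proof -
  have the: "elts (the_set X) = X" if "is_set X" for X :: "'a set"
    using that unfolding is_set_def the_set_def by (metis (mono_tags, lifting) set_ext theI')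
  have 0: "elts (vempty :: 'a) = {}"
    unfolding vempty_def by (rule the[OF empty_set])
  have 1: "elts (vsucc (vempty :: 'a)) = {vempty}"
    unfolding vsucc_def 0 by (rule the) (use pairing[of vempty vempty] in simp)
  show "(vempty :: 'a) \<in> NN" "vsucc (vempty :: 'a) \<in> NN" "vsucc (vempty :: 'a) \<noteq> vempty"
    using 0 1 unfolding NN_def by auto
qed

typedef (overloaded) 'a hrat = "frac_class ` (frac_triples :: ('a::ast \<times> 'a \<times> 'a) set)"
  using vempty_in_NN vone_in_NN vone_neq_vempty unfolding frac_triples_def by blast

definition hrat :: "'a::ast \<times> 'a \<times> 'a \<Rightarrow> 'a hrat" where
  "hrat t = Abs_hrat (frac_class t)"

definition frac_rep :: "'a::ast hrat \<Rightarrow> 'a \<times> 'a \<times> 'a" where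
  "frac_rep q = (SOME t. t \<in> frac_triples \<and> q = hrat t)"

definition of_N :: "'a::ast \<Rightarrow> 'a hrat" where
  "of_N n = hrat (n, vempty, vsucc vempty)"

instantiation hrat :: (ast) "{zero, one, plus, minus, uminus, times, inverse, ord, abs, sgn}"
begin

definition "(0 :: 'a hrat) = of_N vempty"

definition "(1 :: 'a hrat) = of_N (vsucc vempty)"

definition "(p :: 'a hrat) + q = (case (frac_rep p, frac_rep q) of ((a, b, c), (a', b', c')) \<Rightarrow>
  hrat (nat_add (nat_mult a c') (nat_mult a' c), nat_add (nat_mult b c') (nat_mult b' c),
    nat_mult c c'))"

definition "- (p :: 'a hrat) = (case frac_rep p of (a, b, c) \<Rightarrow> hrat (b, a, c))"

definition "(p :: 'a hrat) - q = p + (- q)"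

definition "(p :: 'a hrat) * q = (case (frac_rep p, frac_rep q) of ((a, b, c), (a', b', c')) \<Rightarrow>
  hrat (nat_add (nat_mult a a') (nat_mult b b'), nat_add (nat_mult a b') (nat_mult b a'),
    nat_mult c c'))"

definition "inverse (p :: 'a hrat) = (if p = 0 then 0 else (THE q. p * q = 1))"

definition "(p :: 'a hrat) div q = p * inverse q"

definition "(p :: 'a hrat) \<le> q \<longleftrightarrow> (case (frac_rep p, frac_rep q) of ((a, b, c), (a', b', c')) \<Rightarrow>
  nat_le (nat_add (nat_mult a c') (nat_mult b' c)) (nat_add (nat_mult a' c) (nat_mult b c')))"

definition "(p :: 'a hrat) < q \<longleftrightarrow> p \<le> q \<and> \<not> q \<le> p"

definition "\<bar>p :: 'a hrat\<bar> = (if p < 0 then - p else p)"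

definition "sgn (p :: 'a hrat) = (if p = 0 then 0 else if 0 < p then 1 else - 1)"

instance ..

end

definition Q_plus :: "'a::ast hrat set" where
  "Q_plus = {x. 0 \<le> x}"

definition FQ :: "'a::ast hrat set" where
  "FQ = {q. \<exists>x \<in> FN. \<exists>y \<in> FN. y \<noteq> vempty \<and> (q = of_N x / of_N y \<or> q = - (of_N x / of_N y))}"

definition BQ :: "'a::ast hrat set" where
  "BQ = {x. \<exists>i \<in> FN. \<bar>x\<bar> \<le> of_N i}"


section \<open>Cuts\<close>

definition is_cut :: "'a::ast hrat set \<Rightarrow> bool" where
  "is_cut A \<longleftrightarrow> A \<subseteq> Q_plus \<and> (\<forall>x \<in> A. \<forall>y \<in> Q_plus. y \<le> x \<longrightarrow> y \<in> A) \<and>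
     (\<forall>x \<in> A. \<exists>y \<in> A. x < y)"

definition below :: "'a::ast hrat \<Rightarrow> 'a hrat set" where
  "below q = {x \<in> Q_plus. x < q}"

definition FN_cut :: "'a::ast hrat set" where
  "FN_cut = (\<Union>n \<in> FN. below (of_N n))"

definition inv_FN_cut :: "'a::ast hrat set" where
  "inv_FN_cut = (\<Inter>n \<in> FN - {vempty}. below (1 / of_N n))"

definition external_sum :: "'a::ast hrat set \<Rightarrow> 'a hrat set \<Rightarrow> 'a hrat set" where
  "external_sum A B = {x \<in> Q_plus. \<forall>a \<in> Q_plus - A. \<forall>b \<in> Q_plus - B. x < a + b}"

definition internal_sum :: "'a::ast hrat set \<Rightarrow> 'a hrat set \<Rightarrow> 'a hrat set" where
  "internal_sum A B = {x \<in> Q_plus. \<exists>a \<in> A. \<exists>b \<in> B. x < a + b}"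

definition additive_cut :: "'a::ast hrat set \<Rightarrow> bool" where
  "additive_cut A \<longleftrightarrow> is_cut A \<and> external_sum A A = A \<and> internal_sum A A = A"

definition nonadditive_cut :: "'a::ast hrat set \<Rightarrow> bool" where
  "nonadditive_cut A \<longleftrightarrow> is_cut A \<and> \<not> additive_cut A"

definition add_min_compl :: "'a::ast hrat set \<Rightarrow> 'a hrat set" where
  "add_min_compl B = B \<union> {m \<in> Q_plus - B. \<forall>x \<in> Q_plus - B. m \<le> x}"

definition internal_diff :: "'a::ast hrat set \<Rightarrow> 'a hrat set \<Rightarrow> 'a hrat set"
    (infixl "\<ominus>" 65) where
  "A \<ominus> B = {x \<in> Q_plus. \<forall>b \<in> add_min_compl B. x + b \<in> A}"

definition cut_near :: "'a::ast hrat set \<Rightarrow> 'a hrat set \<Rightarrow> bool" where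
  "cut_near A B \<longleftrightarrow> (A \<ominus> B) \<union> (B \<ominus> A) \<subseteq> inv_FN_cut \<or> FN_cut \<subseteq> A \<inter> B"

definition smaller :: "'a::ast \<Rightarrow> 'a \<Rightarrow> bool" where
  "smaller n u \<longleftrightarrow> (\<exists>f. set_inj f \<and> vdom f = elts n \<and> vrng f \<subset> elts u)"

definition lower_cut :: "'a::ast set \<Rightarrow> 'a hrat set" where
  "lower_cut X = {q \<in> Q_plus. \<exists>n \<in> NN. \<exists>u. elts u \<subseteq> X \<and> smaller n u \<and> q < of_N n}"

definition upper_cut :: "'a::ast set \<Rightarrow> 'a hrat set" where
  "upper_cut X = {q \<in> Q_plus. \<exists>n \<in> NN. (\<forall>u. X \<subseteq> elts u \<longrightarrow> smaller n u) \<and> q < of_N n}"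


section \<open>Approximating sequences and observable semisets\<close>

text \<open>Sequences are functions whose values matter only at arguments in \<open>FN\<close>.\<close>

definition liminf_seq :: "('a::ast \<Rightarrow> 'b set) \<Rightarrow> 'b set" where
  "liminf_seq s = (\<Union>i \<in> FN. \<Inter>j \<in> {j \<in> FN. nat_le i j}. s j)"

definition limsup_seq :: "('a::ast \<Rightarrow> 'b set) \<Rightarrow> 'b set" where
  "limsup_seq s = (\<Inter>i \<in> FN. \<Union>j \<in> {j \<in> FN. nat_le i j}. s j)"

definition approximating_sequence :: "'a::ast set \<Rightarrow> ('a \<Rightarrow> 'a hrat set) \<Rightarrow> bool" where
  "approximating_sequence X s \<longleftrightarrow> (\<forall>i \<in> FN. \<exists>n \<in> NN. s i = below (of_N n)) \<and>
     liminf_seq s = lower_cut X \<and> limsup_seq s = upper_cut X"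

definition BAF :: "('a::ast set \<Rightarrow> 'a \<Rightarrow> 'a hrat set) \<Rightarrow> bool" where
  "BAF F \<longleftrightarrow> (\<forall>A \<in> borel_semisets. approximating_sequence A (F A))"

text \<open>Only meaningful for cuts of the form \<open>below q\<close> with \<open>q \<ge> 0\<close>, which determine \<open>q\<close>.\<close>

definition cut_value :: "'a::ast hrat set \<Rightarrow> 'a hrat" where
  "cut_value A = (THE q. 0 \<le> q \<and> A = below q)"

text \<open>A ratio with denominator \<open>below 0\<close> is undefined mathematically; here it takes the value of
  division by zero. An approximating sequence of a semiset with a nonadditive lower cut has only
  finitely many such terms, and these do not affect any limit below.\<close>

definition ratio :: "('a::ast \<Rightarrow> 'a hrat set) \<Rightarrow> ('a \<Rightarrow> 'a hrat set) \<Rightarrow> 'a \<Rightarrow> 'a hrat" where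
  "ratio b s i = cut_value (b i) / cut_value (s i)"

definition observable :: "('a::ast \<Rightarrow> 'a hrat set) \<Rightarrow> ('a set \<Rightarrow> 'a \<Rightarrow> 'a hrat set) \<Rightarrow> 'a set set"
    ("\<O>") where
  "\<O> s F = {B \<in> borel_semisets. cut_near (liminf_seq (\<lambda>i. below (ratio (F B) s i)))
                                        (limsup_seq (\<lambda>i. below (ratio (F B) s i)))}"


section \<open>Reals and the Kalina measure\<close>

definition rat_near :: "'a::ast hrat \<Rightarrow> 'a hrat \<Rightarrow> bool" where
  "rat_near p q \<longleftrightarrow>
     (p \<in> BQ \<and> q \<in> BQ \<and> (\<forall>i \<in> FN - {vempty}. \<bar>p - q\<bar> < 1 / of_N i)) \<or>
     (\<forall>k \<in> FN. of_N k < p \<and> of_N k < q) \<or>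
     (\<forall>k \<in> FN. p < - of_N k \<and> q < - of_N k)"

definition mon :: "'a::ast hrat \<Rightarrow> 'a hrat set" where
  "mon q = {s. rat_near s q}"

definition monad_reals :: "'a::ast hrat set set" where
  "monad_reals = mon ` BQ"

definition infinite_monad :: "'a::ast hrat set" where
  "infinite_monad = {q. \<forall>i \<in> FN. of_N i < q}"

text \<open>Order of monads, as induced from the order of the rationals.\<close>

definition mon_le :: "'a::ast hrat set \<Rightarrow> 'a hrat set \<Rightarrow> bool" where
  "mon_le X Y \<longleftrightarrow> (\<exists>x \<in> X. \<exists>y \<in> Y. x \<le> y)"

definition seq_lim :: "('a::ast \<Rightarrow> 'a hrat) \<Rightarrow> 'a hrat \<Rightarrow> bool" where
  "seq_lim a x \<longleftrightarrow>
     (\<forall>q \<in> FQ - {0}. \<exists>i \<in> FN. \<forall>j \<in> FN. i \<in>\<^sub>V j \<longrightarrow> \<bar>a j - x\<bar> < \<bar>q\<bar>) \<or>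
     ((\<forall>q \<in> FQ. q < x) \<and> (\<forall>q \<in> FQ. \<exists>i \<in> FN. \<forall>j \<in> FN. i \<in>\<^sub>V j \<longrightarrow> q < a j)) \<or>
     ((\<forall>q \<in> FQ. x < q) \<and> (\<forall>q \<in> FQ. \<exists>i \<in> FN. \<forall>j \<in> FN. i \<in>\<^sub>V j \<longrightarrow> a j < q))"

definition mon_lim :: "('a::ast \<Rightarrow> 'a hrat) \<Rightarrow> 'a hrat set \<Rightarrow> bool" where
  "mon_lim a r \<longleftrightarrow> (\<exists>x. r = mon x \<and> seq_lim a x)"

definition kalina :: "('a::ast \<Rightarrow> 'a hrat set) \<Rightarrow> ('a set \<Rightarrow> 'a \<Rightarrow> 'a hrat set) \<Rightarrow>
    'a set \<Rightarrow> 'a hrat set" where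
  "kalina s F B = (THE r. mon_lim (ratio (F B) s) r)"

end

theory Submission
  imports Defs "HOL-Library.Nat_Bijection" "HOL-Computational_Algebra.Fraction_Field"
begin

text \<open>
  Everything is measured in one unit. As the lower cut \<open>L\<close> of \<open>S\<close> is nonadditive, there is a
  rational \<open>t \<in> L\<close> with \<open>2 t \<notin> L\<close> (\<open>nonadditive_lower_cut_unit\<close>); both failures of
  additivity, that of the external and that of the internal sum, produce such a \<open>t\<close>, and \<open>t\<close> is at
  least \<open>1/2\<close> because sizes of sets are natural numbers. The heart of the proof is that the
  normalised counting measure \<open>|u| / t\<close> cannot distinguish the lower from the upper cut of a
  Borel semiset \<open>B\<close>: if \<open>q\<close> is a finite multiple of \<open>t\<close> in the upper cut, then \<open>q - t/M\<close>, if
  nonnegative, is in the lower cut for each nonzero \<open>M \<in> FN\<close> (\<open>upper_cut_near_lower_cut\<close>).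
  Therefore the terms \<open>b\<^sub>i / t\<close> of an approximating sequence of \<open>B\<close>, which are eventually
  squeezed between the two cuts, either form a Cauchy sequence or exceed every finite number
  (\<open>scaled_approximation_converges\<close>, \<open>scaled_approximation_diverges\<close>). The same holds for
  \<open>s\<^sub>i / t\<close>, where the choice of \<open>t\<close> excludes infinite and infinitesimal limits
  (\<open>nonadditive_denominator\<close>), so that \<open>b\<^sub>i / s\<^sub>i\<close> has a limit in \<open>R \<union> {\<infinity>}\<close>. Convergence gives
  observability, and monotonicity of lower cuts in \<open>B\<close> gives monotonicity of the limit.

  The comparison of the cuts is Choquet's capacitability theorem (\<open>capacitability\<close>), applied to
  the outer measure given by the sizes of the sets that include a class. Borel classes are kernels
  of Souslin schemes of set-definable classes (\<open>borel_imp_souslin\<close>): this family contains the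
  set-definable classes and is closed under unions and intersections over \<open>FN\<close>. Two continuity
  properties of the outer measure are needed. A rising sequence of classes with outer measures
  below \<open>p\<close> has a union of outer measure at most \<open>p + \<epsilon>\<close>, for \<open>\<epsilon>\<close> not infinitesimal relative to
  \<open>p\<close> (\<open>rising_union_hull\<close>); this is what allows one to bound the branching of a scheme level by
  level. A descending sequence of sets of sizes at least \<open>p\<close> includes a set of size at least \<open>p\<close>
  (\<open>decreasing_sets_core\<close>). Both use the prolongation axiom in the form of countable saturation
  (\<open>saturation\<close>). The theorem covers sets of infinite measure as well, which is what yields the
  value \<open>\<infinity>\<close>.

  All of this takes place over the natural and rational numbers of the theory, whose operations
  are defined by equinumerosity of sets. That they form an ordered field is derived from the
  axioms. Induction and separation are available only for set formulas, so a calculus of definable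
  predicates and terms comes first. The class \<open>FN\<close> turns out to be the image of the natural
  numbers of HOL (\<open>FN_eq\<close>), and sequences over \<open>FN\<close> are treated as ordinary sequences.
\<close>


section \<open>Definability\<close>

primrec rename :: "(nat \<Rightarrow> nat) \<Rightarrow> set_formula \<Rightarrow> set_formula" where
  "rename r (FMem i j) = FMem (r i) (r j)"
| "rename r (FEq i j) = FEq (r i) (r j)"
| "rename r (FNeg p) = FNeg (rename r p)"
| "rename r (FConj p q) = FConj (rename r p) (rename r q)"
| "rename r (FAll p) = FAll (rename (case_nat 0 (\<lambda>i. Suc (r i))) p)"

lemma sat_rename: "sat E e (rename r p) = sat E (\<lambda>i. e (r i)) p"
proof (induction p arbitrary: e r)
  case (FAll p)
  have "(\<lambda>i. case_nat x e (case_nat 0 (\<lambda>i. Suc (r i)) i)) = case_nat x (\<lambda>i. e (r i))" for x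
    by (auto simp: fun_eq_iff split: nat.splits)
  then show ?case by (simp add: FAll)
qed auto

text \<open>The environment \<open>v\<close> carries the variables of a predicate in the style of de Bruijn. The map
  \<open>t\<close> sends each index of the formula to such a variable or to a parameter; this freedom makes it
  easy to combine formulas that use different parameters.\<close>

definition definable :: "((nat \<Rightarrow> 'a::ast) \<Rightarrow> bool) \<Rightarrow> bool" where
  "definable P \<longleftrightarrow>
     (\<exists>\<phi> t. \<forall>v. P v = sat mem (\<lambda>i. case t i of Inl j \<Rightarrow> v j | Inr c \<Rightarrow> c) \<phi>)"

text \<open>A term is definable through its graph. The value is variable \<open>0\<close>, and the variables of the
  term are shifted by one.\<close>

definition definable_term :: "((nat \<Rightarrow> 'a::ast) \<Rightarrow> 'a) \<Rightarrow> bool" where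
  "definable_term t \<longleftrightarrow> definable (\<lambda>v. v 0 = t (\<lambda>i. v (Suc i)))"

named_theorems def_intros

lemma definable_not [def_intros]: "definable P \<Longrightarrow> definable (\<lambda>v. \<not> P v)"
  unfolding definable_def by (metis sat.simps(3))

text \<open>The indices of the two formulas are made disjoint by sending them to the even and to the odd
  numbers.\<close>

lemma definable_and [def_intros]:
  assumes "definable P" "definable R"
  shows "definable (\<lambda>v. P v \<and> R v)"
proof -
  from assms obtain \<phi> t \<psi> s where
    P: "\<And>v. P v = sat mem (\<lambda>i. case t i of Inl j \<Rightarrow> v j | Inr c \<Rightarrow> c) \<phi>" and
    R: "\<And>v. R v = sat mem (\<lambda>i. case s i of Inl j \<Rightarrow> v j | Inr c \<Rightarrow> c) \<psi>"
    unfolding definable_def by metis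
  define u where "u i = (if even i then t (i div 2) else s (i div 2))" for i
  have "(P v \<and> R v) = sat mem (\<lambda>i. case u i of Inl j \<Rightarrow> v j | Inr c \<Rightarrow> c)
      (FConj (rename (\<lambda>i. 2 * i) \<phi>) (rename (\<lambda>i. 2 * i + 1) \<psi>))" for v
    by (simp add: sat_rename u_def P R)
  then show ?thesis unfolding definable_def by blast
qed

text \<open>The bound variable must become index \<open>0\<close> of the formula; all other indices move up by one.\<close>

lemma definable_all [def_intros]:
  assumes "definable (\<lambda>v. P (v 0) (\<lambda>i. v (Suc i)))"
  shows "definable (\<lambda>v. \<forall>x. P x v)"
proof -
  from assms obtain \<phi> t where
    P: "\<And>v. P (v 0) (\<lambda>i. v (Suc i)) = sat mem (\<lambda>i. case t i of Inl j \<Rightarrow> v j | Inr c \<Rightarrow> c) \<phi>"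
    unfolding definable_def by metis
  define r where "r i = (case t i of Inl j \<Rightarrow> (case j of 0 \<Rightarrow> 0 | Suc _ \<Rightarrow> Suc i) | Inr c \<Rightarrow> Suc i)" for i
  define s where "s i = (case t i of Inl j \<Rightarrow> Inl (j - 1) | Inr c \<Rightarrow> Inr c)" for i
  have "(\<forall>x. P x v) = sat mem (\<lambda>i. case s i of Inl j \<Rightarrow> v j | Inr c \<Rightarrow> c) (FAll (rename r \<phi>))" for v
  proof -
    have "P x v = sat mem (\<lambda>i. case t i of Inl j \<Rightarrow> case_nat x v j | Inr c \<Rightarrow> c) \<phi>" for x
      using P[of "case_nat x v"] by simp
    moreover have "(\<lambda>i. case t i of Inl j \<Rightarrow> case_nat x v j | Inr c \<Rightarrow> c) =
       (\<lambda>i. case_nat x (\<lambda>i. case s i of Inl j \<Rightarrow> v j | Inr c \<Rightarrow> c) (r i))" for x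
      by (auto simp: r_def s_def fun_eq_iff split: nat.splits sum.splits)
    ultimately show ?thesis by (simp add: sat_rename)
  qed
  then show ?thesis unfolding definable_def by blast
qed

lemma definable_ex [def_intros]:
  assumes "definable (\<lambda>v. P (v 0) (\<lambda>i. v (Suc i)))"
  shows "definable (\<lambda>v. \<exists>x. P x v)"
  using definable_not[OF definable_all[where P = "\<lambda>x v. \<not> P x v", OF definable_not[OF assms]]]
  by simp

lemma definable_or [def_intros]:
  "definable P \<Longrightarrow> definable R \<Longrightarrow> definable (\<lambda>v. P v \<or> R v)"
  using definable_not[OF definable_and[of "\<lambda>v. \<not> P v" "\<lambda>v. \<not> R v", OF definable_not definable_not]]
  by simp

lemma definable_imp [def_intros]:
  "definable P \<Longrightarrow> definable R \<Longrightarrow> definable (\<lambda>v. P v \<longrightarrow> R v)"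
  unfolding imp_conv_disj by (intro definable_or definable_not)

lemma definable_iff [def_intros]:
  "definable P \<Longrightarrow> definable R \<Longrightarrow> definable (\<lambda>v. P v = R v)"
  unfolding iff_conv_conj_imp by (intro definable_and definable_imp)

lemma definable_var_eq: "definable (\<lambda>v. v i = v j)"
  unfolding definable_def
  by (rule exI[of _ "FEq 0 1"], rule exI[of _ "\<lambda>k. if k = 0 then Inl i else Inl j"]) simp

lemma definable_var_mem: "definable (\<lambda>v. v i \<in>\<^sub>V v j)"
  unfolding definable_def
  by (rule exI[of _ "FMem 0 1"], rule exI[of _ "\<lambda>k. if k = 0 then Inl i else Inl j"]) simp

lemma definable_const_eq: "definable (\<lambda>v. v i = c)"
  unfolding definable_def
  by (rule exI[of _ "FEq 0 1"], rule exI[of _ "\<lambda>k. if k = 0 then Inl i else Inr c"]) simp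

lemma definable_term_var [def_intros]: "definable_term (\<lambda>v. v i)"
  unfolding definable_term_def by (rule definable_var_eq)

lemma definable_term_const [def_intros]: "definable_term (\<lambda>v. c)"
  unfolding definable_term_def by (rule definable_const_eq)

lemma definable_rename:
  assumes "definable P"
  shows "definable (\<lambda>v. P (\<lambda>i. v (r i)))"
proof -
  from assms obtain \<phi> t where
    P: "\<And>v. P v = sat mem (\<lambda>i. case t i of Inl j \<Rightarrow> v j | Inr c \<Rightarrow> c) \<phi>"
    unfolding definable_def by metis
  have "P (\<lambda>i. v (r i)) =
      sat mem (\<lambda>i. case (case t i of Inl j \<Rightarrow> Inl (r j) | Inr c \<Rightarrow> Inr c) of Inl j \<Rightarrow> v j | Inr c \<Rightarrow> c) \<phi>" for v
    unfolding P by (intro arg_cong2[where f = "sat mem"] ext) (auto split: sum.splits)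
  then show ?thesis unfolding definable_def by (intro exI allI)
qed

text \<open>The substitution is expressed by \<open>\<exists>x. x = t v \<and> P x v\<close>.\<close>

lemma definable_subst:
  assumes "definable (\<lambda>v. P (v 0) (\<lambda>i. v (Suc i)))" "definable_term t"
  shows "definable (\<lambda>v. P (t v) v)"
proof -
  have "definable (\<lambda>v. \<exists>x. x = t v \<and> P x v)"
    by (rule definable_ex, rule definable_and[OF assms(2)[unfolded definable_term_def] assms(1)])
  then show ?thesis by simp
qed

lemma definable_term_shift:
  "definable_term t \<Longrightarrow> definable_term (\<lambda>v. t (\<lambda>i. v (r i)))"
  unfolding definable_term_def
  using definable_rename[of "\<lambda>v. v 0 = t (\<lambda>i. v (Suc i))" "case_nat 0 (\<lambda>i. Suc (r i))"] by simp

lemma definable_app1: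
  assumes "definable (\<lambda>v. P (v 0))" "definable_term t"
  shows "definable (\<lambda>v. P (t v))"
  by (rule definable_subst[where P = "\<lambda>x v. P x", OF assms])

lemma definable_app2:
  assumes "definable (\<lambda>v. P (v 0) (v 1))" "definable_term s" "definable_term t"
  shows "definable (\<lambda>v. P (s v) (t v))"
proof -
  have "definable (\<lambda>v. P (v 0) (t (\<lambda>i. v (Suc i))))"
    by (rule definable_subst[where P = "\<lambda>y v. P (v 0) y", OF _ definable_term_shift[OF assms(3)]])
      (use definable_rename[OF assms(1), of "\<lambda>i. if i = 0 then 1 else 0"] in simp)
  then show ?thesis by (rule definable_subst[OF _ assms(2)])
qed

lemma definable_eq [def_intros]:
  "definable_term s \<Longrightarrow> definable_term t \<Longrightarrow> definable (\<lambda>v. s v = t v)"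
  by (rule definable_app2[where P = "(=)"]) (rule definable_var_eq)

lemma definable_mem [def_intros]:
  "definable_term s \<Longrightarrow> definable_term t \<Longrightarrow> definable (\<lambda>v. s v \<in>\<^sub>V t v)"
  by (rule definable_app2[where P = mem]) (rule definable_var_mem)

lemma definable_elts [def_intros]:
  "definable_term s \<Longrightarrow> definable_term t \<Longrightarrow> definable (\<lambda>v. s v \<in> elts (t v))"
  unfolding elts_def mem_Collect_eq by (rule definable_mem)

lemma definable_const [def_intros]: "definable (\<lambda>v. b)"
  using definable_const_eq[of 0 undefined] definable_imp[of "\<lambda>v. v 0 = undefined" "\<lambda>v. v 0 = undefined"]
    definable_not[of "\<lambda>_. True"]
  by (cases b) auto

lemma definable_term_app1:
  assumes "definable_term (\<lambda>v. f (v 0))" "definable_term t"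
  shows "definable_term (\<lambda>v. f (t v))"
  unfolding definable_term_def
  using definable_app2[where P = "\<lambda>x y. y = f x", OF _ definable_term_shift[OF assms(2), of Suc] definable_term_var[of 0]]
    definable_rename[OF assms(1)[unfolded definable_term_def], of "\<lambda>i. if i = 0 then 1 else 0"] by simp

lemma definable_term_app2:
  assumes "definable_term (\<lambda>v. f (v 0) (v 1))" "definable_term s" "definable_term t"
  shows "definable_term (\<lambda>v. f (s v) (t v))"
proof -
  have "definable (\<lambda>v. v 0 = f (v 1) (v 2))"
    using assms(1) unfolding definable_term_def by (simp add: numeral_2_eq_2)
  from definable_rename[OF this, of "\<lambda>i. 2 - i"]
  have "definable (\<lambda>v. v (Suc (Suc 0)) = f (v (Suc 0)) (v 0))"
    by (simp add: numeral_2_eq_2)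
  then have "definable (\<lambda>v. v (Suc 0) = f (v 0) (t (\<lambda>i. v (Suc (Suc i)))))"
    by (rule definable_subst[where P = "\<lambda>y v. v (Suc 0) = f (v 0) y"])
      (rule definable_term_shift[OF assms(3)])
  then have "definable (\<lambda>v. v 0 = f (s (\<lambda>i. v (Suc i))) (t (\<lambda>i. v (Suc i))))"
    by (rule definable_subst[where P = "\<lambda>x v. v 0 = f x (t (\<lambda>i. v (Suc i)))"])
      (rule definable_term_shift[OF assms(2)])
  then show ?thesis unfolding definable_term_def .
qed

lemma definable_term_graph:
  assumes "definable (\<lambda>v. R (v 0) (\<lambda>i. v (Suc i)))" "\<And>y v. (y = t v) = R y v"
  shows "definable_term t"
  unfolding definable_term_def assms(2) by (rule assms(1))

lemma definable_ball [def_intros]: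
  assumes "definable (\<lambda>v. P (v 0) (\<lambda>i. v (Suc i)))" "definable_term t"
  shows "definable (\<lambda>v. \<forall>x \<in> elts (t v). P x v)"
  unfolding Ball_def
  by (rule definable_all, rule definable_imp, rule definable_elts, rule definable_term_var,
      rule definable_term_shift[OF assms(2)], rule assms(1))

lemma definable_bex [def_intros]:
  assumes "definable (\<lambda>v. P (v 0) (\<lambda>i. v (Suc i)))" "definable_term t"
  shows "definable (\<lambda>v. \<exists>x \<in> elts (t v). P x v)"
  unfolding Bex_def
  by (rule definable_ex, rule definable_and, rule definable_elts, rule definable_term_var,
      rule definable_term_shift[OF assms(2)], rule assms(1))

lemma definable_subset [def_intros]:
  "definable_term s \<Longrightarrow> definable_term t \<Longrightarrow> definable (\<lambda>v. elts (s v) \<subseteq> elts (t v))"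
  by (rule definable_app2[where P = "\<lambda>x y. elts x \<subseteq> elts y"])
    (auto simp: subset_iff intro!: def_intros)

lemma definable_term_if [def_intros]:
  assumes "definable P" "definable_term s" "definable_term t"
  shows "definable_term (\<lambda>v. if P v then s v else t v)"
proof -
  have "definable (\<lambda>v. (P (\<lambda>i. v (Suc i)) \<and> v 0 = s (\<lambda>i. v (Suc i))) \<or> (\<not> P (\<lambda>i. v (Suc i)) \<and> v 0 = t (\<lambda>i. v (Suc i))))"
    by (rule definable_or; rule definable_and;
        (rule definable_rename[OF assms(1)] definable_not[OF definable_rename[OF assms(1)]]
          assms(2,3)[unfolded definable_term_def])?)
  then show ?thesis unfolding definable_term_def by (auto elim!: back_subst[of definable])
qed

text \<open>All variables but the first are frozen to parameters, which gives a formula with parameters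
  as in the axioms.\<close>

lemma definable_sat:
  assumes "definable P"
  obtains \<phi> e where "\<And>x. P (case_nat x v) = sat mem (case_nat x e) \<phi>"
proof -
  from assms obtain \<phi> t where
    P: "\<And>v. P v = sat mem (\<lambda>i. case t i of Inl j \<Rightarrow> v j | Inr c \<Rightarrow> c) \<phi>"
    unfolding definable_def by metis
  define r where "r i = (case t i of Inl j \<Rightarrow> (case j of 0 \<Rightarrow> 0 | Suc _ \<Rightarrow> Suc i) | Inr c \<Rightarrow> Suc i)" for i
  define e where "e i = (case t i of Inl j \<Rightarrow> v (j - 1) | Inr c \<Rightarrow> c)" for i
  have "(\<lambda>i. case t i of Inl j \<Rightarrow> case_nat x v j | Inr c \<Rightarrow> c) = (\<lambda>i. case_nat x e (r i))" for x
    by (auto simp: r_def e_def fun_eq_iff split: nat.splits sum.splits)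
  then show ?thesis using that[of e "rename r \<phi>"] by (simp add: P sat_rename)
qed

lemma definable_pred_set: "definable (\<lambda>v. P (v 0)) \<longleftrightarrow> set_definable {x. P x}"
proof
  assume "definable (\<lambda>v. P (v 0))"
  then obtain \<phi> e where "\<And>x. P x = sat mem (case_nat x e) \<phi>"
    by (rule definable_sat[where v = undefined]) simp
  then show "set_definable {x. P x}" unfolding set_definable_def by auto
next
  assume "set_definable {x. P x}"
  then obtain \<phi> e where P: "\<And>x. P x = sat mem (case_nat x e) \<phi>"
    unfolding set_definable_def by auto
  have "P (v 0) = sat mem (\<lambda>i. case (case i of 0 \<Rightarrow> Inl 0 | Suc j \<Rightarrow> Inr (e j)) of Inl j \<Rightarrow> v j | Inr c \<Rightarrow> c) \<phi>" for v
    unfolding P by (intro arg_cong2[where f = "sat mem"] ext) (auto split: sum.splits nat.splits)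
  then show "definable (\<lambda>v. P (v 0))" unfolding definable_def by (intro exI allI)
qed

section \<open>Sets\<close>

lemma elts_the_set: "is_set X \<Longrightarrow> elts (the_set X) = X" for X :: "'a::ast set"
  unfolding is_set_def the_set_def by (metis (mono_tags, lifting) set_ext theI')

lemma is_set_elts [simp]: "is_set (elts x)"
  unfolding is_set_def by blast

lemma the_set_elts [simp]: "the_set (elts x) = (x::'a::ast)"
  by (meson elts_the_set is_set_elts set_ext)

lemma mem_elts: "x \<in>\<^sub>V y \<longleftrightarrow> x \<in> elts y"
  by (simp add: elts_def)

lemma definable_replacement:
  fixes a :: "'a::ast"
  assumes "definable (\<lambda>v. R (v 0) (v 1))" "\<And>x y z. x \<in> elts a \<Longrightarrow> R x y \<Longrightarrow> R x z \<Longrightarrow> y = z"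
  shows "is_set {y. \<exists>x \<in> elts a. R x y}"
proof -
  from assms(1) obtain \<phi> t where
    R: "\<And>v :: nat \<Rightarrow> 'a. R (v 0) (v 1) = sat mem (\<lambda>i. case t i of Inl j \<Rightarrow> v j | Inr c \<Rightarrow> c) \<phi>"
    unfolding definable_def by metis
  define r where "r i = (case t i of Inl j \<Rightarrow> (if j < 2 then j else i + 2) | Inr c \<Rightarrow> i + 2)" for i
  define e where "e i = (case t i of Inl j \<Rightarrow> undefined | Inr c \<Rightarrow> c)" for i
  have "R x y = sat mem (case_nat x (case_nat y e)) (rename r \<phi>)" for x y
  proof -
    have "(\<lambda>i. case t i of Inl j \<Rightarrow> case_nat x (case_nat y (\<lambda>_. undefined)) j | Inr c \<Rightarrow> c) =
      (\<lambda>i. case_nat x (case_nat y e) (r i))"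
      by (auto simp: r_def e_def fun_eq_iff numeral_2_eq_2 less_Suc_eq split: nat.splits sum.splits)
    then show ?thesis using R[of "case_nat x (case_nat y (\<lambda>_. undefined))"] by (simp add: sat_rename)
  qed
  then show ?thesis
    using replacement[of a e "rename r \<phi>"] assms(2) by (simp add: mem_elts Bex_def)
qed

lemma is_set_image:
  fixes a :: "'a::ast"
  assumes "definable_term (\<lambda>v. f (v 0))"
  shows "is_set (f ` elts a)"
proof -
  have "definable (\<lambda>v. v 1 = f (v 0))"
    using definable_rename[OF assms[unfolded definable_term_def], of "\<lambda>i. 1 - i"] by simp
  then have "is_set {y. \<exists>x \<in> elts a. y = f x}"
    by (rule definable_replacement[where R = "\<lambda>x y. y = f x"]) simp
  then show ?thesis by (simp add: image_def)
qed

lemma is_set_separation: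
  fixes a :: "'a::ast"
  assumes "definable (\<lambda>v. P (v 0))"
  shows "is_set {x \<in> elts a. P x}"
proof -
  have "definable (\<lambda>v. P (v 0) \<and> v 1 = v 0)"
    by (intro def_intros assms)
  then have "is_set {y. \<exists>x \<in> elts a. P x \<and> y = x}"
    by (rule definable_replacement[where R = "\<lambda>x y. P x \<and> y = x"]) simp
  moreover have "{y. \<exists>x \<in> elts a. P x \<and> y = x} = {x \<in> elts a. P x}" by auto
  ultimately show ?thesis by simp
qed

lemma elts_vempty [simp]: "elts (vempty :: 'a::ast) = {}"
  unfolding vempty_def by (rule elts_the_set[OF empty_set])

lemma is_set_singleton: "is_set {x :: 'a::ast}"
  using pairing[of x x] by simp

lemma is_set_Un:
  fixes X Y :: "'a::ast set"
  assumes "is_set X" "is_set Y" shows "is_set (X \<union> Y)"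
  using union[of "the_set {the_set X, the_set Y}"] assms
  by (simp add: elts_the_set pairing)

lemma is_set_insert: "is_set X \<Longrightarrow> is_set (insert x X)" for X :: "'a::ast set"
  using is_set_Un[OF is_set_singleton[of x]] by simp

lemma elts_vsucc [simp]: "elts (vsucc x) = insert x (elts x)" for x :: "'a::ast"
  unfolding vsucc_def by (rule elts_the_set) (intro is_set_insert is_set_elts)

lemma opair_inject [simp]: "opair x y = opair x' y' \<longleftrightarrow> x = x' \<and> y = y'" for x :: "'a::ast"
proof
  assume "opair x y = opair x' y'"
  then have "{the_set {x}, the_set {x, y}} = {the_set {x'}, the_set {x', y'}}"
    unfolding opair_def by (metis elts_the_set pairing)
  moreover have "the_set {a,b} = the_set {c,d} \<longleftrightarrow> {a,b} = {c,d}" for a b c d :: 'a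
    by (metis elts_the_set pairing)
  moreover have "the_set {a} = the_set {c,d} \<longleftrightarrow> {a} = {c,d}" for a c d :: 'a
    by (metis elts_the_set pairing is_set_singleton)
  moreover have "the_set {a,b} = the_set {c} \<longleftrightarrow> {a,b} = {c}" for a b c :: 'a
    by (metis elts_the_set pairing is_set_singleton)
  moreover have "the_set {a} = the_set {c} \<longleftrightarrow> a = c" for a c :: 'a
    by (metis elts_the_set is_set_singleton singleton_inject)
  ultimately show "x = x' \<and> y = y'" by (simp add: doubleton_eq_iff) metis
qed auto

text \<open>Equality with the abstraction is membership equivalence, by extensionality.\<close>

lemma definable_is_the_set:
  assumes "definable (\<lambda>v. P (v 0) (\<lambda>i. v (Suc i)))" "\<And>v. is_set {x. P x v}"
  shows "definable_term (\<lambda>v. the_set {x. P x v})"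
proof (rule definable_term_graph)
  show "(y = the_set {x. P x v}) = (\<forall>x. x \<in>\<^sub>V y \<longleftrightarrow> P x v)" for y v
  proof -
    have "(y = the_set {x. P x v}) \<longleftrightarrow> elts y = {x. P x v}"
      using assms(2) by (metis elts_the_set the_set_elts)
    then show ?thesis by (auto simp: mem_elts)
  qed
  show "definable (\<lambda>v. \<forall>x. x \<in>\<^sub>V v 0 \<longleftrightarrow> P x (\<lambda>i. v (Suc i)))"
    by (intro definable_all definable_iff def_intros)
      (use definable_rename[OF assms(1), of "\<lambda>i. if i = 0 then 0 else Suc i"] in simp)
qed

lemma definable_singleton: "definable_term t \<Longrightarrow> definable_term (\<lambda>v. the_set {t v})"
  using definable_is_the_set[where P = "\<lambda>x v. x = t v"]
  by (simp add: is_set_singleton definable_term_def)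

lemma definable_pair:
  assumes "definable_term s" "definable_term t"
  shows "definable_term (\<lambda>v. the_set {s v, t v})"
proof -
  have eq: "{s v, t v} = {x. x = s v \<or> x = t v}" for v by auto
  have "definable (\<lambda>v. v 0 = s (\<lambda>i. v (Suc i)) \<or> v 0 = t (\<lambda>i. v (Suc i)))"
    using assms unfolding definable_term_def by (rule definable_or)
  then show ?thesis unfolding eq
    by (rule definable_is_the_set) (use pairing eq in metis)
qed

lemma definable_opair [def_intros]:
  "definable_term s \<Longrightarrow> definable_term t \<Longrightarrow> definable_term (\<lambda>v. opair (s v) (t v))"
  unfolding opair_def by (intro definable_pair definable_singleton)

lemma definable_adjoin [def_intros]:
  assumes "definable_term s" "definable_term t"
  shows "definable_term (\<lambda>v. the_set (insert (s v) (elts (t v))))"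
proof -
  have eq: "insert (s v) (elts (t v)) = {x. x = s v \<or> x \<in>\<^sub>V t v}" for v by (auto simp: mem_elts)
  have "definable (\<lambda>v. v 0 = s (\<lambda>i. v (Suc i)) \<or> v 0 \<in>\<^sub>V t (\<lambda>i. v (Suc i)))"
    by (rule definable_or[OF assms(1)[unfolded definable_term_def]
          definable_mem[OF definable_term_var definable_term_shift[OF assms(2)]]])
  then show ?thesis unfolding eq
    by (rule definable_is_the_set) (use is_set_insert[OF is_set_elts] eq in metis)
qed

lemma definable_vsucc [def_intros]: "definable_term s \<Longrightarrow> definable_term (\<lambda>v. vsucc (s v))"
  unfolding vsucc_def by (rule definable_adjoin)

lemma definable_NN [def_intros]: "definable_term s \<Longrightarrow> definable (\<lambda>v. s v \<in> NN)"
  by (rule definable_app1[where P = "\<lambda>x. x \<in> NN"]) (auto simp: NN_def intro!: def_intros)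

lemma set_induct [case_names definable empty adjoin]:
  fixes x :: "'a::ast"
  assumes "definable (\<lambda>v. P (v 0))"
    and "P vempty"
    and "\<And>x y. P x \<Longrightarrow> y \<notin> elts x \<Longrightarrow> P (the_set (insert y (elts x)))"
  shows "P x"
proof -
  obtain \<phi> e where P: "\<And>x. P x = sat mem (case_nat x e) \<phi>"
    using definable_sat[OF assms(1)] by (metis nat.case(1))
  show ?thesis unfolding P
  proof (rule set_induction, unfold P[symmetric])
    show "P vempty" by (rule assms(2))
    show "P (the_set (insert y (elts x)))" if "P x" for x y
      using that assms(3) by (cases "y \<in> elts x") (auto simp: insert_absorb)
  qed
qed


section \<open>Natural numbers\<close>

lemma not_mem_self: "x \<notin> elts x" for x :: "'a::ast"
proof
  assume "x \<in> elts x"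
  with foundation[of "the_set {x}"] show False by (auto simp: elts_the_set is_set_singleton)
qed

lemma mem_asym: "x \<in> elts y \<Longrightarrow> y \<notin> elts x" for x :: "'a::ast"
  using foundation[of "the_set {x, y}"] by (auto simp: elts_the_set pairing)

lemma mem_no_3_cycle: "x \<in> elts y \<Longrightarrow> y \<in> elts z \<Longrightarrow> z \<notin> elts x" for x :: "'a::ast"
  using foundation[of "the_set (insert x {y, z})"]
  by (auto simp: elts_the_set pairing is_set_insert)

lemma vsucc_inject [simp]: "vsucc x = vsucc y \<longleftrightarrow> x = y" for x :: "'a::ast"
  by (metis elts_vsucc insert_iff mem_asym)

lemma vsucc_neq_vempty [simp]: "vsucc x \<noteq> vempty" "vempty \<noteq> vsucc x" for x :: "'a::ast"
  by (metis elts_vempty elts_vsucc insert_not_empty)+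

lemma vempty_NN [simp]: "(vempty :: 'a::ast) \<in> NN"
  by (rule vempty_in_NN)

lemma vsucc_NN [simp]: "vsucc x \<in> NN \<longleftrightarrow> x \<in> NN" for x :: "'a::ast"
proof
  show "x \<in> NN \<Longrightarrow> vsucc x \<in> NN" unfolding NN_def by (auto simp: mem_elts)
  assume *: "vsucc x \<in> NN"
  have "elts y \<subseteq> elts x" if "y \<in> elts x" for y
    using * that mem_asym[of y x] unfolding NN_def by (auto simp: mem_elts)
  with * show "x \<in> NN" unfolding NN_def by (auto simp: mem_elts)
qed

text \<open>Foundation excludes membership cycles of length two and three; with linearity this makes an
  element of a number transitive.\<close>

lemma NN_elts:
  fixes n :: "'a::ast"
  assumes "n \<in> NN" "x \<in> elts n"
  shows "x \<in> NN"
proof -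
  have trans: "\<And>y z. y \<in> elts n \<Longrightarrow> z \<in> elts y \<Longrightarrow> z \<in> elts n"
    and lin: "\<And>y z. y \<in> elts n \<Longrightarrow> z \<in> elts n \<Longrightarrow> y \<in> elts z \<or> y = z \<or> z \<in> elts y"
    using assms(1) unfolding NN_def mem_elts by blast+
  have "z \<in> elts x" if "y \<in> elts x" "z \<in> elts y" for y z
  proof -
    have "y \<in> elts n" "z \<in> elts n" using trans assms(2) that by blast+
    then show ?thesis
      using lin[of z x] assms(2) that mem_asym[of y x] mem_no_3_cycle[of z y x] by blast
  qed
  then show ?thesis
    unfolding NN_def mem_elts using lin trans assms(2) by blast
qed

lemma NN_trans: "n \<in> NN \<Longrightarrow> x \<in> elts n \<Longrightarrow> y \<in> elts x \<Longrightarrow> y \<in> elts n" for n :: "'a::ast"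
  unfolding NN_def by auto

lemma NN_least:
  fixes n :: "'a::ast"
  assumes "definable (\<lambda>v. P (v 0))" "n \<in> NN" "P n"
  obtains m where "m \<in> NN" "P m" "\<And>k. k \<in> elts m \<Longrightarrow> \<not> P k"
proof -
  define u where "u = the_set {x \<in> elts (vsucc n). P x}"
  have u: "elts u = {x \<in> elts (vsucc n). P x}"
    unfolding u_def by (rule elts_the_set[OF is_set_separation[OF assms(1)]])
  then obtain m where m: "m \<in> elts u" "elts m \<inter> elts u = {}"
    using foundation[of u] assms(3) by auto
  have "m \<in> NN" "\<And>k. k \<in> elts m \<Longrightarrow> k \<in> elts (vsucc n)"
    using m(1) u assms(2) NN_elts[OF assms(2)] NN_trans[OF assms(2)] by auto
  with m u show ?thesis by (intro that[of m]) auto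
qed

text \<open>A least exception would be a nonzero limit ordinal, hence a set that contains \<open>vempty\<close> and
  is closed under \<open>vsucc\<close>, contrary to the negated axiom of infinity. This is where ordinals
  become natural numbers.\<close>

lemma NN_cases [case_names zero succ]:
  fixes n :: "'a::ast"
  assumes "n \<in> NN"
  obtains "n = vempty" | m where "m \<in> NN" "n = vsucc m"
proof (rule ccontr)
  assume no: "\<not> thesis"
  let ?P = "\<lambda>n :: 'a. n \<noteq> vempty \<and> (\<forall>m. n \<noteq> vsucc m)"
  have def: "definable (\<lambda>v. ?P (v 0))" by (intro def_intros)
  have "?P n" using no that assms vsucc_NN by metis
  from NN_least[of ?P, OF def assms this]
  obtain l where l: "l \<in> NN" "?P l" "\<And>k. k \<in> elts l \<Longrightarrow> \<not> ?P k" by blast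
  \<comment> \<open>The least exception \<open>l\<close> contains \<open>vempty\<close>, since its \<open>\<in>\<close>-minimal element is empty.\<close>
  have "elts l \<noteq> {}" using l(2) by (metis elts_vempty set_ext)
  then obtain x where x: "x \<in> elts l" "elts x \<inter> elts l = {}"
    using foundation by blast
  then have "elts x = {}" using NN_trans[OF l(1)] by blast
  then have "vempty \<in> elts l" using x by (metis elts_vempty set_ext)
  moreover have "vsucc y \<in> elts l" if y: "y \<in> elts l" for y
  proof -
    \<comment> \<open>The least element of \<open>l\<close> not in \<open>vsucc y\<close> is \<open>vsucc y\<close>.\<close>
    have "elts (vsucc y) \<subseteq> elts l" using y NN_trans[OF l(1)] by auto
    moreover have "elts (vsucc y) \<noteq> elts l" using l(2) set_ext by metis
    ultimately have ex: "\<exists>z. z \<in> elts l \<and> z \<notin> elts (vsucc y)" by auto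
    then obtain z where z: "z \<in> elts l" "z \<notin> elts (vsucc y)" by blast
    let ?Q = "\<lambda>z. z \<in> elts l \<and> z \<notin> elts (vsucc y)"
    have def: "definable (\<lambda>v. ?Q (v 0))" by (intro def_intros)
    have "?Q z" using z by blast
    from NN_least[of ?Q, OF def NN_elts[OF l(1) z(1)] this]
    obtain m where m: "m \<in> NN" "?Q m" "\<And>k. k \<in> elts m \<Longrightarrow> \<not> ?Q k" by blast
    have "y \<in> elts m" using l(1) y m(2) unfolding NN_def by (auto simp: mem_elts)
    then have "elts m = elts (vsucc y)"
      using m(2,3) NN_trans[OF m(1)] NN_trans[OF l(1)] by fastforce
    then show ?thesis using m(2) set_ext by metis
  qed
  ultimately show False using no_infinity mem_elts by metis
qed

lemma NN_induct [consumes 1, case_names definable zero succ]: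
  fixes n :: "'a::ast"
  assumes "n \<in> NN" "definable (\<lambda>v. P (v 0))"
    and "P vempty" "\<And>n. n \<in> NN \<Longrightarrow> P n \<Longrightarrow> P (vsucc n)"
  shows "P n"
proof (rule ccontr)
  assume "\<not> P n"
  then obtain m where m: "m \<in> NN" "\<not> P m" "\<And>k. k \<in> elts m \<Longrightarrow> \<not> \<not> P k"
    using NN_least[OF definable_not[OF assms(2)] assms(1)] by metis
  from m(1) show False
    by (cases rule: NN_cases) (use m assms(3,4) in auto)
qed

lemma NN_vsucc_mem:
  fixes n :: "'a::ast"
  assumes "n \<in> NN" "m \<in> elts n"
  shows "vsucc m \<in> elts n \<or> vsucc m = n"
proof -
  have "m \<in> elts n \<longrightarrow> vsucc m \<in> elts n \<or> vsucc m = n"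
    using assms(1)
  proof (induction rule: NN_induct)
    case definable
    show ?case by (intro def_intros)
  qed auto
  with assms(2) show ?thesis by blast
qed

lemma NN_linear:
  fixes n :: "'a::ast"
  assumes "m \<in> NN" "n \<in> NN"
  shows "m \<in> elts n \<or> m = n \<or> n \<in> elts m"
  using assms
proof (induction m rule: NN_induct)
  case definable
  show ?case by (intro def_intros)
next
  case zero
  then show ?case
  proof (induction n rule: NN_induct)
    case definable
    show ?case by (intro def_intros)
  qed auto
next
  case (succ m)
  then show ?case using NN_vsucc_mem[of n m] by auto
qed

section \<open>Counting\<close>

text \<open>Functions of HOL with a set-definable graph stand for set functions: on a set they restrict
  to one, and every set function extends to one. So \<open>bij_betw\<close> and its theory can be used for
  equinumerosity.\<close>

definition internal_map :: "('a::ast \<Rightarrow> 'a) \<Rightarrow> bool" where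
  "internal_map f \<longleftrightarrow> definable_term (\<lambda>v. f (v 0))"

lemma internal_mapD: "internal_map f \<Longrightarrow> definable_term t \<Longrightarrow> definable_term (\<lambda>v. f (t v))"
  unfolding internal_map_def by (rule definable_term_app1)

lemma set_equinumerous_iff_internal:
  fixes x y :: "'a::ast"
  shows "set_equinumerous x y \<longleftrightarrow> (\<exists>f. internal_map f \<and> bij_betw f (elts x) (elts y))"
proof
  assume "set_equinumerous x y"
  then obtain f where f: "set_inj f" "vdom f = elts x" "vrng f = elts y"
    unfolding set_equinumerous_def by blast
  define g where "g a = (if a \<in> vdom f then THE b. opair a b \<in>\<^sub>V f else vempty)" for a
  have uniq: "opair a b \<in>\<^sub>V f \<Longrightarrow> opair a c \<in>\<^sub>V f \<Longrightarrow> b = c" for a b c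
    using f(1) unfolding set_inj_def set_fun_def by blast
  have inj: "opair a c \<in>\<^sub>V f \<Longrightarrow> opair b c \<in>\<^sub>V f \<Longrightarrow> a = b" for a b c
    using f(1) unfolding set_inj_def by blast
  have g: "opair a (g a) \<in>\<^sub>V f" if "a \<in> elts x" for a
    using that uniq unfolding g_def f(2)[symmetric] by (auto simp: vdom_def intro: theI2)
  have graph: "(b = g a) = (if a \<in> elts x then opair a b \<in>\<^sub>V f else b = vempty)" for a b
    using g uniq f(2) by (auto simp: g_def)
  have "internal_map g"
    unfolding internal_map_def
    by (rule definable_term_graph[where R = "\<lambda>b v. (v 0 \<in> elts x \<and> opair (v 0) b \<in>\<^sub>V f) \<or> (v 0 \<notin> elts x \<and> b = vempty)"])
      (auto simp: graph intro!: def_intros)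
  moreover have "bij_betw g (elts x) (elts y)"
  proof (rule bij_betw_imageI)
    show "inj_on g (elts x)" using g inj by (metis inj_onI)
    show "g ` elts x = elts y"
      unfolding f(2,3)[symmetric] using g uniq f(2) by (auto simp: vdom_def vrng_def) (metis image_eqI mem_Collect_eq vdom_def)
  qed
  ultimately show "\<exists>f. internal_map f \<and> bij_betw f (elts x) (elts y)" by blast
next
  assume "\<exists>f. internal_map f \<and> bij_betw f (elts x) (elts y)"
  then obtain f where f: "internal_map f" and bij: "bij_betw f (elts x) (elts y)" by blast
  define g where "g = the_set ((\<lambda>a. opair a (f a)) ` elts x)"
  have g: "elts g = (\<lambda>a. opair a (f a)) ` elts x"
    unfolding g_def by (intro elts_the_set is_set_image def_intros internal_mapD[OF f])
  have pg: "opair a b \<in> elts g \<longleftrightarrow> a \<in> elts x \<and> b = f a" for a b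
    unfolding g by auto
  have "\<forall>p \<in> elts g. \<exists>a b. p = opair a b" unfolding g by blast
  moreover have "a = b" if "a \<in> elts x" "b \<in> elts x" "f a = f b" for a b
    using bij that unfolding bij_betw_def inj_on_def by blast
  ultimately have "set_inj g" unfolding set_inj_def set_fun_def mem_elts pg by metis
  moreover have "vdom g = elts x" unfolding vdom_def mem_elts pg by simp
  moreover have "vrng g = elts y" using bij unfolding vrng_def mem_elts pg bij_betw_def by blast
  ultimately show "set_equinumerous x y" unfolding set_equinumerous_def by blast
qed

lemma definable_set_equinumerous [def_intros]:
  assumes "definable_term s" "definable_term t"
  shows "definable (\<lambda>v. set_equinumerous (s v) (t v))"
proof (rule definable_app2[OF _ assms])
  have eq: "(X = Y) = (\<forall>x. x \<in> X \<longleftrightarrow> x \<in> Y)" for X Y :: "'a set" by auto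
  show "definable (\<lambda>v. set_equinumerous (v 0) (v 1 :: 'a))"
    unfolding set_equinumerous_def set_inj_def set_fun_def vdom_def vrng_def eq mem_Collect_eq
    by (intro def_intros)
qed

lemma set_equinumerous_sym:
  fixes x y :: "'a::ast"
  assumes "set_equinumerous x y" shows "set_equinumerous y x"
proof -
  from assms obtain f where f: "set_inj f" "vdom f = elts x" "vrng f = elts y"
    unfolding set_equinumerous_def by blast
  define R where "R p q \<longleftrightarrow> (\<exists>a b. p = opair a b \<and> q = opair b a)" for p q :: 'a
  define g where "g = the_set {q. \<exists>p \<in> elts f. R p q}"
  have "is_set {q. \<exists>p \<in> elts f. R p q}"
    by (rule definable_replacement) (auto simp: R_def intro!: def_intros)
  then have g: "elts g = {q. \<exists>p \<in> elts f. R p q}"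
    unfolding g_def by (rule elts_the_set)
  have pg: "opair b a \<in> elts g \<longleftrightarrow> opair a b \<in> elts f" for a b
    by (auto simp: g R_def)
  have "set_inj g"
    using f(1) unfolding set_inj_def set_fun_def mem_elts pg by (auto simp: g R_def)
  moreover have "vdom g = elts y" "vrng g = elts x"
    using f(2,3) unfolding vdom_def vrng_def mem_elts pg by auto
  ultimately show ?thesis unfolding set_equinumerous_def by blast
qed

lemma set_equinumerous_trans:
  fixes x y z :: "'a::ast"
  assumes "set_equinumerous x y" "set_equinumerous y z"
  shows "set_equinumerous x z"
proof -
  from assms obtain f g where f: "internal_map f" "bij_betw f (elts x) (elts y)"
    and g: "internal_map g" "bij_betw g (elts y) (elts z)"
    unfolding set_equinumerous_iff_internal by blast
  have "internal_map (g \<circ> f)"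
    unfolding internal_map_def comp_def by (intro internal_mapD[OF g(1)] internal_mapD[OF f(1)] def_intros)
  then show ?thesis
    unfolding set_equinumerous_iff_internal using bij_betw_trans[OF f(2) g(2)] by blast
qed

lemma set_equinumerous_refl: "set_equinumerous x x" for x :: "'a::ast"
  unfolding set_equinumerous_iff_internal internal_map_def
  by (rule exI[of _ id]) (auto intro: def_intros)

lemma set_equinumerous_adjoin:
  fixes n x y :: "'a::ast"
  assumes "set_equinumerous n x" "y \<notin> elts x"
  shows "set_equinumerous (vsucc n) (the_set (insert y (elts x)))"
proof -
  obtain f where f: "internal_map f" "bij_betw f (elts n) (elts x)"
    using assms(1) unfolding set_equinumerous_iff_internal by blast
  let ?g = "\<lambda>a. if a = n then y else f a"
  have "internal_map ?g" unfolding internal_map_def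
    by (intro def_intros internal_mapD[OF f(1)])
  moreover have "bij_betw ?g (insert n (elts n)) (insert y (elts x))"
  proof -
    have "bij_betw ?g (elts n) (elts x)"
      using f(2) not_mem_self[of n] by (subst bij_betw_cong[of _ _ f]) auto
    then show ?thesis
      using notIn_Un_bij_betw[of n "elts n" ?g "elts x"] not_mem_self[of n] assms(2) by auto
  qed
  ultimately show ?thesis
    unfolding set_equinumerous_iff_internal elts_vsucc elts_the_set[OF is_set_insert[OF is_set_elts]]
    by blast
qed

lemma ex_set_equinumerous_NN: "\<exists>n \<in> NN. set_equinumerous n x" for x :: "'a::ast"
proof (induction x rule: set_induct)
  case definable
  show ?case unfolding Bex_def by (intro def_intros)
next
  case empty
  then show ?case using set_equinumerous_refl vempty_NN by blast
next
  case (adjoin x y)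
  then obtain n where "n \<in> NN" "set_equinumerous n x" by blast
  with adjoin(2) show ?case using set_equinumerous_adjoin vsucc_NN by blast
qed

text \<open>The pigeonhole principle. In the step a bijection \<open>f\<close> from \<open>vsucc n\<close> to \<open>vsucc k\<close> is
  corrected to one from \<open>n\<close> to \<open>k\<close>, by sending the element mapped to \<open>k\<close> to \<open>f n\<close> instead.\<close>

lemma set_equinumerous_NN_eq:
  fixes m n :: "'a::ast"
  assumes "n \<in> NN" "m \<in> NN" "set_equinumerous n m"
  shows "n = m"
proof -
  have "\<forall>m. m \<in> NN \<longrightarrow> set_equinumerous n m \<longrightarrow> n = m"
    using assms(1)
  proof (induction rule: NN_induct)
    case definable
    show ?case by (intro def_intros)
  next
    case zero
    show ?case
      unfolding set_equinumerous_iff_internal by (metis bij_betw_empty1 elts_vempty set_ext)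
  next
    case (succ n)
    show ?case
    proof (intro allI impI)
      fix m :: 'a
      assume m: "m \<in> NN" "set_equinumerous (vsucc n) m"
      then obtain f where f: "internal_map f" "bij_betw f (insert n (elts n)) (elts m)"
        unfolding set_equinumerous_iff_internal by auto
      then have "elts m \<noteq> {}" by (auto simp: bij_betw_def)
      with m(1) obtain k where k: "k \<in> NN" "m = vsucc k" by (cases rule: NN_cases) auto
      define g where "g a = (if f a = k then f n else f a)" for a
      have "internal_map g" unfolding internal_map_def g_def
        by (intro def_intros internal_mapD[OF f(1)])
      moreover have "bij_betw g (elts n) (elts k)"
      proof (rule bij_betw_imageI)
        have inj: "inj_on f (insert n (elts n))" and im: "f ` insert n (elts n) = insert k (elts k)"
          using f(2) k by (auto simp: bij_betw_def)
        show "inj_on g (elts n)"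
          using inj not_mem_self[of n] unfolding g_def inj_on_def by (metis insertCI)
        show "g ` elts n = elts k"
        proof
          show "g ` elts n \<subseteq> elts k"
            using inj im not_mem_self[of n] unfolding g_def inj_on_def
            by (smt (verit) image_iff image_subset_iff insert_iff)
          show "elts k \<subseteq> g ` elts n"
          proof
            fix b assume b: "b \<in> elts k"
            then obtain a where a: "a \<in> insert n (elts n)" "b = f a" using im by blast
            obtain c where c: "c \<in> insert n (elts n)" "k = f c" using im by blast
            have "b \<noteq> k" using b not_mem_self by blast
            show "b \<in> g ` elts n"
            proof (cases "a = n")
              case True
              then have "c \<in> elts n" using c a \<open>b \<noteq> k\<close> by auto
              then show ?thesis using c a True by (auto simp: g_def image_iff)
            next
              case False
              then show ?thesis using a \<open>b \<noteq> k\<close> by (auto simp: g_def image_iff)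
            qed
          qed
        qed
      qed
      ultimately have "set_equinumerous n k" unfolding set_equinumerous_iff_internal by blast
      with succ k show "vsucc n = m" by auto
    qed
  qed
  with assms(2,3) show ?thesis by blast
qed

text \<open>Every set has a cardinal number (by induction on sets) and only one, so \<open>vcard\<close> is a total
  definable function.\<close>

definition vcard :: "'a::ast \<Rightarrow> 'a" where
  "vcard x = (THE n. n \<in> NN \<and> set_equinumerous n x)"

lemma vcard_eq_iff: "n = vcard x \<longleftrightarrow> n \<in> NN \<and> set_equinumerous n x" for x :: "'a::ast"
proof -
  have "\<exists>!n. n \<in> NN \<and> set_equinumerous n x"
  proof (rule ex_ex1I)
    show "\<exists>n. n \<in> NN \<and> set_equinumerous n x" using ex_set_equinumerous_NN by blast
    show "m = n" if "m \<in> NN \<and> set_equinumerous m x" "n \<in> NN \<and> set_equinumerous n x" for m n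
      using that set_equinumerous_NN_eq set_equinumerous_trans set_equinumerous_sym by blast
  qed
  from the1_equality[OF this, of n] theI'[OF this] show ?thesis
    unfolding vcard_def[symmetric] by blast
qed

lemma vcard_NN [simp]: "vcard x \<in> NN"
  using vcard_eq_iff[of "vcard x" x] by simp

lemma vcard_equinumerous: "set_equinumerous (vcard x) x"
  using vcard_eq_iff[of "vcard x" x] by simp

lemma vcard_of_NN: "n \<in> NN \<Longrightarrow> vcard n = n"
  using vcard_eq_iff[of n n] set_equinumerous_refl[of n] by simp

lemma vcard_cong: "set_equinumerous x y \<Longrightarrow> vcard x = vcard y"
  using vcard_eq_iff[of "vcard x" y] set_equinumerous_trans[OF vcard_equinumerous] by simp

lemma definable_vcard [def_intros]: "definable_term t \<Longrightarrow> definable_term (\<lambda>v. vcard (t v))"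
  by (rule definable_term_app1) 
    (rule definable_term_graph[where R = "\<lambda>y v. y \<in> NN \<and> set_equinumerous y (v 0)"];
      (intro def_intros | simp add: vcard_eq_iff))

lemma vcard_empty [simp]: "vcard vempty = vempty"
  by (simp add: vcard_of_NN)

lemma vcard_adjoin:
  fixes x :: "'a::ast"
  assumes "y \<notin> elts x"
  shows "vcard (the_set (insert y (elts x))) = vsucc (vcard x)"
  using vcard_eq_iff[of "vsucc (vcard x)" "the_set (insert y (elts x))"]
    set_equinumerous_adjoin[OF vcard_equinumerous assms] by simp


section \<open>Arithmetic of the natural numbers\<close>

lemma nat_add_eq_vcard:
  "nat_add m n = vcard (the_set (opair vempty ` elts m \<union> opair (vsucc vempty) ` elts n))"
  unfolding nat_add_def vcard_def ..

lemma nat_mult_eq_vcard: "nat_mult m n = vcard (the_set {opair x y | x y. x \<in>\<^sub>V m \<and> y \<in>\<^sub>V n})"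
  unfolding nat_mult_def vcard_def ..

lemma is_set_tagged_union: "is_set (opair s ` elts m \<union> opair t ` elts n)" for m :: "'a::ast"
  by (intro is_set_Un is_set_image def_intros)

lemma is_set_Times: "is_set {opair x y | x y. x \<in>\<^sub>V m \<and> y \<in>\<^sub>V n}" for m :: "'a::ast"
proof -
  define g where "g y = the_set {p. \<exists>x \<in> elts m. p = opair x y}" for y
  have set: "is_set {p. \<exists>x \<in> elts m. p = opair x y}" for y
    using is_set_image[of "\<lambda>x. opair x y" m] by (simp add: image_def def_intros)
  have "definable_term (\<lambda>v. g (v 0))"
    unfolding g_def by (intro definable_is_the_set set def_intros)
  then have "elts (the_set (g ` elts n)) = g ` elts n"
    by (intro elts_the_set is_set_image)
  then have "is_set (\<Union>y \<in> g ` elts n. elts y)"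
    using union[of "the_set (g ` elts n)"] by simp
  moreover have "elts (g y) = {p. \<exists>x \<in> elts m. p = opair x y}" for y
    unfolding g_def by (rule elts_the_set[OF set])
  ultimately show ?thesis
    by (elim back_subst[of is_set]) (auto simp: mem_elts)
qed

lemma definable_nat_add [def_intros]:
  assumes "definable_term s" "definable_term t"
  shows "definable_term (\<lambda>v. nat_add (s v) (t v))"
proof (rule definable_term_app2[OF _ assms])
  have eq: "opair vempty ` elts x \<union> opair (vsucc vempty) ` elts y =
      {p. (\<exists>a \<in> elts x. p = opair vempty a) \<or> (\<exists>a \<in> elts y. p = opair (vsucc vempty) a)}" for x y :: 'a
    by auto
  have set: "is_set {p. (\<exists>a \<in> elts x. p = opair vempty a) \<or> (\<exists>a \<in> elts y. p = opair (vsucc vempty) a)}"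
    for x y :: 'a
    using is_set_tagged_union[of vempty x "vsucc vempty" y] unfolding eq .
  show "definable_term (\<lambda>v. nat_add (v 0) (v 1 :: 'a))"
    unfolding nat_add_eq_vcard eq
    by (intro definable_vcard definable_is_the_set set def_intros)
qed

lemma definable_nat_mult [def_intros]:
  assumes "definable_term s" "definable_term t"
  shows "definable_term (\<lambda>v. nat_mult (s v) (t v))"
proof (rule definable_term_app2[OF _ assms])
  show "definable_term (\<lambda>v. nat_mult (v 0) (v 1 :: 'a))"
    unfolding nat_mult_eq_vcard
    by (intro definable_vcard definable_is_the_set is_set_Times def_intros)
qed

lemma nat_add_NN [simp]: "nat_add m n \<in> NN" for m :: "'a::ast"
  by (simp add: nat_add_eq_vcard)

lemma nat_mult_NN [simp]: "nat_mult m n \<in> NN" for m :: "'a::ast"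
  by (simp add: nat_mult_eq_vcard)

lemma set_equinumerousI:
  assumes "definable_term (\<lambda>v. f (v 0))" "bij_betw f (elts x) (elts y)"
  shows "set_equinumerous x y"
  using assms unfolding set_equinumerous_iff_internal internal_map_def by blast

lemma nat_add_vempty: "nat_add m vempty = vcard m" for m :: "'a::ast"
proof -
  have "elts (the_set (opair vempty ` elts m)) = opair vempty ` elts m"
    by (intro elts_the_set is_set_image def_intros)
  then have "set_equinumerous m (the_set (opair vempty ` elts m))"
    by (intro set_equinumerousI[where f = "opair vempty"])
      (auto simp: bij_betw_def inj_on_def intro!: def_intros)
  from vcard_cong[OF this] show ?thesis by (simp add: nat_add_eq_vcard)
qed

text \<open>Together with \<open>nat_add_vempty\<close> and the analogous facts on \<open>nat_mult\<close> below, this replaces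
  the definition by equinumerosity with the usual recursion, from which the laws of arithmetic
  follow by induction.\<close>

lemma nat_add_vsucc: "nat_add m (vsucc n) = vsucc (nat_add m n)" for m :: "'a::ast"
proof -
  let ?S = "opair vempty ` elts m \<union> opair (vsucc vempty) ` elts n"
  have "opair (vsucc vempty) n \<notin> elts (the_set ?S)"
    using not_mem_self[of n] by (auto simp: elts_the_set is_set_tagged_union)
  from vcard_adjoin[OF this] show ?thesis
    by (simp add: nat_add_eq_vcard elts_the_set is_set_tagged_union)
qed

text \<open>By induction on \<open>y\<close>: both sides grow by one when an element is adjoined to \<open>y\<close>.\<close>

lemma vcard_Un_disjoint:
  fixes x y z :: "'a::ast"
  assumes "elts x \<inter> elts y = {}" "elts z = elts x \<union> elts y"
  shows "vcard z = nat_add (vcard x) (vcard y)"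
proof -
  have "\<forall>z. (\<forall>a. a \<in> elts x \<longrightarrow> a \<notin> elts y) \<longrightarrow> (\<forall>a. a \<in> elts z \<longleftrightarrow> a \<in> elts x \<or> a \<in> elts y) \<longrightarrow>
    vcard z = nat_add (vcard x) (vcard y)"
  proof (induction y rule: set_induct)
    case definable
    show ?case by (intro def_intros)
  next
    case empty
    have "z = x" if "\<forall>a. a \<in> elts z \<longleftrightarrow> a \<in> elts x" for z using that set_ext by blast
    then show ?case by (auto simp: nat_add_vempty vcard_of_NN)
  next
    case (adjoin y b)
    show ?case
    proof (intro allI impI)
      fix z
      assume "\<forall>a. a \<in> elts x \<longrightarrow> a \<notin> elts (the_set (insert b (elts y)))"
        and "\<forall>a. a \<in> elts z \<longleftrightarrow> a \<in> elts x \<or> a \<in> elts (the_set (insert b (elts y)))"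
      then have disj: "\<forall>a. a \<in> elts x \<longrightarrow> a \<noteq> b \<and> a \<notin> elts y"
        and z: "elts z = insert b (elts x \<union> elts y)"
        by (auto simp: elts_the_set is_set_insert)
      let ?w = "the_set (elts x \<union> elts y)"
      have w: "elts ?w = elts x \<union> elts y" by (intro elts_the_set is_set_Un is_set_elts)
      have "z = the_set (insert b (elts ?w))" using z w by (metis the_set_elts)
      then have "vcard z = vsucc (vcard ?w)"
        using vcard_adjoin[of b ?w] disj adjoin(2) w by auto
      also have "vcard ?w = nat_add (vcard x) (vcard y)" using adjoin(1) disj w by blast
      finally show "vcard z = nat_add (vcard x) (vcard (the_set (insert b (elts y))))"
        using vcard_adjoin[OF adjoin(2)] by (simp add: nat_add_vsucc)
    qed
  qed
  with assms show ?thesis by blast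
qed

lemma nat_mult_vempty: "nat_mult m vempty = vempty" for m :: "'a::ast"
  by (simp add: nat_mult_eq_vcard mem_elts vempty_def[symmetric])

lemma nat_mult_vsucc: "nat_mult m (vsucc n) = nat_add (nat_mult m n) (vcard m)" for m :: "'a::ast"
proof -
  let ?P = "\<lambda>n. the_set {opair x y | x y. x \<in>\<^sub>V m \<and> y \<in>\<^sub>V n}"
  let ?C = "the_set ((\<lambda>x. opair x n) ` elts m)"
  have P: "elts (?P k) = {opair x y | x y. x \<in> elts m \<and> y \<in> elts k}" for k
    using elts_the_set[OF is_set_Times] by (simp add: mem_elts)
  have C: "elts ?C = (\<lambda>x. opair x n) ` elts m" by (intro elts_the_set is_set_image def_intros)
  have "set_equinumerous m ?C"
    by (rule set_equinumerousI[where f = "\<lambda>x. opair x n"])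
      (auto simp: C bij_betw_def inj_on_def intro!: def_intros)
  then have "vcard ?C = vcard m" by (rule vcard_cong[THEN sym])
  moreover have "vcard (?P (vsucc n)) = nat_add (vcard (?P n)) (vcard ?C)"
    by (rule vcard_Un_disjoint) (use not_mem_self[of n] in \<open>auto simp: P C\<close>)
  ultimately show ?thesis by (simp add: nat_mult_eq_vcard)
qed

lemmas NN_rec = nat_add_vempty nat_add_vsucc nat_mult_vempty nat_mult_vsucc vcard_of_NN

lemma nat_add_0_left: "n \<in> NN \<Longrightarrow> nat_add vempty n = n" for n :: "'a::ast"
proof (induction n rule: NN_induct)
  case definable
  show ?case by (intro def_intros)
qed (auto simp: NN_rec)

lemma nat_add_Suc_left: "n \<in> NN \<Longrightarrow> m \<in> NN \<Longrightarrow> nat_add (vsucc m) n = vsucc (nat_add m n)"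
  for m n :: "'a::ast"
proof (induction n rule: NN_induct)
  case definable
  show ?case by (intro def_intros)
qed (auto simp: NN_rec)

lemma nat_add_commute: "n \<in> NN \<Longrightarrow> m \<in> NN \<Longrightarrow> nat_add m n = nat_add n m" for m n :: "'a::ast"
proof (induction n rule: NN_induct)
  case definable
  show ?case by (intro def_intros)
qed (auto simp: NN_rec nat_add_0_left nat_add_Suc_left)

lemma nat_add_assoc:
  "k \<in> NN \<Longrightarrow> m \<in> NN \<Longrightarrow> n \<in> NN \<Longrightarrow> nat_add (nat_add m n) k = nat_add m (nat_add n k)" for k m n :: "'a::ast"
proof (induction k rule: NN_induct)
  case definable
  show ?case by (intro def_intros)
qed (auto simp: NN_rec)

lemma nat_mult_0_left: "n \<in> NN \<Longrightarrow> nat_mult vempty n = vempty" for n :: "'a::ast"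
proof (induction n rule: NN_induct)
  case definable
  show ?case by (intro def_intros)
qed (auto simp: NN_rec)

lemma nat_mult_Suc_left:
  "n \<in> NN \<Longrightarrow> m \<in> NN \<Longrightarrow> nat_mult (vsucc m) n = nat_add (nat_mult m n) n" for m n :: "'a::ast"
proof (induction n rule: NN_induct)
  case definable
  show ?case by (intro def_intros)
next
  case (succ n)
  then show ?case
    by (simp add: NN_rec nat_add_assoc nat_add_commute[of m n])
qed (auto simp: NN_rec)

lemma nat_mult_commute: "n \<in> NN \<Longrightarrow> m \<in> NN \<Longrightarrow> nat_mult m n = nat_mult n m" for m n :: "'a::ast"
proof (induction n rule: NN_induct)
  case definable
  show ?case by (intro def_intros)
qed (auto simp: NN_rec nat_mult_0_left nat_mult_Suc_left)

lemma nat_mult_add_distrib: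
  "k \<in> NN \<Longrightarrow> m \<in> NN \<Longrightarrow> n \<in> NN \<Longrightarrow>
    nat_mult m (nat_add n k) = nat_add (nat_mult m n) (nat_mult m k)" for k m n :: "'a::ast"
proof (induction k rule: NN_induct)
  case definable
  show ?case by (intro def_intros)
qed (auto simp: NN_rec nat_add_assoc)

lemma nat_mult_assoc:
  "k \<in> NN \<Longrightarrow> m \<in> NN \<Longrightarrow> n \<in> NN \<Longrightarrow> nat_mult (nat_mult m n) k = nat_mult m (nat_mult n k)"
  for k m n :: "'a::ast"
proof (induction k rule: NN_induct)
  case definable
  show ?case by (intro def_intros)
qed (auto simp: NN_rec nat_mult_add_distrib)

lemma nat_add_cancel:
  "k \<in> NN \<Longrightarrow> m \<in> NN \<Longrightarrow> n \<in> NN \<Longrightarrow> nat_add m k = nat_add n k \<longleftrightarrow> m = n" for k m n :: "'a::ast"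
proof (induction k rule: NN_induct)
  case definable
  show ?case by (intro def_intros)
qed (auto simp: NN_rec)

lemma nat_mult_eq_0:
  fixes m n :: "'a::ast"
  assumes "m \<in> NN" "n \<in> NN"
  shows "nat_mult m n = vempty \<longleftrightarrow> m = vempty \<or> n = vempty"
proof (cases rule: NN_cases[OF assms(2)])
  case n: (2 n')
  show ?thesis
    by (cases rule: NN_cases[OF assms(1)]) (auto simp: n NN_rec nat_mult_0_left)
qed (simp add: nat_mult_vempty)

lemma nat_le_iff_add:
  fixes m n :: "'a::ast"
  assumes "m \<in> NN" "n \<in> NN"
  shows "nat_le m n \<longleftrightarrow> (\<exists>k \<in> NN. n = nat_add m k)"
proof
  have "m \<in> elts n \<or> m = n \<longrightarrow> (\<exists>k. k \<in> NN \<and> n = nat_add m k)"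
    using assms(2)
  proof (induction n rule: NN_induct)
    case definable
    show ?case by (intro def_intros)
  next
    case zero
    show ?case by (intro impI exI[of _ vempty]) (auto simp: nat_add_vempty)
  next
    case (succ n)
    have "m = nat_add m vempty" using nat_add_vempty[of m] vcard_of_NN[OF assms(1)] by simp
    with succ show ?case by (metis elts_vsucc insert_iff nat_add_vsucc vempty_NN vsucc_NN)
  qed
  then show "nat_le m n \<Longrightarrow> \<exists>k \<in> NN. n = nat_add m k"
    unfolding nat_le_def mem_elts by blast
next
  have le: "nat_add m k = m \<or> m \<in> elts (nat_add m k)" if "k \<in> NN" for k
    using that
  proof (induction k rule: NN_induct)
    case definable
    show ?case by (intro def_intros)
  qed (auto simp: NN_rec assms)
  assume "\<exists>k \<in> NN. n = nat_add m k"
  then obtain k where "k \<in> NN" "n = nat_add m k" by blast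
  with le[of k] show "nat_le m n" unfolding nat_le_def mem_elts by auto
qed

text \<open>The numbers as a type of their own, so that the type classes of ordered semirings apply.\<close>

typedef (overloaded) 'a vnat = "NN :: 'a::ast set"
  by (rule exI[of _ vempty]) simp

setup_lifting type_definition_vnat

instantiation vnat :: (ast) "{comm_semiring_1, linorder}"
begin

lift_definition zero_vnat :: "'a vnat" is vempty by simp
lift_definition one_vnat :: "'a vnat" is "vsucc vempty" by simp
lift_definition plus_vnat :: "'a vnat \<Rightarrow> 'a vnat \<Rightarrow> 'a vnat" is nat_add by simp
lift_definition times_vnat :: "'a vnat \<Rightarrow> 'a vnat \<Rightarrow> 'a vnat" is nat_mult by simp
lift_definition less_eq_vnat :: "'a vnat \<Rightarrow> 'a vnat \<Rightarrow> bool" is nat_le .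
lift_definition less_vnat :: "'a vnat \<Rightarrow> 'a vnat \<Rightarrow> bool" is mem .

instance
proof
  fix a b c :: "'a vnat"
  show "a + b + c = a + (b + c)" by transfer (rule nat_add_assoc)
  show "a + b = b + a" by transfer (rule nat_add_commute)
  show "0 + a = a" by transfer (rule nat_add_0_left)
  show "a * b * c = a * (b * c)" by transfer (rule nat_mult_assoc)
  show "a * b = b * a" by transfer (rule nat_mult_commute)
  show "1 * a = a" by transfer (simp add: nat_mult_Suc_left nat_mult_0_left nat_add_0_left)
  show "(a + b) * c = a * c + b * c"
    by transfer (metis nat_mult_add_distrib nat_mult_commute nat_add_NN)
  show "0 * a = 0" by transfer (rule nat_mult_0_left)
  show "a * 0 = 0" by transfer (rule nat_mult_vempty)
  show "(0 :: 'a vnat) \<noteq> 1" by transfer simp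
  show "(a < b) = (a \<le> b \<and> \<not> b \<le> a)"
    by transfer (use mem_asym not_mem_self in \<open>auto simp: nat_le_def mem_elts\<close>)
  show "a \<le> a" by transfer (simp add: nat_le_def)
  show "a \<le> b \<Longrightarrow> b \<le> c \<Longrightarrow> a \<le> c"
    by transfer (use NN_trans in \<open>auto simp: nat_le_def mem_elts\<close>)
  show "a \<le> b \<Longrightarrow> b \<le> a \<Longrightarrow> a = b"
    by transfer (use mem_asym in \<open>auto simp: nat_le_def mem_elts\<close>)
  show "a \<le> b \<or> b \<le> a"
    by transfer (use NN_linear in \<open>auto simp: nat_le_def mem_elts\<close>)
qed

end

lemma vnat_le_iff_add: "a \<le> b \<longleftrightarrow> (\<exists>c. b = a + c)" for a b :: "'a::ast vnat"
  by transfer (simp add: nat_le_iff_add)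

lemma vnat_add_cancel: "a + c = b + c \<longleftrightarrow> a = b" for a b c :: "'a::ast vnat"
  by transfer (rule nat_add_cancel)

instantiation vnat :: (ast) linordered_semidom
begin

definition minus_vnat :: "'a vnat \<Rightarrow> 'a vnat \<Rightarrow> 'a vnat" where
  "minus_vnat a b = (if b \<le> a then THE c. a = b + c else 0)"

instance
proof
  fix a b c :: "'a vnat"
  have diff: "(a + b) - a = b" for a b :: "'a vnat"
    unfolding minus_vnat_def
    by (auto simp: vnat_le_iff_add vnat_add_cancel add.commute[of a] intro!: the_equality)
  show "a + b - a = b" by (rule diff)
  show le_diff: "b \<le> a \<Longrightarrow> a - b + b = a" for a b :: "'a vnat"
  proof -
    assume "b \<le> a"
    then obtain c where "a = b + c" by (auto simp: vnat_le_iff_add)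
    then show "a - b + b = a" using diff[of b c] by (simp add: add.commute)
  qed
  have nle: "\<not> b \<le> a \<Longrightarrow> a - b = 0" for a b :: "'a vnat"
    by (simp add: minus_vnat_def)
  have le_add: "a \<le> a + b" for a b :: "'a vnat" by (auto simp: vnat_le_iff_add)
  show "a - b - c = a - (b + c)"
  proof (cases "b + c \<le> a")
    case True
    then obtain d where "a = b + (c + d)" by (auto simp: vnat_le_iff_add add.assoc)
    moreover then have "a = (b + c) + d" by (simp add: add.assoc)
    ultimately show ?thesis by (metis diff)
  next
    case False
    show ?thesis
    proof (cases "b \<le> a")
      case True
      then obtain d where d: "a = b + d" by (auto simp: vnat_le_iff_add)
      with False have "\<not> c \<le> d" by (auto simp: vnat_le_iff_add add.assoc)
      then show ?thesis using False d nle diff by simp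
    next
      case b: False
      have "\<not> c \<le> 0 \<or> c = 0" using le_add[of 0 c] by (auto intro: order.antisym)
      then have "0 - c = 0" using nle diff[of 0 0] by auto
      then show ?thesis using b False nle by simp
    qed
  qed
  have pos: "0 \<le> a" for a :: "'a vnat" using le_add[of 0 a] by simp
  have prod0: "a * b = 0 \<longleftrightarrow> a = 0 \<or> b = 0" for a b :: "'a vnat"
    by transfer (rule nat_mult_eq_0)
  show "a \<noteq> 0 \<Longrightarrow> b \<noteq> 0 \<Longrightarrow> a * b \<noteq> 0" using prod0 by simp
  show "a \<le> b \<Longrightarrow> c + a \<le> c + b" by (auto simp: vnat_le_iff_add add.assoc)
  show less: "a < b \<Longrightarrow> 0 < c \<Longrightarrow> c * a < c * b" for a b c :: "'a vnat"
  proof -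
    assume ab: "a < b" and c: "0 < c"
    obtain d where d: "b = a + d" using less_imp_le[OF ab] vnat_le_iff_add by blast
    with ab have "d \<noteq> 0" by auto
    with c have "c * d \<noteq> 0" using prod0 by auto
    then have "c * a \<noteq> c * a + c * d"
      using vnat_add_cancel[of "c * d" "c * a" 0] by (simp add: add.commute[of "c * d"])
    moreover have "c * b = c * a + c * d" by (simp add: d distrib_left)
    ultimately show "c * a < c * b" using le_add[of "c * a" "c * d"] by (simp add: order.strict_iff_order)
  qed
  show "(0 :: 'a vnat) < 1" using pos[of 1] by (simp add: order.strict_iff_order)
  show "a * (b - c) = a * b - a * c"
  proof (cases "c \<le> b")
    case True
    then obtain d where "b = c + d" by (auto simp: vnat_le_iff_add)
    then show ?thesis using diff by (simp add: distrib_left)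
  next
    case False
    then have bc: "b - c = 0" "b < c" using nle by auto
    show ?thesis
    proof (cases "a = 0")
      case True
      then show ?thesis using diff[of 0 0] by (simp)
    next
      case False
      then have "0 < a" using pos[of a] by (simp add: order.strict_iff_order)
      from less[OF bc(2) this] have "\<not> a * c \<le> a * b" by (simp add: not_le)
      then show ?thesis using nle bc by simp
    qed
  qed
qed

end


section \<open>The ordered field of rationals\<close>

text \<open>The ring of differences of an ordered semiring, built as the integers are built from the
  natural numbers. Its field of fractions is an ordered field, in which the triples \<open>(a, b, c)\<close>
  have the value \<open>(a - b) / c\<close>. Computing with these values avoids all well-definedness
  arguments for the operations on \<open>hrat\<close>.\<close>

definition diff_rel :: "'a::linordered_semidom \<times> 'a \<Rightarrow> 'a \<times> 'a \<Rightarrow> bool" where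
  "diff_rel = (\<lambda>(a, b) (c, d). a + d = c + b)"

lemma difference_eq_trans:
  fixes a b c d e f :: "'a::linordered_semidom"
  assumes "a + d = c + b" "c + f = e + d"
  shows "a + f = e + b"
proof -
  have "(a + f) + (c + d) = (a + d) + (c + f)" by (simp add: ac_simps)
  also have "\<dots> = (e + b) + (c + d)" by (simp add: assms ac_simps)
  finally show ?thesis by simp
qed

quotient_type (overloaded) 'a diffs = "'a::linordered_semidom \<times> 'a" / diff_rel
  morphisms Rep_diffs Abs_diffs
proof (rule equivpI)
  show "reflp diff_rel" by (auto simp: reflp_def diff_rel_def)
  show "symp diff_rel" by (auto simp: symp_def diff_rel_def)
  show "transp diff_rel" by (clarsimp simp: transp_def diff_rel_def) (erule (1) difference_eq_trans)
qed

instantiation diffs :: (linordered_semidom) comm_ring_1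
begin

lift_definition zero_diffs :: "'a diffs" is "(0, 0)" .
lift_definition one_diffs :: "'a diffs" is "(1, 0)" .
lift_definition plus_diffs :: "'a diffs \<Rightarrow> 'a diffs \<Rightarrow> 'a diffs" is
  "\<lambda>(a, b) (c, d). (a + c, b + d)"
  by (clarsimp simp: diff_rel_def) (metis (no_types, opaque_lifting) add.assoc add.commute)
lift_definition uminus_diffs :: "'a diffs \<Rightarrow> 'a diffs" is "\<lambda>(a, b). (b, a)"
  by (auto simp: diff_rel_def add.commute)
lift_definition minus_diffs :: "'a diffs \<Rightarrow> 'a diffs \<Rightarrow> 'a diffs" is
  "\<lambda>(a, b) (c, d). (a + d, b + c)"
  by (clarsimp simp: diff_rel_def) (metis (no_types, opaque_lifting) add.assoc add.commute)
lift_definition times_diffs :: "'a diffs \<Rightarrow> 'a diffs \<Rightarrow> 'a diffs" is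
  "\<lambda>(a, b) (c, d). (a * c + b * d, a * d + b * c)"
proof (clarsimp simp: diff_rel_def)
  fix a b c d a' b' c' d' :: 'a
  assume 1: "a + b' = a' + b" and 2: "c + d' = c' + d"
  have "(a * c + b * d) + (a' * d + b' * c) = (a + b') * c + (a' + b) * d" by (simp add: algebra_simps)
  also have "\<dots> = (a' + b) * c + (a + b') * d" using 1 by simp
  also have "\<dots> = (a' * c + b' * d) + (a * d + b * c)" by (simp add: algebra_simps)
  finally have 3: "(a * c + b * d) + (a' * d + b' * c) = (a' * c + b' * d) + (a * d + b * c)" .
  have "(a' * c + b' * d) + (a' * d' + b' * c') = a' * (c + d') + b' * (c' + d)" by (simp add: algebra_simps)
  also have "\<dots> = a' * (c' + d) + b' * (c + d')" using 2 by simp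
  also have "\<dots> = (a' * c' + b' * d') + (a' * d + b' * c)" by (simp add: algebra_simps)
  finally have 4: "(a' * c + b' * d) + (a' * d' + b' * c') = (a' * c' + b' * d') + (a' * d + b' * c)" .
  have "((a * c + b * d) + (a' * d' + b' * c')) + ((a' * d + b' * c) + (a' * c + b' * d)) =
     ((a * c + b * d) + (a' * d + b' * c)) + ((a' * c + b' * d) + (a' * d' + b' * c'))"
    by (simp add: ac_simps)
  also have "\<dots> = ((a' * c + b' * d) + (a * d + b * c)) + ((a' * c' + b' * d') + (a' * d + b' * c))"
    by (simp only: 3 4)
  also have "\<dots> = ((a' * c' + b' * d') + (a * d + b * c)) + ((a' * d + b' * c) + (a' * c + b' * d))"
    by (simp add: ac_simps)
  finally show "a * c + b * d + (a' * d' + b' * c') = a' * c' + b' * d' + (a * d + b * c)" by simp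
qed

instance
  by (standard; transfer) (auto simp: diff_rel_def algebra_simps)

end

lift_definition diff_less_eq :: "'a::linordered_semidom diffs \<Rightarrow> 'a diffs \<Rightarrow> bool" is
  "\<lambda>(a, b) (c, d). a + d \<le> c + b"
proof (clarsimp simp: diff_rel_def)
  fix a b c d a' b' c' d' :: 'a
  assume 1: "a + b' = a' + b" and 2: "c + d' = c' + d"
  have "a + d \<le> c + b \<longleftrightarrow> (a + d) + (b' + d') \<le> (c + b) + (b' + d')" by simp
  also have "\<dots> \<longleftrightarrow> (a + b') + (d + d') \<le> (c + d') + (b + b')" by (simp add: ac_simps)
  also have "\<dots> \<longleftrightarrow> (a' + d') + (b + d) \<le> (c' + b') + (b + d)" unfolding 1 2 by (simp add: ac_simps)
  also have "\<dots> \<longleftrightarrow> a' + d' \<le> c' + b'" by simp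
  finally show "(a + d \<le> c + b) = (a' + d' \<le> c' + b')" .
qed

instantiation diffs :: (linordered_semidom) linordered_idom
begin

definition less_eq_diffs :: "'a diffs \<Rightarrow> 'a diffs \<Rightarrow> bool" where "less_eq_diffs = diff_less_eq"

definition less_diffs :: "'a diffs \<Rightarrow> 'a diffs \<Rightarrow> bool" where
  "less_diffs x y \<longleftrightarrow> x \<le> y \<and> \<not> y \<le> x"

definition abs_diffs :: "'a diffs \<Rightarrow> 'a diffs" where "abs_diffs x = (if x < 0 then - x else x)"

definition sgn_diffs :: "'a diffs \<Rightarrow> 'a diffs" where
  "sgn_diffs x = (if x = 0 then 0 else if 0 < x then 1 else - 1)"

instance
proof
  fix x y z :: "'a diffs"
  show "(x < y) = (x \<le> y \<and> \<not> y \<le> x)" by (rule less_diffs_def)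
  show "x \<le> x" unfolding less_eq_diffs_def by transfer auto
  show "x \<le> y \<Longrightarrow> y \<le> x \<Longrightarrow> x = y" unfolding less_eq_diffs_def
    by transfer (auto simp: diff_rel_def)
  show linear: "x \<le> y \<or> y \<le> x" for x y :: "'a diffs"
    unfolding less_eq_diffs_def by transfer (auto simp: linear)
  show "x \<le> y \<Longrightarrow> y \<le> z \<Longrightarrow> x \<le> z" unfolding less_eq_diffs_def
  proof (transfer, clarsimp)
    fix a b c d e f :: 'a
    assume "a + d \<le> c + b" "c + f \<le> e + d"
    from add_mono[OF this] have "(a + f) + (c + d) \<le> (e + b) + (c + d)" by (simp add: ac_simps)
    then show "a + f \<le> e + b" by simp
  qed
  show "x \<le> y \<Longrightarrow> z + x \<le> z + y" unfolding less_eq_diffs_def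
  proof (transfer, clarsimp)
    fix a b c d e f :: 'a
    assume "a + d \<le> c + b"
    then have "(a + d) + (e + f) \<le> (c + b) + (e + f)" by simp
    then show "e + a + (f + d) \<le> e + c + (f + b)" by (simp add: ac_simps)
  qed
  have mult_less: "(e * a + f * b) + (e * d + f * c) < (e * c + f * d) + (e * b + f * a)"
    if 1: "a + d < c + b" and "f < e" for a b c d e f :: 'a
  proof -
    from \<open>f < e\<close> obtain k where k: "e = f + k" "0 < k"
      by (metis add.commute le_add_diff_inverse2 less_imp_le less_add_same_cancel1)
    have "k * (a + d) < k * (c + b)" using mult_strict_left_mono[OF 1 k(2)] .
    then have "k * (a + d) + f * (a + b + c + d) < k * (c + b) + f * (a + b + c + d)" by simp
    then show ?thesis using k(1) by (simp add: algebra_simps)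
  qed
  have less: "x < y \<longleftrightarrow> \<not> diff_less_eq y x" for x y :: "'a diffs"
    using linear unfolding less_diffs_def less_eq_diffs_def by blast
  show "x < y \<Longrightarrow> 0 < z \<Longrightarrow> z * x < z * y"
    unfolding less
  proof (transfer, goal_cases)
    case (1 y x z)
    then show ?case
      using mult_less[of "fst x" "snd y" "fst y" "snd x" "snd z" "fst z"]
      by (simp add: case_prod_unfold not_le)
  qed
  show "\<bar>x\<bar> = (if x < 0 then - x else x)" by (rule abs_diffs_def)
  show "sgn x = (if x = 0 then 0 else if 0 < x then 1 else - 1)" by (rule sgn_diffs_def)
qed

end

lift_definition diff_of :: "'a::linordered_semidom \<Rightarrow> 'a diffs" is "\<lambda>a. (a, 0)" .

lemma diff_of_simps:
  "diff_of 0 = 0" "diff_of 1 = 1" "diff_of (a + b) = diff_of a + diff_of b"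
  "diff_of (a * b) = diff_of a * diff_of b"
  by (transfer, auto simp: diff_rel_def)+

lemma diff_of_le: "diff_of a \<le> diff_of b \<longleftrightarrow> a \<le> b"
  unfolding less_eq_diffs_def by transfer simp

lemma diffs_cases: obtains a b where "x = diff_of a - diff_of b"
proof -
  have "\<exists>a b. x = diff_of a - diff_of b" by transfer (auto simp: diff_rel_def)
  with that show ?thesis by blast
qed

definition nval :: "'a::ast \<Rightarrow> 'a vnat diffs fract" where
  "nval n = Fract (diff_of (Abs_vnat n)) 1"

lemma Abs_vnat_simps:
  "m \<in> NN \<Longrightarrow> n \<in> NN \<Longrightarrow> Abs_vnat (nat_add m n) = Abs_vnat m + Abs_vnat n"
  "m \<in> NN \<Longrightarrow> n \<in> NN \<Longrightarrow> Abs_vnat (nat_mult m n) = Abs_vnat m * Abs_vnat n"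
  "Abs_vnat vempty = 0" "Abs_vnat (vsucc vempty) = 1"
  "m \<in> NN \<Longrightarrow> n \<in> NN \<Longrightarrow> Abs_vnat m \<le> Abs_vnat n \<longleftrightarrow> nat_le m n"
  by (simp_all add: plus_vnat_def times_vnat_def zero_vnat_def one_vnat_def less_eq_vnat_def
      Abs_vnat_inverse)

lemma nval_vempty [simp]: "nval vempty = 0"
  and nval_one [simp]: "nval (vsucc vempty) = 1"
  by (simp_all add: nval_def Abs_vnat_simps diff_of_simps Zero_fract_def One_fract_def)

lemma nval_add [simp]: "m \<in> NN \<Longrightarrow> n \<in> NN \<Longrightarrow> nval (nat_add m n) = nval m + nval n"
  and nval_mult [simp]: "m \<in> NN \<Longrightarrow> n \<in> NN \<Longrightarrow> nval (nat_mult m n) = nval m * nval n"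
  by (simp_all add: nval_def Abs_vnat_simps diff_of_simps)

lemma nval_le: "m \<in> NN \<Longrightarrow> n \<in> NN \<Longrightarrow> nval m \<le> nval n \<longleftrightarrow> nat_le m n"
  by (simp add: nval_def Abs_vnat_simps diff_of_le)

lemma nval_inject: "m \<in> NN \<Longrightarrow> n \<in> NN \<Longrightarrow> nval m = nval n \<longleftrightarrow> m = n"
  using nval_le[of m n] nval_le[of n m] mem_asym[of m n]
  by (auto simp: nat_le_def mem_elts)

lemma nval_eq_0: "n \<in> NN \<Longrightarrow> nval n = 0 \<longleftrightarrow> n = vempty"
  using nval_inject[of n vempty] by simp

lemma nval_ge_0: "n \<in> NN \<Longrightarrow> 0 \<le> nval n"
  using nval_le[of vempty n] NN_linear[of vempty n] by (auto simp: nat_le_def mem_elts)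

fun fval :: "'a::ast \<times> 'a \<times> 'a \<Rightarrow> 'a vnat diffs fract" where
  "fval (a, b, c) = (nval a - nval b) / nval c"

lemma frac_triples_iff [simp]:
  "(a, b, c) \<in> frac_triples \<longleftrightarrow> a \<in> NN \<and> b \<in> NN \<and> c \<in> NN \<and> c \<noteq> vempty"
  by (simp add: frac_triples_def)

lemma frac_class_eq: "t \<in> frac_triples \<Longrightarrow> frac_class t = {t' \<in> frac_triples. fval t = fval t'}"
proof (cases t)
  case (fields a b c)
  assume t: "t \<in> frac_triples"
  have "nat_add (nat_mult a c') (nat_mult b' c) = nat_add (nat_mult a' c) (nat_mult b c') \<longleftrightarrow>
      fval t = fval (a', b', c')" if "(a', b', c') \<in> frac_triples" for a' b' c'
  proof -
    have "nat_add (nat_mult a c') (nat_mult b' c) = nat_add (nat_mult a' c) (nat_mult b c') \<longleftrightarrow>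
       nval (nat_add (nat_mult a c') (nat_mult b' c)) = nval (nat_add (nat_mult a' c) (nat_mult b c'))"
      by (rule nval_inject[symmetric]) auto
    also have "\<dots> \<longleftrightarrow> nval a * nval c' + nval b' * nval c = nval a' * nval c + nval b * nval c'"
      using that t fields by simp
    also have "\<dots> \<longleftrightarrow> fval t = fval (a', b', c')"
      using that t fields by (auto simp: frac_eq_eq nval_eq_0 algebra_simps)
    finally show ?thesis .
  qed
  then show ?thesis by (auto simp: frac_class_def fields)
qed

lemma hrat_eq_iff:
  assumes "t \<in> frac_triples" "t' \<in> frac_triples"
  shows "hrat t = hrat t' \<longleftrightarrow> fval t = fval t'"
proof -
  have "hrat t = hrat t' \<longleftrightarrow> frac_class t = frac_class t'"
    unfolding hrat_def using assms by (intro Abs_hrat_inject) auto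
  then show ?thesis using assms by (auto simp: frac_class_eq)
qed

lemma frac_rep: "frac_rep q \<in> frac_triples \<and> q = hrat (frac_rep q)"
proof -
  have "\<exists>t. t \<in> frac_triples \<and> q = hrat t"
    unfolding hrat_def by (cases q rule: Abs_hrat_cases) (auto simp del: frac_triples_iff)
  then show ?thesis unfolding frac_rep_def by (rule someI_ex)
qed

text \<open>An embedding of \<open>hrat\<close> into a known ordered field. It is bijective and commutes with all
  operations, hence the axioms of an ordered field can be pulled back along it.\<close>

definition hval :: "'a::ast hrat \<Rightarrow> 'a vnat diffs fract" where
  "hval q = fval (frac_rep q)"

lemma hval_hrat: "t \<in> frac_triples \<Longrightarrow> hval (hrat t) = fval t"
  unfolding hval_def using frac_rep[of "hrat t"] hrat_eq_iff by metis

lemma hval_inject: "hval p = hval q \<longleftrightarrow> p = q"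
  using frac_rep[of p] frac_rep[of q] hrat_eq_iff unfolding hval_def by metis

lemma hrat_cases:
  obtains a b c where "frac_rep q = (a, b, c)" "a \<in> NN" "b \<in> NN" "c \<in> NN" "c \<noteq> vempty"
    "hval q = (nval a - nval b) / nval c" "0 < nval c"
proof -
  obtain a b c where abc: "frac_rep q = (a, b, c)" by (cases "frac_rep q")
  then have t: "(a, b, c) \<in> frac_triples" using frac_rep[of q] by simp
  then have "0 < nval c" using nval_ge_0[of c] nval_eq_0[of c] by (simp add: order.strict_iff_order)
  then show ?thesis using that abc t by (simp add: hval_def)
qed

lemma nat_mult_neq_vempty:
  "m \<in> NN \<Longrightarrow> n \<in> NN \<Longrightarrow> m \<noteq> vempty \<Longrightarrow> n \<noteq> vempty \<Longrightarrow> nat_mult m n \<noteq> vempty"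
  by (simp add: nat_mult_eq_0)

lemma hval_of_N: "n \<in> NN \<Longrightarrow> hval (of_N n) = nval n"
  unfolding of_N_def by (subst hval_hrat) auto

lemma hval_0: "hval 0 = 0" and hval_1: "hval 1 = 1"
  by (simp_all add: zero_hrat_def one_hrat_def hval_of_N)

lemma hval_add: "hval (p + q) = hval p + hval q"
proof (cases p rule: hrat_cases)
  case p: (1 a b c)
  show ?thesis
  proof (cases q rule: hrat_cases)
    case q: (1 a' b' c')
    show ?thesis unfolding plus_hrat_def p(1) q(1) prod.case
      by (subst hval_hrat) (use p(2-5,7) q(2-5,7) in \<open>auto simp: p(6) q(6) nat_mult_neq_vempty field_simps\<close>)
  qed
qed

lemma hval_minus: "hval (- p) = - hval p"
proof (cases p rule: hrat_cases)
  case p: (1 a b c)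
  show ?thesis unfolding uminus_hrat_def p(1) prod.case
    by (subst hval_hrat) (use p in \<open>auto simp: field_simps\<close>)
qed

lemma hval_mult: "hval (p * q) = hval p * hval q"
proof (cases p rule: hrat_cases)
  case p: (1 a b c)
  show ?thesis
  proof (cases q rule: hrat_cases)
    case q: (1 a' b' c')
    show ?thesis unfolding times_hrat_def p(1) q(1) prod.case
      by (subst hval_hrat) (use p(2-5,7) q(2-5,7) in \<open>auto simp: p(6) q(6) nat_mult_neq_vempty field_simps\<close>)
  qed
qed

lemma hval_le: "hval p \<le> hval q \<longleftrightarrow> p \<le> q"
proof (cases p rule: hrat_cases)
  case p: (1 a b c)
  show ?thesis
  proof (cases q rule: hrat_cases)
    case q: (1 a' b' c')
    have "p \<le> q \<longleftrightarrow> nval (nat_add (nat_mult a c') (nat_mult b' c)) \<le> nval (nat_add (nat_mult a' c) (nat_mult b c'))"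
      unfolding less_eq_hrat_def p(1) q(1) prod.case by (rule nval_le[symmetric]) auto
    also have "\<dots> \<longleftrightarrow> hval p \<le> hval q"
      using p(2-5,7) q(2-5,7) by (simp add: p(6) q(6) field_simps)
    finally show ?thesis by simp
  qed
qed

lemma hval_surj: "\<exists>q. hval q = x"
proof (induction x rule: fract_induct_pos)
  case (Fract x y)
  obtain a b where x: "x = diff_of a - diff_of b" by (rule diffs_cases)
  obtain c d where y: "y = diff_of c - diff_of d" by (rule diffs_cases)
  have "d < c"
    using Fract y diff_of_le[of c d] by (auto simp: not_le[symmetric])
  then have c: "c = d + (c - d)" "c - d \<noteq> 0"
    by (metis add.commute le_add_diff_inverse2 less_imp_le, metis add_0 le_add_diff_inverse2 less_imp_le less_irrefl)
  then have y: "y = diff_of (c - d)" using y by (metis add_diff_cancel_left' diff_of_simps(3))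
  let ?t = "(Rep_vnat a, Rep_vnat b, Rep_vnat (c - d))"
  have t: "?t \<in> frac_triples"
    using Rep_vnat c(2) by (auto simp: zero_vnat.rep_eq[symmetric] Rep_vnat_inject)
  have "fval ?t = Fract x y"
    using Fract unfolding fval.simps nval_def Rep_vnat_inverse x y by simp
  then show ?case using hval_hrat[OF t] by metis
qed

instance hrat :: (ast) linordered_field
proof
  fix p q r :: "'a hrat"
  note hval = hval_add hval_minus hval_mult hval_0 hval_1
  have minus: "hval (p - q) = hval p - hval q" for p q :: "'a hrat"
    by (simp add: minus_hrat_def hval)
  have comm: "p * q = q * p" for p q :: "'a hrat"
    by (simp add: hval_inject[symmetric] hval)
  show "p * q = q * p" by (rule comm)
  show "p + q + r = p + (q + r)" "p + q = q + p" "p + q - p = q" "p - q - r = p - (q + r)" "0 + p = p" "- p + p = 0" "p - q = p + - q"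
    "p * q * r = p * (q * r)" "0 * p = 0" "p * 0 = 0" "1 * p = p" "(p + q) * r = p * r + q * r"
    "(0 :: 'a hrat) \<noteq> 1"
    by (simp_all add: hval_inject[symmetric] hval minus algebra_simps)
  show inv: "p \<noteq> 0 \<Longrightarrow> inverse p * p = 1" for p :: "'a hrat"
  proof -
    assume p: "p \<noteq> 0"
    obtain q where q: "hval q = inverse (hval p)" using hval_surj by blast
    have "hval p \<noteq> 0" using p hval_inject[of p 0] by (simp add: hval)
    then have iff: "p * r = 1 \<longleftrightarrow> r = q" for r
      unfolding hval_inject[symmetric] hval q by (auto simp: field_simps)
    then have "inverse p = q" using p by (simp add: inverse_hrat_def)
    then show "inverse p * p = 1" using iff[of q] comm[of q p] by simp
  qed
  show "p / q = p * inverse q" by (rule divide_hrat_def)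
  show "inverse (0 :: 'a hrat) = 0" by (simp add: inverse_hrat_def)
  show "(p < q) = (p \<le> q \<and> \<not> q \<le> p)" by (rule less_hrat_def)
  have less: "p < q \<longleftrightarrow> hval p < hval q" for p q :: "'a hrat"
    by (auto simp: less_hrat_def hval_le[symmetric])
  show "p \<le> p" "p \<le> q \<Longrightarrow> q \<le> r \<Longrightarrow> p \<le> r" "p \<le> q \<Longrightarrow> q \<le> p \<Longrightarrow> p = q" "p \<le> q \<or> q \<le> p"
    "p \<le> q \<Longrightarrow> r + p \<le> r + q"
    by (auto simp: hval_le[symmetric] hval_inject[symmetric] hval)
  show "p < q \<Longrightarrow> 0 < r \<Longrightarrow> r * p < r * q"
    by (simp add: less hval)
  show "\<bar>p\<bar> = (if p < 0 then - p else p)" by (rule abs_hrat_def)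
  show "sgn p = (if p = 0 then 0 else if 0 < p then 1 else - 1)" by (rule sgn_hrat_def)
qed

lemma of_N_vempty [simp]: "of_N vempty = 0" and of_N_one: "of_N (vsucc vempty) = 1"
  by (simp_all add: zero_hrat_def one_hrat_def)

lemma of_N_add: "m \<in> NN \<Longrightarrow> n \<in> NN \<Longrightarrow> of_N (nat_add m n) = of_N m + of_N n"
  by (simp add: hval_inject[symmetric] hval_add hval_of_N)

lemma of_N_mult: "m \<in> NN \<Longrightarrow> n \<in> NN \<Longrightarrow> of_N (nat_mult m n) = of_N m * of_N n"
  by (simp add: hval_inject[symmetric] hval_mult hval_of_N)

lemma of_N_le: "m \<in> NN \<Longrightarrow> n \<in> NN \<Longrightarrow> of_N m \<le> of_N n \<longleftrightarrow> nat_le m n"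
  by (simp add: hval_le[symmetric] hval_of_N nval_le)

lemma of_N_inject: "m \<in> NN \<Longrightarrow> n \<in> NN \<Longrightarrow> of_N m = of_N n \<longleftrightarrow> m = n"
  by (simp add: hval_inject[symmetric] hval_of_N nval_inject)

lemma of_N_less: "m \<in> NN \<Longrightarrow> n \<in> NN \<Longrightarrow> of_N m < of_N n \<longleftrightarrow> m \<in> elts n"
  using of_N_le[of n m] NN_linear[of m n] mem_asym[of m n] not_mem_self[of m]
  by (auto simp: not_le[symmetric] nat_le_def mem_elts)

lemma of_N_ge_0: "n \<in> NN \<Longrightarrow> 0 \<le> of_N n"
  by (simp add: hval_le[symmetric] hval_of_N hval_0 nval_ge_0)

lemma of_N_vsucc: "n \<in> NN \<Longrightarrow> of_N (vsucc n) = of_N n + 1"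
  using of_N_add[of n "vsucc vempty"] by (simp add: NN_rec of_N_one)

lemma hrat_eq_quotient:
  obtains a b c where "a \<in> NN" "b \<in> NN" "c \<in> NN" "0 < of_N c" "q = (of_N a - of_N b) / of_N c"
proof (cases q rule: hrat_cases)
  case (1 a b c)
  then have c: "0 < of_N c"
    using of_N_ge_0[of c] of_N_inject[of c vempty] by (simp add: order.strict_iff_order)
  have "hval (q * of_N c) = hval (of_N a - of_N b)"
    using 1 by (simp add: hval_mult hval_of_N diff_conv_add_uminus hval_add hval_minus del: add_uminus_conv_diff)
  then have "q * of_N c = of_N a - of_N b" by (simp add: hval_inject)
  then show ?thesis using that 1 c by (simp add: field_simps)
qed


section \<open>Finite natural numbers and saturation\<close>

primrec fin :: "nat \<Rightarrow> 'a::ast" where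
  "fin 0 = vempty"
| "fin (Suc k) = vsucc (fin k)"

lemma elts_fin: "elts (fin k) = fin ` {..<k}"
  by (induction k) (auto simp: lessThan_Suc)

lemma fin_NN [simp]: "fin k \<in> NN"
  by (induction k) auto

lemma of_N_fin [simp]: "of_N (fin k) = of_nat k"
  by (induction k) (auto simp: of_N_vsucc)

lemma fin_mem_iff: "(fin i :: 'a::ast) \<in> elts (fin j) \<longleftrightarrow> i < j"
  using of_N_less[of "fin i :: 'a" "fin j"] by simp

lemma fin_eq_iff [simp]: "(fin i :: 'a::ast) = fin j \<longleftrightarrow> i = j"
  using of_N_inject[of "fin i :: 'a" "fin j"] by simp

lemma fin_le_iff: "nat_le (fin i :: 'a::ast) (fin j) \<longleftrightarrow> i \<le> j"
  using of_N_le[of "fin i :: 'a" "fin j"] by simp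

lemma is_set_finite: "finite X \<Longrightarrow> is_set X" for X :: "'a::ast set"
  by (induction rule: finite_induct) (auto intro: empty_set is_set_insert)

text \<open>It would be an inductive set.\<close>

lemma not_is_set_range_fin: "\<not> is_set (range fin :: 'a::ast set)"
proof
  assume "is_set (range fin :: 'a set)"
  then have "elts (the_set (range fin)) = (range fin :: 'a set)" by (rule elts_the_set)
  moreover have "(vempty :: 'a) \<in> range fin" by (metis fin.simps(1) rangeI)
  moreover have "vsucc y \<in> range fin" if "y \<in> range fin" for y :: 'a
    using that by (metis fin.simps(2) rangeE rangeI)
  ultimately show False using no_infinity mem_elts by metis
qed

lemma NN_not_fin:
  fixes n :: "'a::ast"
  assumes "n \<in> NN" "n \<notin> range fin"
  shows "fin k \<in> elts n"
proof -
  have "fin k \<noteq> n" using assms(2) by blast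
  moreover have "n \<notin> elts (fin k)" using assms(2) unfolding elts_fin by blast
  ultimately show ?thesis using NN_linear[OF fin_NN assms(1)] by blast
qed

text \<open>A number outside of the range has all \<open>fin k\<close> as elements, so it has the subclass
  \<open>range fin\<close>, which is not a set. Conversely, a subclass of \<open>fin k\<close> has finitely many elements
  in the sense of HOL.\<close>

lemma FN_eq: "FN = range (fin :: nat \<Rightarrow> 'a::ast)"
proof
  show "FN \<subseteq> range (fin :: nat \<Rightarrow> 'a)"
  proof
    fix n :: 'a
    assume n: "n \<in> FN"
    show "n \<in> range fin"
    proof (rule ccontr)
      assume "n \<notin> range fin"
      then have "range fin \<subseteq> elts n" using n NN_not_fin unfolding FN_def by blast
      then show False using n not_is_set_range_fin unfolding FN_def by blast
    qed
  qed
  have "is_set X" if "X \<subseteq> elts (fin k)" for X :: "'a set" and k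
    using that by (intro is_set_finite) (metis elts_fin finite_imageI finite_lessThan finite_subset)
  then show "range fin \<subseteq> (FN :: 'a set)" unfolding FN_def by auto
qed

text \<open>Otherwise \<open>range fin\<close> could be separated from a set. A set that includes it is the domain
  of a prolongation of the identity function on \<open>FN\<close>.\<close>

lemma overspill:
  fixes P :: "'a::ast \<Rightarrow> bool"
  assumes "definable (\<lambda>v. P (v 0))" "\<And>k. P (fin k)"
  obtains n where "n \<in> NN" "n \<notin> range fin" "P n"
proof (rule ccontr)
  assume no: "\<not> thesis"
  obtain f :: 'a where f: "set_fun f" "\<forall>n \<in> FN. opair n n \<in>\<^sub>V f"
    using prolongation[of "\<lambda>n. n"] by blast
  define d where "d = the_set {x. \<exists>p \<in> elts f. \<exists>y. p = opair x y}"
  have "is_set {x. \<exists>p \<in> elts f. \<exists>y. p = opair x y}"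
    by (rule definable_replacement) (auto intro!: def_intros)
  then have d: "elts d = {x. \<exists>p \<in> elts f. \<exists>y. p = opair x y}"
    unfolding d_def by (rule elts_the_set)
  have "is_set {x \<in> elts d. x \<in> NN \<and> P x}"
    by (rule is_set_separation) (intro def_intros assms(1))
  also have "{x \<in> elts d. x \<in> NN \<and> P x} = range fin"
  proof (intro equalityI subsetI)
    fix x :: 'a assume "x \<in> range fin"
    then have "opair x x \<in> elts f" "x \<in> NN" "P x"
      using f(2) assms(2) unfolding FN_eq mem_elts by auto
    then show "x \<in> {x \<in> elts d. x \<in> NN \<and> P x}" unfolding d by blast
  qed (use no that in blast)
  finally show False using not_is_set_range_fin by blast
qed

text \<open>Prolong the sequence to a set function and overspill the statement that some \<open>x\<close> serves all
  values at arguments below \<open>m\<close>.\<close>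

lemma saturation:
  fixes a :: "nat \<Rightarrow> 'a::ast"
  assumes "definable (\<lambda>v. P (v 0) (v 1))" and "\<And>n. \<exists>x. \<forall>i<n. P x (a i)"
  shows "\<exists>x. \<forall>n. P x (a n)"
proof -
  obtain f :: 'a where f: "set_fun f" "\<forall>n \<in> FN. opair n (a (inv fin n)) \<in>\<^sub>V f"
    using prolongation[of "\<lambda>n. a (inv fin n)"] by blast
  have inv: "inv fin (fin i :: 'a) = i" for i by (intro inv_f_f injI) simp
  have "opair (fin i) (a i) \<in> elts f" for i
    using bspec[OF f(2), of "fin i"] unfolding FN_eq inv mem_elts by simp
  then have fa: "opair (fin i) y \<in> elts f \<longleftrightarrow> y = a i" for i y
    using f(1) unfolding set_fun_def mem_elts by blast
  let ?Q = "\<lambda>m. \<exists>x. \<forall>i \<in> elts m. \<forall>y. opair i y \<in> elts f \<longrightarrow> P x y"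
  have "definable (\<lambda>v. ?Q (v 0))"
    by (intro def_intros definable_app2[OF assms(1)])
  moreover have "?Q (fin k)" for k
    using assms(2)[of k] unfolding elts_fin by (auto simp: fa)
  ultimately obtain m where m: "m \<in> NN" "m \<notin> range fin" "?Q m" by (rule overspill)
  then show ?thesis using NN_not_fin[OF m(1,2)] fa by blast
qed

section \<open>Sizes of sets\<close>

definition csize :: "'a::ast set \<Rightarrow> 'a hrat" where
  "csize X = of_N (vcard (the_set X))"

lemma csize_ge_0: "0 \<le> csize X"
  by (simp add: csize_def of_N_ge_0)

lemma is_set_definable_Int: "set_definable X \<Longrightarrow> is_set Y \<Longrightarrow> is_set (X \<inter> Y)"
  for X :: "'a::ast set"
proof -
  assume "set_definable X" and Y: "is_set Y"
  then have "definable (\<lambda>v. v 0 \<in> X)" using definable_pred_set[of "\<lambda>x. x \<in> X"] by simp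
  from is_set_separation[OF this, of "the_set Y"] show ?thesis
    using Y by (simp add: elts_the_set Int_def conj_commute)
qed

lemma is_set_imp_definable: "is_set X \<Longrightarrow> set_definable X" for X :: "'a::ast set"
proof -
  assume "is_set X"
  then obtain x where "X = {y. y \<in> elts x}" unfolding is_set_def by auto
  moreover have "definable (\<lambda>v. v 0 \<in> elts x)" by (intro def_intros)
  ultimately show ?thesis using definable_pred_set[of "\<lambda>y. y \<in> elts x"] by simp
qed

lemma is_set_Int: "is_set X \<Longrightarrow> is_set Y \<Longrightarrow> is_set (X \<inter> Y)" for X :: "'a::ast set"
  by (intro is_set_definable_Int is_set_imp_definable)

lemma is_set_Diff:
  fixes X Y :: "'a::ast set"
  assumes "is_set X" "is_set Y" shows "is_set (X - Y)"
proof -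
  have "definable (\<lambda>v. v 0 \<notin> elts (the_set Y))" by (intro def_intros)
  from is_set_separation[OF this, of "the_set X"] show ?thesis
    using assms by (simp add: elts_the_set set_diff_eq)
qed

lemma csize_Un_disjoint:
  "is_set X \<Longrightarrow> is_set Y \<Longrightarrow> X \<inter> Y = {} \<Longrightarrow> csize (X \<union> Y) = csize X + csize Y"
  unfolding csize_def
  by (subst vcard_Un_disjoint[of "the_set X" "the_set Y"]) (auto simp: elts_the_set is_set_Un of_N_add)

lemma csize_Un_Int:
  assumes "is_set X" "is_set Y"
  shows "csize (X \<union> Y) + csize (X \<inter> Y) = csize X + csize Y"
proof -
  have "csize (X \<union> (Y - X)) = csize X + csize (Y - X)"
    by (intro csize_Un_disjoint assms is_set_Diff) auto
  moreover have "csize ((Y - X) \<union> (X \<inter> Y)) = csize (Y - X) + csize (X \<inter> Y)"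
    by (intro csize_Un_disjoint assms is_set_Diff is_set_Int) auto
  moreover have "(Y - X) \<union> (X \<inter> Y) = Y" by auto
  ultimately show ?thesis by simp
qed

lemma csize_mono:
  assumes "is_set X" "is_set Y" "X \<subseteq> Y"
  shows "csize X \<le> csize Y"
proof -
  have "csize (X \<union> (Y - X)) = csize X + csize (Y - X)"
    by (intro csize_Un_disjoint assms is_set_Diff) auto
  moreover have "X \<union> (Y - X) = Y" using assms(3) by auto
  ultimately show ?thesis using csize_ge_0[of "Y - X"] by simp
qed

lemma csize_eq_0_iff: "is_set X \<Longrightarrow> csize X = 0 \<longleftrightarrow> X = {}"
proof -
  assume "is_set X"
  have "vcard (the_set X) = vempty \<longleftrightarrow> elts (the_set X) = {}"
    using vcard_equinumerous[of "the_set X"] vcard_empty set_ext[of "the_set X" vempty]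
    unfolding set_equinumerous_iff_internal bij_betw_def by (metis elts_vempty image_is_empty)
  then show ?thesis
    using \<open>is_set X\<close> of_N_inject[of "vcard (the_set X)" vempty] by (simp add: csize_def elts_the_set)
qed

lemma csize_psubset:
  assumes "is_set X" "is_set Y" "X \<subset> Y"
  shows "csize X < csize Y"
proof -
  have "csize (X \<union> (Y - X)) = csize X + csize (Y - X)"
    by (intro csize_Un_disjoint assms is_set_Diff) auto
  moreover have "X \<union> (Y - X) = Y" using assms(3) by auto
  moreover have "0 < csize (Y - X)"
    using assms csize_ge_0[of "Y - X"] csize_eq_0_iff[OF is_set_Diff[OF assms(2,1)]]
    by (auto simp: order.strict_iff_order)
  ultimately show ?thesis by simp
qed

lemma definable_nat_le [def_intros]:
  "definable_term s \<Longrightarrow> definable_term t \<Longrightarrow> definable (\<lambda>v. nat_le (s v) (t v))"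
  unfolding nat_le_def by (intro def_intros)

lemma of_N_le_quotient_iff:
  assumes "a \<in> NN" "b \<in> NN" "c \<in> NN" "0 < of_N c" "n \<in> NN"
  shows "of_N n \<le> (of_N a - of_N b) / of_N c \<longleftrightarrow> nat_le (nat_add (nat_mult n c) b) a"
    and "(of_N a - of_N b) / of_N c \<le> of_N n \<longleftrightarrow> nat_le a (nat_add (nat_mult n c) b)"
  using assms by (auto simp: of_N_le[symmetric] of_N_add of_N_mult field_simps)

text \<open>The bound \<open>q\<close> is not a set but can be replaced by three numbers that represent it.\<close>

lemma definable_csize_le [def_intros]:
  assumes "definable_term t"
  shows "definable (\<lambda>v. csize (elts (t v)) \<le> q)" "definable (\<lambda>v. q \<le> csize (elts (t v)))"
proof -
  obtain a b c where "a \<in> NN" "b \<in> NN" "c \<in> NN" "0 < of_N c" "q = (of_N a - of_N b) / of_N c"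
    by (rule hrat_eq_quotient)
  note iff = of_N_le_quotient_iff[OF this(1-4) vcard_NN, folded this(5)]
  show "definable (\<lambda>v. csize (elts (t v)) \<le> q)" "definable (\<lambda>v. q \<le> csize (elts (t v)))"
    unfolding csize_def the_set_elts iff by (intro def_intros assms)+
qed

text \<open>The number \<open>n + 1\<close> is the least number above \<open>q\<close>; to be above \<open>q\<close> is set-definable.\<close>

lemma hrat_floor:
  fixes q :: "'a::ast hrat"
  assumes "0 \<le> q"
  obtains n where "n \<in> NN" "of_N n \<le> q" "q < of_N n + 1"
proof -
  obtain a b c where abc: "a \<in> NN" "b \<in> NN" "c \<in> NN" "0 < of_N c" "q = (of_N a - of_N b) / of_N c"
    by (rule hrat_eq_quotient)
  let ?P = "\<lambda>n. \<not> nat_le (nat_add (nat_mult n c) b) a"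
  have P: "?P n \<longleftrightarrow> q < of_N n" if "n \<in> NN" for n
    using of_N_le_quotient_iff(1)[OF abc(1-4) that] abc(5) by auto
  have def: "definable (\<lambda>v. ?P (v 0))" by (intro def_intros)
  have "1 \<le> of_N c"
    using of_N_le[of "vsucc vempty" c] of_N_less[of vempty c] abc NN_vsucc_mem[of c vempty]
    by (auto simp: nat_le_def mem_elts of_N_one)
  have "q < of_N (vsucc a)"
  proof -
    have "q \<le> of_N a / of_N c" unfolding abc(5) using abc(2,4) of_N_ge_0[of b] by (intro divide_right_mono) auto
    also have "\<dots> \<le> of_N a" using abc(1) \<open>1 \<le> of_N c\<close> of_N_ge_0[of a] by (simp add: divide_le_eq mult_left_le mult_le_cancel_left1)
    finally show ?thesis using abc(1) by (simp add: of_N_vsucc)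
  qed
  then have "?P (vsucc a)" using P abc(1) by simp
  from NN_least[of ?P, OF def _ this] abc(1)
  obtain m where m: "m \<in> NN" "?P m" "\<And>k. k \<in> elts m \<Longrightarrow> \<not> ?P k" by auto
  from m(1) show ?thesis
  proof (cases rule: NN_cases)
    case zero
    then show ?thesis using m(2) P[OF m(1)] assms by simp
  next
    case (succ k)
    then have "of_N k \<le> q" using m(3)[of k] P[of k] by auto
    moreover have "q < of_N k + 1" using m(1,2) P succ by (simp add: of_N_vsucc)
    ultimately show ?thesis using that succ by blast
  qed
qed

section \<open>Capacity\<close>

text \<open>By saturation, since the \<open>n\<close>-th set is included in all the earlier ones.\<close>

lemma decreasing_sets_core:
  fixes D :: "nat \<Rightarrow> 'a::ast set"
  assumes "\<And>n. is_set (D n)" "\<And>n. D (Suc n) \<subseteq> D n" "\<And>n. p \<le> csize (D n)"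
  shows "\<exists>E. is_set E \<and> (\<forall>n. E \<subseteq> D n) \<and> p \<le> csize E"
proof -
  have D: "elts (the_set (D n)) = D n" for n using assms(1) by (rule elts_the_set)
  let ?P = "\<lambda>x y. elts x \<subseteq> elts y \<and> p \<le> csize (elts x)"
  have "definable (\<lambda>v. ?P (v 0) (v 1))" by (intro def_intros)
  moreover have "\<exists>x. \<forall>i<n. ?P x (the_set (D i))" for n
  proof -
    have "\<forall>i<n. ?P (the_set (D n)) (the_set (D i))"
      using assms(3) lift_Suc_antimono_le[of D, OF assms(2)] by (auto simp: D less_imp_le)
    then show ?thesis by blast
  qed
  ultimately have "\<exists>x. \<forall>n. ?P x (the_set (D n))" by (rule saturation)
  then show ?thesis unfolding D by (metis is_set_elts)
qed

lemma increasing_sets_hull: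
  fixes V :: "nat \<Rightarrow> 'a::ast set"
  assumes "\<And>n. is_set (V n)" "\<And>n. V n \<subseteq> V (Suc n)" "\<And>n. csize (V n) \<le> p"
  shows "\<exists>W. is_set W \<and> (\<forall>n. V n \<subseteq> W) \<and> csize W \<le> p"
proof -
  have V: "elts (the_set (V n)) = V n" for n using assms(1) by (rule elts_the_set)
  let ?P = "\<lambda>x y. elts y \<subseteq> elts x \<and> csize (elts x) \<le> p"
  have "definable (\<lambda>v. ?P (v 0) (v 1))" by (intro def_intros)
  moreover have "\<exists>x. \<forall>i<n. ?P x (the_set (V i))" for n
  proof -
    have "\<forall>i<n. ?P (the_set (V n)) (the_set (V i))"
      using assms(3) lift_Suc_mono_le[of V, OF assms(2)] by (auto simp: V less_imp_le)
    then show ?thesis by blast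
  qed
  ultimately have "\<exists>x. \<forall>n. ?P x (the_set (V n))" by (rule saturation)
  then show ?thesis unfolding V by (metis is_set_elts)
qed

text \<open>Sizes of hulls of \<open>X\<close> need not have a minimum, because the class of these sizes is not
  definable. But starting from \<open>p\<close> one can descend by steps of \<open>\<delta>\<close> only finitely often.\<close>

lemma near_optimal_hull:
  fixes X :: "'a::ast set"
  assumes "0 < \<delta>" "p \<le> of_nat K * \<delta>" "is_set U" "X \<subseteq> U" "csize U \<le> p"
  shows "\<exists>U. is_set U \<and> X \<subseteq> U \<and> csize U \<le> p \<and> (\<forall>U'. is_set U' \<longrightarrow> X \<subseteq> U' \<longrightarrow> csize U - \<delta> \<le> csize U')"
proof (rule ccontr)
  assume no: "\<not> ?thesis"
  have "\<exists>U. is_set U \<and> X \<subseteq> U \<and> csize U \<le> p - of_nat j * \<delta>" for j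
  proof (induction j)
    case 0
    then show ?case using assms by auto
  next
    case (Suc j)
    then obtain U where U: "is_set U" "X \<subseteq> U" "csize U \<le> p - of_nat j * \<delta>" by blast
    moreover have "p - of_nat j * \<delta> \<le> p" using assms(1) by simp
    ultimately have "csize U \<le> p" by simp
    then obtain U' where "is_set U'" "X \<subseteq> U'" "csize U' < csize U - \<delta>" using no U by (meson not_le)
    with U have "is_set U' \<and> X \<subseteq> U' \<and> csize U' \<le> p - of_nat (Suc j) * \<delta>" by (simp add: algebra_simps)
    then show ?case by blast
  qed
  then obtain U where "csize U \<le> p - of_nat (Suc K) * \<delta>" by blast
  also have "\<dots> < 0" using assms(1,2) by (simp add: algebra_simps)
  finally show False using csize_ge_0[of U] by simp
qed

text \<open>Continuity of the outer measure along rising sequences. Choose hulls \<open>U\<^sub>n\<close> of \<open>X\<^sub>n\<close> that are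
  optimal up to \<open>\<epsilon> / 2\<^sup>n\<^sup>+\<^sup>1\<close>. Let \<open>V\<^sub>n = U\<^sub>0 \<union> \<dots> \<union> U\<^sub>n\<close>. As \<open>V\<^sub>n \<inter> U\<^sub>n\<^sub>+\<^sub>1\<close> is a hull
  of \<open>X\<^sub>n\<close>, the excess of the size of \<open>V\<^sub>n\<^sub>+\<^sub>1\<close> over that of \<open>U\<^sub>n\<^sub>+\<^sub>1\<close> is larger than the excess
  of \<open>V\<^sub>n\<close> over \<open>U\<^sub>n\<close> by at most that error. Finally, saturation provides a hull of all \<open>V\<^sub>n\<close>.\<close>

lemma rising_union_hull:
  fixes X :: "nat \<Rightarrow> 'a::ast set"
  assumes "0 < \<epsilon>" "p \<le> of_nat K * \<epsilon>" "\<And>n. X n \<subseteq> X (Suc n)"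
    and "\<And>n. \<exists>U. is_set U \<and> X n \<subseteq> U \<and> csize U \<le> p"
  shows "\<exists>W. is_set W \<and> (\<Union>n. X n) \<subseteq> W \<and> csize W \<le> p + \<epsilon>"
proof -
  define \<delta> where "\<delta> n = \<epsilon> / 2 ^ Suc n" for n :: nat
  have "\<exists>U. is_set U \<and> X n \<subseteq> U \<and> csize U \<le> p \<and>
      (\<forall>U'. is_set U' \<longrightarrow> X n \<subseteq> U' \<longrightarrow> csize U - \<delta> n \<le> csize U')" for n
  proof -
    obtain U where U: "is_set U" "X n \<subseteq> U" "csize U \<le> p" using assms(4) by blast
    have p: "p \<le> of_nat (K * 2 ^ Suc n) * \<delta> n" using assms(2) by (simp add: \<delta>_def)
    have "0 < \<delta> n" using assms(1) by (simp add: \<delta>_def)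
    from near_optimal_hull[OF this p U] show ?thesis .
  qed
  then obtain U where U: "\<And>n. is_set (U n)" "\<And>n. X n \<subseteq> U n" "\<And>n. csize (U n) \<le> p"
    "\<And>n U'. is_set U' \<Longrightarrow> X n \<subseteq> U' \<Longrightarrow> csize (U n) - \<delta> n \<le> csize U'"
    by metis
  define V where "V n = (\<Union>i\<le>n. U i)" for n
  have V_Suc: "V (Suc n) = V n \<union> U (Suc n)" for n by (auto simp: V_def atMost_Suc)
  have V: "is_set (V n)" for n
    by (induction n) (auto simp: V_Suc U(1) intro: is_set_Un, simp add: V_def U(1))
  have size: "csize (V n) \<le> csize (U n) + \<epsilon> * (1 - 1 / 2 ^ n)" for n
  proof (induction n)
    case 0
    then show ?case by (simp add: V_def)
  next
    case (Suc n)
    have "X n \<subseteq> V n \<inter> U (Suc n)"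
      using U(2)[of n] U(2)[of "Suc n"] assms(3)[of n] by (auto simp: V_def)
    then have 1: "csize (U n) - \<delta> n \<le> csize (V n \<inter> U (Suc n))"
      by (intro U(4) is_set_Int V U(1))
    have 2: "csize (V (Suc n)) + csize (V n \<inter> U (Suc n)) = csize (V n) + csize (U (Suc n))"
      unfolding V_Suc by (intro csize_Un_Int V U(1))
    have 3: "\<epsilon> * (1 - 1 / 2 ^ n) + \<delta> n = \<epsilon> * (1 - 1 / 2 ^ Suc n)"
      by (simp add: \<delta>_def field_simps)
    show ?case unfolding 3[symmetric] using 1 2 Suc by (simp add: algebra_simps)
  qed
  have "csize (V n) \<le> p + \<epsilon>" for n
  proof -
    have "\<epsilon> * (1 - 1 / 2 ^ n) \<le> \<epsilon>" using assms(1) by (simp add: algebra_simps)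
    with size[of n] U(3)[of n] show ?thesis by simp
  qed
  then obtain W where W: "is_set W" "\<And>n. V n \<subseteq> W" "csize W \<le> p + \<epsilon>"
    using increasing_sets_hull[of V, OF V] V_Suc by (metis Un_upper1)
  have "(\<Union>n. X n) \<subseteq> W" using U(2) W(2) by (fastforce simp: V_def)
  with W show ?thesis by blast
qed

section \<open>Souslin schemes\<close>

text \<open>The \<open>n\<close>-th class may depend only on the first \<open>n\<close> values of the branch \<open>f\<close>; indexing by
  whole branches instead of finite sequences avoids codings of prefixes.\<close>

definition souslin_scheme :: "(nat \<Rightarrow> (nat \<Rightarrow> nat) \<Rightarrow> 'a::ast set) \<Rightarrow> bool" where
  "souslin_scheme A \<longleftrightarrow>
     (\<forall>n f. set_definable (A n f)) \<and> (\<forall>n f g. (\<forall>i<n. f i = g i) \<longrightarrow> A n f = A n g)"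

definition kernel :: "(nat \<Rightarrow> (nat \<Rightarrow> nat) \<Rightarrow> 'a set) \<Rightarrow> 'a set" where
  "kernel A = {x. \<exists>f. \<forall>n. x \<in> A n f}"

definition souslin :: "'a::ast set \<Rightarrow> bool" where
  "souslin X \<longleftrightarrow> (\<exists>A. souslin_scheme A \<and> X = kernel A)"

lemma souslin_schemeD:
  assumes "souslin_scheme A"
  shows "set_definable (A n f)" "(\<And>i. i < n \<Longrightarrow> f i = g i) \<Longrightarrow> A n f = A n g"
  using assms unfolding souslin_scheme_def by blast+

text \<open>Dependent choice for branches: if admissible prefixes can always be prolonged by one value,
  then there is a branch all of whose prefixes are admissible.\<close>

lemma prefix_choice:
  fixes P :: "nat \<Rightarrow> (nat \<Rightarrow> nat) \<Rightarrow> bool"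
  assumes "P 0 h0" and step: "\<And>n h. P n h \<Longrightarrow> \<exists>m. P (Suc n) (h(n := m))"
    and local: "\<And>n h h'. (\<And>i. i < n \<Longrightarrow> h i = h' i) \<Longrightarrow> P n h \<Longrightarrow> P n h'"
  shows "\<exists>h. \<forall>n. P n h"
proof -
  have "\<exists>h. \<forall>n. P n (h n) \<and> (\<exists>m. h (Suc n) = (h n)(n := m))"
    by (rule dependent_nat_choice) (use assms(1) step in blast)+
  then obtain H where H: "\<And>n. P n (H n)" "\<And>n. \<exists>m. H (Suc n) = (H n)(n := m)" by blast
  have agree: "i < n \<Longrightarrow> H n i = H (Suc i) i" for i n
  proof (induction n)
    case (Suc n)
    obtain m where "H (Suc n) = (H n)(n := m)" using H(2) by blast
    with Suc show ?case by (cases "i = n") auto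
  qed simp
  have "P n (\<lambda>i. H (Suc i) i)" for n
    by (rule local[OF _ H(1)]) (rule agree)
  then show ?thesis by blast
qed

lemma set_definable_UNIV: "set_definable (UNIV :: 'a::ast set)"
proof -
  have "definable (\<lambda>v :: nat \<Rightarrow> 'a. True)" by (rule definable_const)
  then show ?thesis using definable_pred_set[of "\<lambda>_ :: 'a. True"] by simp
qed

lemma souslin_definable: "set_definable X \<Longrightarrow> souslin X"
  unfolding souslin_def by (rule exI[of _ "\<lambda>_ _. X"]) (simp add: souslin_scheme_def kernel_def)

text \<open>The first value of the branch selects the member of the union.\<close>

lemma souslin_Union:
  assumes "\<And>i. souslin (X i)"
  shows "souslin (\<Union>i :: nat. X i)"
proof -
  from assms obtain A where scheme: "\<And>i. souslin_scheme (A i)" and X: "\<And>i. X i = kernel (A i)"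
    unfolding souslin_def by metis
  note A = souslin_schemeD(1)[OF scheme] souslin_schemeD(2)[OF scheme] X[unfolded kernel_def]
  define B where "B n f = (case n of 0 \<Rightarrow> UNIV | Suc m \<Rightarrow> A (f 0) m (\<lambda>k. f (Suc k)))" for n f
  have "set_definable (B n f)" for n f
    by (simp add: B_def A(1) set_definable_UNIV split: nat.split)
  moreover have "B n f = B n g" if "\<forall>j<n. f j = g j" for n f g
    using that by (auto simp: B_def split: nat.split intro!: A(2))
  moreover have "(\<Union>i. X i) = {x. \<exists>f. \<forall>n. x \<in> B n f}"
  proof (intro equalityI subsetI)
    fix x assume "x \<in> (\<Union>i. X i)"
    then obtain i f where "\<forall>n. x \<in> A i n f" using A(3) by auto
    then have "\<forall>n. x \<in> B n (case_nat i f)" by (simp add: B_def split: nat.split)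
    then show "x \<in> {x. \<exists>f. \<forall>n. x \<in> B n f}" by blast
  next
    fix x assume "x \<in> {x. \<exists>f. \<forall>n. x \<in> B n f}"
    then obtain f where "\<And>n. x \<in> B n f" by blast
    from this[of "Suc n" for n] have "\<forall>n. x \<in> A (f 0) n (\<lambda>k. f (Suc k))" by (simp add: B_def)
    then show "x \<in> (\<Union>i. X i)" using A(3) by auto
  qed
  ultimately show ?thesis unfolding souslin_def souslin_scheme_def kernel_def by blast
qed

text \<open>One branch encodes a sequence of branches through a pairing function. The pairing is
  monotone in its second argument, so a prefix of the code determines the required prefixes of all
  components.\<close>

lemma souslin_Inter:
  assumes "\<And>i. souslin (X i)"
  shows "souslin (\<Inter>i :: nat. X i)"
proof -
  from assms obtain A where scheme: "\<And>i. souslin_scheme (A i)" and X: "\<And>i. X i = kernel (A i)"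
    unfolding souslin_def by metis
  note A = souslin_schemeD(1)[OF scheme] souslin_schemeD(2)[OF scheme] X[unfolded kernel_def]
  define B where "B n f = (case prod_decode n of (i, m) \<Rightarrow> A i m (\<lambda>k. f (prod_encode (i, k))))" for n f
  have "set_definable (B n f)" for n f
    by (simp add: B_def A(1) split: prod.split)
  moreover have "B n f = B n g" if "\<forall>j<n. f j = g j" for n f g
  proof -
    obtain i m where n: "prod_decode n = (i, m)" by (cases "prod_decode n")
    then have n': "n = prod_encode (i, m)" by (metis prod_decode_inverse)
    have "prod_encode (i, k) < n" if "k < m" for k
    proof -
      have "triangle (i + k) < triangle (i + m)"
        using that by (induction m) (auto simp: less_Suc_eq)
      then show ?thesis by (simp add: n' prod_encode_def)
    qed
    with that show ?thesis by (auto simp: B_def n intro!: A(2))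
  qed
  moreover have "(\<Inter>i. X i) = {x. \<exists>f. \<forall>n. x \<in> B n f}"
  proof (intro equalityI subsetI)
    fix x assume "x \<in> (\<Inter>i. X i)"
    then have "\<forall>i. \<exists>f. \<forall>n. x \<in> A i n f" using A(3) by auto
    then obtain F where "\<And>i n. x \<in> A i n (F i)" by metis
    then have "\<forall>n. x \<in> B n (\<lambda>j. case prod_decode j of (i, k) \<Rightarrow> F i k)"
      by (simp add: B_def split: prod.split)
    then show "x \<in> {x. \<exists>f. \<forall>n. x \<in> B n f}" by blast
  next
    fix x assume "x \<in> {x. \<exists>f. \<forall>n. x \<in> B n f}"
    then obtain f where "\<And>n. x \<in> B n f" by blast
    from this[of "prod_encode (i, m)" for i m]
    have "x \<in> A i m (\<lambda>k. f (prod_encode (i, k)))" for i m by (simp add: B_def)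
    then show "x \<in> (\<Inter>i. X i)" using A(3) by auto
  qed
  ultimately show ?thesis unfolding souslin_def souslin_scheme_def kernel_def by blast
qed

lemma borel_imp_souslin: "borel_class X \<Longrightarrow> souslin X"
proof -
  have "(sigma_class a X \<longrightarrow> souslin X) \<and> (pi_class a X \<longrightarrow> souslin X)" for a and X :: "'a set"
  proof (rule sigma_class_pi_class.induct)
    fix a :: 'a and Y :: "'a \<Rightarrow> 'a set"
    assume "\<forall>i\<in>FN. \<exists>b. b \<in>\<^sub>V a \<and> pi_class b (Y i) \<and> souslin (Y i)"
    then have "souslin (\<Union>i. Y (fin i))" by (intro souslin_Union) (auto simp: FN_eq)
    then show "souslin (\<Union>i\<in>FN. Y i)" by (simp add: FN_eq)
  next
    fix a :: 'a and Y :: "'a \<Rightarrow> 'a set"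
    assume "\<forall>i\<in>FN. \<exists>b. b \<in>\<^sub>V a \<and> sigma_class b (Y i) \<and> souslin (Y i)"
    then have "souslin (\<Inter>i. Y (fin i))" by (intro souslin_Inter) (auto simp: FN_eq)
    then show "souslin (\<Inter>i\<in>FN. Y i)" by (simp add: FN_eq)
  qed (auto intro: souslin_definable)
  then show "borel_class X \<Longrightarrow> souslin X" unfolding borel_class_def by blast
qed

text \<open>
  Let \<open>Y n h\<close> consist of the points of \<open>X\<close> that have a witnessing branch bounded by \<open>h\<close> in its
  first \<open>n\<close> values. By continuity along rising sequences the bounds \<open>h 0\<close>, \<open>h 1\<close>, \<open>\<dots>\<close> can be
  chosen one after the other so that the outer measure of \<open>Y n h\<close> remains above
  \<open>r n = q - \<epsilon> (1 - 1 / 2\<^sup>n)\<close>. With these bounds each level of the scheme has finitely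
  many branches, so the points surviving up to level \<open>n\<close> form a set \<open>D n\<close>. It includes \<open>Y n h\<close>
  and thus has size at least \<open>q - \<epsilon>\<close>. A core \<open>E\<close> of the sets \<open>D n\<close> is included in \<open>X\<close> by
  Koenig's lemma.

  The hypothesis \<open>q \<le> K \<epsilon>\<close> says that \<open>\<epsilon>\<close> is not infinitesimal relative to \<open>q\<close>.
\<close>

theorem capacitability:
  fixes X :: "'a::ast set"
  assumes "souslin X" "semiset X" "0 < \<epsilon>" "q \<le> of_nat K * \<epsilon>"
    and big: "\<And>U. is_set U \<Longrightarrow> X \<subseteq> U \<Longrightarrow> q < csize U"
  shows "\<exists>E. is_set E \<and> E \<subseteq> X \<and> q - \<epsilon> \<le> csize E"
proof -
  from assms(1) obtain A where scheme: "souslin_scheme A" and X: "X = kernel A"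
    unfolding souslin_def by metis
  note A = souslin_schemeD[OF scheme] X[unfolded kernel_def]
  from assms(2) obtain W where W: "is_set W" "X \<subseteq> W"
    unfolding semiset_def by (metis is_set_elts)
  define Y where "Y n h = {x. \<exists>f. (\<forall>i<n. f i \<le> h i) \<and> (\<forall>k. x \<in> A k f)}" for n :: nat and h :: "nat \<Rightarrow> nat"
  define r where "r n = q - \<epsilon> * (1 - 1 / 2 ^ n)" for n :: nat
  define P where "P n h \<longleftrightarrow> (\<forall>U. is_set U \<longrightarrow> Y n h \<subseteq> U \<longrightarrow> r n < csize U)" for n h
  have "\<exists>h. \<forall>n. P n h"
  proof (rule prefix_choice)
    show "P 0 (\<lambda>_. 0)"
      using big by (auto simp: P_def Y_def r_def A(3))
  next
    fix n h h'
    assume eq: "\<And>i. i < n \<Longrightarrow> h i = h' i" and "P n h"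
    have "Y n h = Y n h'" unfolding Y_def using eq by (metis (no_types, lifting))
    then show "P n h'" using \<open>P n h\<close> by (simp add: P_def)
  next
    fix n h
    assume P: "P n h"
    show "\<exists>m. P (Suc n) (h(n := m))"
    proof (rule ccontr)
      assume "\<not> ?thesis"
      then have small: "\<exists>U. is_set U \<and> Y (Suc n) (h(n := m)) \<subseteq> U \<and> csize U \<le> r (Suc n)" for m
        unfolding P_def by (meson not_le)
      define \<delta> where "\<delta> = \<epsilon> / 2 ^ Suc n"
      have "0 < \<delta>" using assms(3) by (simp add: \<delta>_def)
      moreover have "r (Suc n) \<le> of_nat (K * 2 ^ Suc n) * \<delta>"
      proof -
        have "(1 :: 'a hrat) \<le> 2 ^ Suc n" by (rule one_le_power) simp
        then have "1 / 2 ^ Suc n \<le> (1 :: 'a hrat)" by (simp only: divide_le_eq_1_pos zero_less_power zero_less_numeral)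
        then have "0 \<le> \<epsilon> * (1 - 1 / 2 ^ Suc n)" using assms(3) by (intro mult_nonneg_nonneg) auto
        then show ?thesis using assms(4) by (simp add: \<delta>_def r_def)
      qed
      moreover have "Y (Suc n) (h(n := m)) \<subseteq> Y (Suc n) (h(n := Suc m))" for m
      proof -
        have "f i \<le> (h(n := Suc m)) i" if "f i \<le> (h(n := m)) i" for f i
          using that by (cases "i = n") auto
        then show ?thesis unfolding Y_def by blast
      qed
      ultimately have "\<exists>W. is_set W \<and> (\<Union>m. Y (Suc n) (h(n := m))) \<subseteq> W \<and> csize W \<le> r (Suc n) + \<delta>"
        using small by (rule rising_union_hull)
      moreover have "Y n h \<subseteq> (\<Union>m. Y (Suc n) (h(n := m)))"
      proof
        fix x assume "x \<in> Y n h"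
        then obtain f where "\<forall>i<n. f i \<le> h i" "\<forall>k. x \<in> A k f" unfolding Y_def by blast
        then have "x \<in> Y (Suc n) (h(n := f n))" unfolding Y_def by (auto simp: less_Suc_eq)
        then show "x \<in> (\<Union>m. Y (Suc n) (h(n := m)))" by blast
      qed
      moreover have "r (Suc n) + \<delta> = r n" by (simp add: r_def \<delta>_def field_simps)
      ultimately show False using P unfolding P_def by (metis leD order.trans)
    qed
  qed
  then obtain h where h: "\<And>n. P n h" by blast
  \<comment> \<open>For level \<open>n\<close> one may take branches that vanish from \<open>n\<close> on, and only finitely many of these are
    bounded by \<open>h\<close>.\<close>
  define D where "D n = {x \<in> W. \<exists>f. (\<forall>i<n. f i \<le> h i) \<and> (\<forall>k\<le>n. x \<in> A k f)}" for n
  have D_set: "is_set (D n)" for n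
  proof -
    define Fs where "Fs = {f. (\<forall>i<n. f i \<le> h i) \<and> (\<forall>i. \<not> i < n \<longrightarrow> f i = 0)}"
    have "f i \<le> Max (h ` {..<n})" if "f i \<le> h i" "i < n" for f i
      by (rule order.trans[OF that(1) Max_ge]) (use that(2) in auto)
    then have "Fs \<subseteq> {f. \<forall>i. (i \<in> {..<n} \<longrightarrow> f i \<in> {..Max (h ` {..<n})}) \<and> (i \<notin> {..<n} \<longrightarrow> f i = 0)}"
      unfolding Fs_def by simp blast
    then have fin: "finite Fs"
      by (rule finite_subset) (rule finite_set_of_finite_funs, auto)
    have Int: "is_set (W \<inter> (\<Inter>k\<le>m. A k f))" for m f
    proof (induction m)
      case 0
      then show ?case using is_set_definable_Int[OF A(1) W(1), of 0 f] by (simp add: Int_commute)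
    next
      case (Suc m)
      have "W \<inter> (\<Inter>k\<le>Suc m. A k f) = A (Suc m) f \<inter> (W \<inter> (\<Inter>k\<le>m. A k f))"
        by (auto simp: atMost_Suc)
      then show ?case using is_set_definable_Int[OF A(1) Suc] by simp
    qed
    have "is_set (\<Union>f\<in>Gs. W \<inter> (\<Inter>k\<le>n. A k f))" if "finite Gs" for Gs
      using that by induction (auto intro: empty_set is_set_Un Int)
    with fin have "is_set (\<Union>f\<in>Fs. W \<inter> (\<Inter>k\<le>n. A k f))" by blast
    also have "(\<Union>f\<in>Fs. W \<inter> (\<Inter>k\<le>n. A k f)) = D n"
    proof (intro equalityI subsetI)
      fix x assume "x \<in> D n"
      then obtain f where f: "x \<in> W" "\<forall>i<n. f i \<le> h i" "\<forall>k\<le>n. x \<in> A k f" unfolding D_def by blast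
      let ?g = "\<lambda>i. if i < n then f i else 0"
      have "A k ?g = A k f" if "k \<le> n" for k
        by (rule A(2)) (use that in auto)
      with f have "?g \<in> Fs" "x \<in> W \<inter> (\<Inter>k\<le>n. A k ?g)" unfolding Fs_def by auto
      then show "x \<in> (\<Union>f\<in>Fs. W \<inter> (\<Inter>k\<le>n. A k f))" by blast
    qed (auto simp: D_def Fs_def)
    finally show ?thesis .
  qed
  have "q - \<epsilon> \<le> csize (D n)" for n
  proof -
    have "Y n h \<subseteq> D n" using W(2) unfolding Y_def D_def A(3) by blast
    then have "r n < csize (D n)" using h D_set unfolding P_def by blast
    moreover have "q - \<epsilon> \<le> r n" using assms(3) by (simp add: r_def algebra_simps)
    ultimately show ?thesis by simp
  qed
  moreover have "D (Suc n) \<subseteq> D n" for n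
    unfolding D_def by (auto intro: less_SucI le_SucI)
  ultimately obtain E where E: "is_set E" "\<And>n. E \<subseteq> D n" "q - \<epsilon> \<le> csize E"
    using decreasing_sets_core[of D, OF D_set] by blast
  have "x \<in> X" if x: "\<And>n. x \<in> D n" for x
  proof -
    \<comment> \<open>Koenig's lemma: the prefix of \<open>g\<close> of length \<open>n\<close> is good if it extends to bounded branches that keep \<open>x\<close>
      up to any level. Of the finitely many values allowed next, one gives a good prefix again.\<close>
    define G where "G n g \<longleftrightarrow>
      (\<forall>N. \<exists>f. (\<forall>i<n. f i = g i) \<and> (\<forall>i<N. f i \<le> h i) \<and> (\<forall>k\<le>N. x \<in> A k f))" for n and g :: "nat \<Rightarrow> nat"
    have "\<exists>g. \<forall>n. G n g"
    proof (rule prefix_choice)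
      show "G 0 (\<lambda>_. 0)" using x by (auto simp: G_def D_def)
    next
      fix n g g' assume "\<And>i. i < n \<Longrightarrow> g i = g' i" and "G n g"
      then show "G n g'" by (simp add: G_def)
    next
      fix n g
      assume g: "G n g"
      show "\<exists>m. G (Suc n) (g(n := m))"
      proof (rule ccontr)
        assume "\<not> ?thesis"
        then have "\<forall>m. \<exists>N. \<not> (\<exists>f. (\<forall>i<Suc n. f i = (g(n := m)) i) \<and> (\<forall>i<N. f i \<le> h i) \<and> (\<forall>k\<le>N. x \<in> A k f))"
          unfolding G_def by blast
        then obtain N where N: "\<And>m f. (\<forall>i<Suc n. f i = (g(n := m)) i) \<Longrightarrow> (\<forall>i<N m. f i \<le> h i) \<Longrightarrow>
            (\<forall>k\<le>N m. x \<in> A k f) \<Longrightarrow> False"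
          by metis
        define M where "M = Max (N ` {..h n}) + Suc n"
        have M: "N m \<le> M" if "m \<le> h n" for m
          unfolding M_def by (rule trans_le_add1[OF Max_ge]) (use that in auto)
        obtain f where f: "\<forall>i<n. f i = g i" "\<forall>i<M. f i \<le> h i" "\<forall>k\<le>M. x \<in> A k f"
          using g unfolding G_def by blast
        have "f n \<le> h n" using f(2) by (simp add: M_def)
        from M[OF this] f show False
          by (intro N[of f "f n"]) (auto simp: less_Suc_eq)
      qed
    qed
    then obtain g where g: "\<And>n. G n g" by blast
    have "x \<in> A n g" for n
    proof -
      obtain f where "\<forall>i<n. f i = g i" "\<forall>k\<le>n. x \<in> A k f" using g[of n] unfolding G_def by blast
      then show ?thesis using A(2)[of n f g] by auto
    qed
    then show ?thesis using A(3) by blast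
  qed
  with E show ?thesis by blast
qed


section \<open>Lower and upper cuts of Borel semisets\<close>

lemma vsucc_le_iff: "m \<in> NN \<Longrightarrow> n \<in> NN \<Longrightarrow> of_N m < of_N n \<longleftrightarrow> of_N m + 1 \<le> of_N n"
  using of_N_le[of "vsucc m" n] NN_vsucc_mem[of n m] NN_trans[of n "vsucc m" m]
  by (auto simp: of_N_less of_N_vsucc nat_le_def mem_elts)

lemma smaller_iff_csize:
  fixes n u :: "'a::ast"
  assumes "n \<in> NN"
  shows "smaller n u \<longleftrightarrow> of_N n < csize (elts u)"
proof
  assume "smaller n u"
  then obtain f where f: "set_inj f" "vdom f = elts n" "vrng f \<subset> elts u"
    unfolding smaller_def by blast
  have "is_set (vrng f)"
  proof -
    have "is_set {y. \<exists>p \<in> elts f. \<exists>x. p = opair x y}"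
      by (rule definable_replacement) (auto intro!: def_intros)
    also have "{y. \<exists>p \<in> elts f. \<exists>x. p = opair x y} = vrng f"
      unfolding vrng_def mem_elts by blast
    finally show ?thesis .
  qed
  then have w: "elts (the_set (vrng f)) = vrng f" by (rule elts_the_set)
  then have "set_equinumerous n (the_set (vrng f))"
    using f unfolding set_equinumerous_def by blast
  then have "csize (vrng f) = of_N n"
    using vcard_cong[of n] assms by (simp add: csize_def vcard_of_NN)
  with csize_psubset[OF \<open>is_set (vrng f)\<close> is_set_elts f(3)] show "of_N n < csize (elts u)" by simp
next
  assume "of_N n < csize (elts u)"
  then have n: "n \<in> elts (vcard u)" using assms by (simp add: csize_def of_N_less)
  obtain f where f: "internal_map f" "bij_betw f (elts (vcard u)) (elts u)"
    using vcard_equinumerous[of u] unfolding set_equinumerous_iff_internal by blast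
  have sub: "elts n \<subset> elts (vcard u)"
    using n NN_trans[OF vcard_NN n] not_mem_self[of n] by blast
  define w where "w = the_set (f ` elts n)"
  have w: "elts w = f ` elts n"
    unfolding w_def using f(1) by (intro elts_the_set is_set_image) (simp add: internal_map_def)
  have inj: "inj_on f (elts (vcard u))" and im: "f ` elts (vcard u) = elts u"
    using f(2) by (auto simp: bij_betw_def)
  have "bij_betw f (elts n) (elts w)"
    unfolding w using inj sub by (intro bij_betw_imageI) (auto intro: inj_on_subset)
  then have "set_equinumerous n w" using f(1) unfolding set_equinumerous_iff_internal by blast
  moreover have "elts w \<subset> elts u"
    using inj_on_image_eq_iff[OF inj, of "elts n" "elts (vcard u)"] sub im w by blast
  ultimately show "smaller n u" unfolding smaller_def set_equinumerous_def by metis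
qed

text \<open>The bound \<open>n\<close> in the definition is a natural number with \<open>q < n < |U|\<close>. It can be chosen
  as the least number above \<open>q\<close>, which explains the summand \<open>1\<close>.\<close>

lemma mem_lower_cut_iff:
  "q \<in> lower_cut X \<longleftrightarrow> 0 \<le> q \<and> (\<exists>U. is_set U \<and> U \<subseteq> X \<and> q + 1 < csize U)"
proof
  assume "q \<in> lower_cut X"
  then obtain n u where "0 \<le> q" and nu: "n \<in> NN" "elts u \<subseteq> X" "of_N n < csize (elts u)" "q < of_N n"
    unfolding lower_cut_def Q_plus_def using smaller_iff_csize by blast
  have "of_N n + 1 \<le> csize (elts u)"
    using nu(1,3) by (simp add: csize_def vsucc_le_iff)
  then have "q + 1 < csize (elts u)" using nu(4) by simp
  with nu(2) \<open>0 \<le> q\<close> show "0 \<le> q \<and> (\<exists>U. is_set U \<and> U \<subseteq> X \<and> q + 1 < csize U)"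
    using is_set_elts by blast
next
  assume "0 \<le> q \<and> (\<exists>U. is_set U \<and> U \<subseteq> X \<and> q + 1 < csize U)"
  then obtain u where q: "0 \<le> q" and u: "elts u \<subseteq> X" "q + 1 < csize (elts u)"
    unfolding is_set_def by blast
  obtain n where n: "n \<in> NN" "of_N n \<le> q" "q < of_N n + 1" using q by (rule hrat_floor)
  then have "q < of_N (vsucc n)" "of_N (vsucc n) < csize (elts u)" and N: "vsucc n \<in> NN"
    using u(2) by (auto simp: of_N_vsucc)
  then show "q \<in> lower_cut X"
    unfolding lower_cut_def Q_plus_def using smaller_iff_csize[OF N, of u] u(1) q by blast
qed

text \<open>The definition asks for one \<open>n\<close> that serves all hulls; the least number above \<open>q\<close> does.\<close>

lemma mem_upper_cut_iff:
  "q \<in> upper_cut X \<longleftrightarrow> 0 \<le> q \<and> (\<forall>U. is_set U \<longrightarrow> X \<subseteq> U \<longrightarrow> q + 1 < csize U)"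
proof
  assume "q \<in> upper_cut X"
  then obtain n where "0 \<le> q" and n: "n \<in> NN" "\<And>u. X \<subseteq> elts u \<Longrightarrow> of_N n < csize (elts u)" "q < of_N n"
    unfolding upper_cut_def Q_plus_def using smaller_iff_csize by blast
  have "q + 1 < csize (elts u)" if "X \<subseteq> elts u" for u
    using vsucc_le_iff[OF n(1) vcard_NN[of u]] n(2)[OF that] n(3) by (simp add: csize_def)
  with \<open>0 \<le> q\<close> show "0 \<le> q \<and> (\<forall>U. is_set U \<longrightarrow> X \<subseteq> U \<longrightarrow> q + 1 < csize U)"
    unfolding is_set_def by blast
next
  assume *: "0 \<le> q \<and> (\<forall>U. is_set U \<longrightarrow> X \<subseteq> U \<longrightarrow> q + 1 < csize U)"
  then have q: "0 \<le> q" by blast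
  obtain n where n: "n \<in> NN" "of_N n \<le> q" "q < of_N n + 1" using q by (rule hrat_floor)
  have "of_N (vsucc n) < csize (elts u)" if "X \<subseteq> elts u" for u
  proof -
    have "of_N (vsucc n) \<le> q + 1" using n by (simp add: of_N_vsucc)
    also have "\<dots> < csize (elts u)" using * that by simp
    finally show ?thesis .
  qed
  moreover have "q < of_N (vsucc n)" and N: "vsucc n \<in> NN" using n by (simp_all add: of_N_vsucc)
  ultimately show "q \<in> upper_cut X"
    unfolding upper_cut_def Q_plus_def using smaller_iff_csize[OF N] q by blast
qed

lemma lower_cut_mono: "X \<subseteq> Y \<Longrightarrow> lower_cut X \<subseteq> lower_cut Y"
  unfolding subset_iff mem_lower_cut_iff by blast

lemma lower_cut_down: "q \<in> lower_cut X \<Longrightarrow> 0 \<le> p \<Longrightarrow> p \<le> q \<Longrightarrow> p \<in> lower_cut X"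
  by (auto simp: mem_lower_cut_iff intro: order.strict_trans1[OF add_right_mono])

lemma lower_cut_subset_upper_cut: "lower_cut X \<subseteq> upper_cut X"
proof
  fix q assume "q \<in> lower_cut X"
  then obtain U where U: "0 \<le> q" "is_set U" "U \<subseteq> X" "q + 1 < csize U"
    by (auto simp: mem_lower_cut_iff)
  have "q + 1 < csize U'" if "is_set U'" "X \<subseteq> U'" for U'
    using order.strict_trans2[OF U(4) csize_mono[OF U(2) that(1)]] U(3) that(2) by blast
  with U(1) show "q \<in> upper_cut X" by (simp add: mem_upper_cut_iff)
qed

text \<open>Capacitability in terms of cuts. Half of \<open>\<delta>\<close> is kept in reserve because membership in the
  lower cut is a strict inequality.\<close>

lemma upper_cut_near_lower_cut:
  fixes X :: "'a::ast set"
  assumes X: "X \<in> borel_semisets" and "0 < \<delta>" "q + 1 \<le> of_nat K * \<delta>" "q \<in> upper_cut X" "0 \<le> q - \<delta>"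
  shows "q - \<delta> \<in> lower_cut X"
proof -
  have "souslin X" "semiset X" using X borel_imp_souslin by (auto simp: borel_semisets_def)
  moreover have "0 < \<delta> / 2" "q + 1 \<le> of_nat (K * 2) * (\<delta> / 2)" using assms by simp_all
  moreover have "q + 1 < csize U" if "is_set U" "X \<subseteq> U" for U
    using assms(4) that by (simp add: mem_upper_cut_iff)
  ultimately obtain E where E: "is_set E" "E \<subseteq> X" "q + 1 - \<delta> / 2 \<le> csize E"
    using capacitability by blast
  have "(q - \<delta>) + 1 < q + 1 - \<delta> / 2" using assms(2) by (simp add: field_simps)
  with E have "(q - \<delta>) + 1 < csize E" by simp
  with E assms(5) show ?thesis unfolding mem_lower_cut_iff by blast
qed

text \<open>If the lower cut were closed under doubling, then both sums of it with itself would agree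
  with it. For the external sum, note that \<open>x \<notin> L\<close> would give \<open>x / 2 \<notin> L\<close> and then
  \<open>x < x / 2 + x / 2\<close>.\<close>

lemma nonadditive_lower_cut_unit:
  fixes S :: "'a::ast set"
  assumes "nonadditive_cut (lower_cut S)"
  obtains t where "t \<in> lower_cut S" "2 * t \<notin> lower_cut S" "1 \<le> 2 * t"
proof -
  let ?L = "lower_cut S"
  have cut: "is_cut ?L" and "\<not> (external_sum ?L ?L = ?L \<and> internal_sum ?L ?L = ?L)"
    using assms unfolding nonadditive_cut_def additive_cut_def by auto
  have pos: "0 \<le> q" if "q \<in> ?L" for q using that by (simp add: mem_lower_cut_iff)
  have "\<exists>t. t \<in> ?L \<and> 2 * t \<notin> ?L"
  proof (rule ccontr)
    assume "\<not> ?thesis"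
    then have double: "\<And>t. t \<in> ?L \<Longrightarrow> 2 * t \<in> ?L" by blast
    have "external_sum ?L ?L = ?L"
    proof (intro equalityI subsetI)
      fix x assume x: "x \<in> external_sum ?L ?L"
      show "x \<in> ?L"
      proof (rule ccontr)
        assume "x \<notin> ?L"
        then have "x / 2 \<notin> ?L" using double[of "x / 2"] by auto
        moreover have "0 \<le> x" using x by (simp add: external_sum_def Q_plus_def)
        ultimately have "x / 2 \<in> Q_plus - ?L" by (simp add: Q_plus_def)
        then have "x < x / 2 + x / 2" using x unfolding external_sum_def by blast
        then show False by simp
      qed
    next
      fix x assume x: "x \<in> ?L"
      have "x < a + b" if "0 \<le> a" "a \<notin> ?L" "0 \<le> b" for a b
      proof -
        have "x < a" using lower_cut_down[OF x that(1)] that(2) by force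
        then show ?thesis using that(3) by simp
      qed
      then show "x \<in> external_sum ?L ?L" using pos[OF x] unfolding external_sum_def Q_plus_def by auto
    qed
    moreover have "internal_sum ?L ?L = ?L"
    proof (intro equalityI subsetI)
      fix x assume "x \<in> internal_sum ?L ?L"
      then obtain a b where ab: "0 \<le> x" "a \<in> ?L" "b \<in> ?L" "x < a + b"
        unfolding internal_sum_def Q_plus_def by auto
      have "2 * max a b \<in> ?L" using ab double by (simp add: max_def)
      moreover have "x \<le> 2 * max a b" using ab(4) by (auto simp: max_def)
      ultimately show "x \<in> ?L" using lower_cut_down ab(1) by blast
    next
      fix x assume x: "x \<in> ?L"
      then obtain y where y: "y \<in> ?L" "x < y" using cut unfolding is_cut_def by blast
      have "x < y + y" using y pos[OF y(1)] by simp
      with x y pos show "x \<in> internal_sum ?L ?L" unfolding internal_sum_def Q_plus_def by blast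
    qed
    ultimately show False using \<open>\<not> (external_sum ?L ?L = ?L \<and> internal_sum ?L ?L = ?L)\<close> by blast
  qed
  then obtain t where t: "t \<in> ?L" "2 * t \<notin> ?L" by blast
  have "1 \<le> 2 * t"
  proof (rule ccontr)
    \<comment> \<open>A set of size above \<open>t + 1\<close> has at least two elements, so \<open>2 t < 1\<close> would be in the lower cut, too.\<close>
    assume "\<not> 1 \<le> 2 * t"
    obtain U where U: "is_set U" "U \<subseteq> S" "t + 1 < csize U" using t(1) by (auto simp: mem_lower_cut_iff)
    have "1 < csize U" using U(3) pos[OF t(1)] by simp
    then have "1 + 1 \<le> csize U"
      using vsucc_le_iff[of "vsucc vempty" "vcard (the_set U)"] by (simp add: csize_def of_N_one)
    then have "2 * t + 1 < csize U" using \<open>\<not> 1 \<le> 2 * t\<close> by simp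
    then have "2 * t \<in> ?L" using U pos[OF t(1)] unfolding mem_lower_cut_iff by auto
    then show False using t(2) by simp
  qed
  with t that show ?thesis by blast
qed

section \<open>Approximating sequences\<close>

lemma cut_value_below: "0 \<le> q \<Longrightarrow> cut_value (below q) = q"
  unfolding cut_value_def
proof (rule the_equality)
  fix p assume q: "0 \<le> q" and p: "0 \<le> p \<and> below q = below p"
  have "\<not> p < q" using p by (auto simp: below_def Q_plus_def)
  moreover have "\<not> q < p" using p q by (auto simp: below_def Q_plus_def)
  ultimately show "p = q" by simp
qed simp

lemma FN_from: "{j \<in> FN. nat_le (fin i) j} = fin ` {i..}"
  by (auto simp: FN_eq fin_le_iff)

lemma mem_liminf_seq_iff:
  fixes s :: "'a::ast \<Rightarrow> 'b set"
  shows "x \<in> liminf_seq s \<longleftrightarrow> (\<forall>\<^sub>F k in sequentially. x \<in> s (fin k))"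
proof -
  have "x \<in> liminf_seq s \<longleftrightarrow> (\<exists>i. x \<in> (\<Inter>j \<in> fin ` {i..}. s j))"
    unfolding liminf_seq_def by (simp add: FN_eq FN_from[unfolded FN_eq])
  then show ?thesis by (auto simp: eventually_sequentially)
qed

lemma not_mem_limsup_seq_iff:
  fixes s :: "'a::ast \<Rightarrow> 'b set"
  shows "x \<notin> limsup_seq s \<longleftrightarrow> (\<forall>\<^sub>F k in sequentially. x \<notin> s (fin k))"
proof -
  have "x \<notin> limsup_seq s \<longleftrightarrow> (\<exists>i. x \<notin> (\<Union>j \<in> fin ` {i..}. s j))"
    unfolding limsup_seq_def by (simp add: FN_eq FN_from[unfolded FN_eq])
  then show ?thesis by (auto simp: eventually_sequentially)
qed

text \<open>What the limits of an approximating sequence say about its terms, now taken as numbers.\<close>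

definition approximates :: "(nat \<Rightarrow> 'a::ast hrat) \<Rightarrow> 'a set \<Rightarrow> bool" where
  "approximates a X \<longleftrightarrow> (\<forall>k. 0 \<le> a k) \<and>
     (\<forall>q \<ge> 0. q \<in> lower_cut X \<longleftrightarrow> (\<forall>\<^sub>F k in sequentially. q < a k)) \<and>
     (\<forall>q \<ge> 0. q \<notin> upper_cut X \<longleftrightarrow> (\<forall>\<^sub>F k in sequentially. a k \<le> q))"

lemma approximating_sequence_approximates:
  fixes X :: "'a::ast set"
  assumes "approximating_sequence X s"
  shows "approximates (\<lambda>k. cut_value (s (fin k))) X"
proof -
  have "\<exists>n \<in> NN. s (fin k) = below (of_N n)" for k
    using assms unfolding approximating_sequence_def FN_eq by auto
  then obtain n where n: "\<And>k. n k \<in> NN" "\<And>k. s (fin k) = below (of_N (n k))" by metis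
  have v: "cut_value (s (fin k)) = of_N (n k)" for k
    by (simp add: n cut_value_below of_N_ge_0)
  have mem: "q \<in> s (fin k) \<longleftrightarrow> q < of_N (n k)" if "0 \<le> q" for q k
    using that by (simp add: n below_def Q_plus_def)
  have lim: "liminf_seq s = lower_cut X" "limsup_seq s = upper_cut X"
    using assms unfolding approximating_sequence_def by blast+
  have "q \<in> lower_cut X \<longleftrightarrow> (\<forall>\<^sub>F k in sequentially. q < of_N (n k))" if "0 \<le> q" for q
    using mem_liminf_seq_iff[of q s] unfolding lim mem[OF that] .
  moreover have "q \<notin> upper_cut X \<longleftrightarrow> (\<forall>\<^sub>F k in sequentially. of_N (n k) \<le> q)" if "0 \<le> q" for q
    using not_mem_limsup_seq_iff[of q s] unfolding lim mem[OF that] not_less .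
  moreover have "0 \<le> of_N (n k)" for k by (rule of_N_ge_0[OF n(1)])
  ultimately show ?thesis unfolding approximates_def v by simp
qed


section \<open>Limits of sequences of rationals\<close>

text \<open>Convergence up to infinitesimals: only the distances \<open>1 / M\<close> with finite \<open>M\<close> count, so
  that \<open>x\<close> is determined only up to its monad.\<close>

definition converges :: "(nat \<Rightarrow> 'a::linordered_field) \<Rightarrow> 'a \<Rightarrow> bool" where
  "converges a x \<longleftrightarrow> (\<forall>M > 0. \<forall>\<^sub>F k in sequentially. \<bar>a k - x\<bar> \<le> 1 / of_nat M)"

definition diverges :: "(nat \<Rightarrow> 'a::linordered_field) \<Rightarrow> bool" where
  "diverges a \<longleftrightarrow> (\<forall>M. \<forall>\<^sub>F k in sequentially. of_nat M < a k)"

lemma infinite_natural: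
  obtains n :: "'a::ast" where "n \<in> NN" "\<And>k. of_nat k < of_N n"
proof -
  obtain n :: 'a where n: "n \<in> NN" "n \<notin> range fin"
    by (rule overspill[of "\<lambda>_. True"]) (rule definable_const, simp)
  have "of_nat k < of_N n" for k
    using of_N_less[OF fin_NN n(1), of k] NN_not_fin[OF n, of k] by simp
  with n(1) that show ?thesis by blast
qed

lemma saturation_sets:
  fixes X :: "nat \<Rightarrow> 'a::ast set"
  assumes "\<And>n. is_set (X n)" "\<And>n. \<exists>x. \<forall>i<n. x \<in> X i"
  shows "\<exists>x. \<forall>n. x \<in> X n"
proof -
  have X: "elts (the_set (X n)) = X n" for n using assms(1) by (rule elts_the_set)
  have "\<exists>x. \<forall>n. x \<in> elts (the_set (X n))"
    by (rule saturation[where P = "\<lambda>x y. x \<in> elts y"]) (intro def_intros, unfold X, rule assms(2))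
  then show ?thesis by (simp add: X)
qed

lemma is_set_NN_interval: "is_set {n \<in> NN. lo \<le> of_N n \<and> of_N n \<le> hi}" for lo :: "'a::ast hrat"
proof (cases "0 \<le> hi")
  case True
  then obtain m where m: "m \<in> NN" "hi < of_N m + 1" using hrat_floor by metis
  obtain a b c where lo: "a \<in> NN" "b \<in> NN" "c \<in> NN" "0 < of_N c" "lo = (of_N a - of_N b) / of_N c"
    by (rule hrat_eq_quotient)
  obtain a' b' c' where hi: "a' \<in> NN" "b' \<in> NN" "c' \<in> NN" "0 < of_N c'" "hi = (of_N a' - of_N b') / of_N c'"
    by (rule hrat_eq_quotient)
  let ?P = "\<lambda>n. n \<in> NN \<and> nat_le a (nat_add (nat_mult n c) b) \<and> nat_le (nat_add (nat_mult n c') b') a'"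
  have P: "?P n \<longleftrightarrow> n \<in> NN \<and> lo \<le> of_N n \<and> of_N n \<le> hi" for n
    using of_N_le_quotient_iff(2)[OF lo(1-4), of n] of_N_le_quotient_iff(1)[OF hi(1-4), of n] lo(5) hi(5)
    by auto
  have "is_set {n \<in> elts (vsucc m). ?P n}"
    by (rule is_set_separation) (intro def_intros)
  also have "{n \<in> elts (vsucc m). ?P n} = {n \<in> NN. lo \<le> of_N n \<and> of_N n \<le> hi}"
  proof -
    have "n \<in> elts (vsucc m)" if "n \<in> NN" "of_N n \<le> hi" for n
    proof -
      have "of_N n < of_N (vsucc m)" using that m by (simp add: of_N_vsucc)
      then show ?thesis using of_N_less[of n "vsucc m"] that m by simp
    qed
    then show ?thesis unfolding P by blast
  qed
  finally show ?thesis .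
next
  case False
  then have "{n \<in> NN. lo \<le> of_N n \<and> of_N n \<le> hi} = {}"
    using of_N_ge_0 by (force dest: order.trans)
  then show ?thesis using empty_set by metis
qed

text \<open>Fix an infinite number \<open>\<nu>\<close>. Rationals with denominator \<open>\<nu>\<close> are infinitesimally dense, and
  their numerators can be treated as elements of sets. The numerators of the points near \<open>c\<^sub>n\<close>
  form sets \<open>X\<^sub>n\<close> with the finite intersection property, so by saturation some \<open>m\<close> lies in all of
  them, and the limit is \<open>m / \<nu>\<close>.\<close>

lemma converges_if_cauchy:
  fixes a :: "nat \<Rightarrow> 'a::ast hrat"
  assumes pos: "\<And>k. 0 \<le> a k"
    and cauchy: "\<And>M. 0 < M \<Longrightarrow> \<exists>c. \<forall>\<^sub>F k in sequentially. \<bar>a k - c\<bar> \<le> 1 / of_nat M"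
  obtains x where "0 \<le> x" "converges a x"
proof -
  obtain \<nu> :: 'a where \<nu>: "\<nu> \<in> NN" "\<And>k. of_nat k < of_N \<nu>" by (rule infinite_natural) blast
  have \<nu>0: "0 < of_N \<nu>" using \<nu>(2)[of 0] by simp
  have "\<forall>n. \<exists>c. \<forall>\<^sub>F k in sequentially. \<bar>a k - c\<bar> \<le> 1 / of_nat (Suc n)"
    using cauchy[OF zero_less_Suc] by blast
  then obtain c where c: "\<And>n. \<forall>\<^sub>F k in sequentially. \<bar>a k - c n\<bar> \<le> 1 / of_nat (Suc n)" by metis
  \<comment> \<open>The factor 2 leaves room for the rounding of \<open>a k * \<nu>\<close> to a natural number.\<close>
  define X where "X n = {m \<in> NN. (c n - 2 / of_nat (Suc n)) * of_N \<nu> \<le> of_N m \<and>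
      of_N m \<le> (c n + 2 / of_nat (Suc n)) * of_N \<nu>}" for n
  have "\<exists>m. \<forall>n. m \<in> X n"
  proof (rule saturation_sets)
    show "is_set (X n)" for n unfolding X_def by (rule is_set_NN_interval)
    show "\<exists>m. \<forall>i<n. m \<in> X i" for n
    proof -
      have "\<forall>\<^sub>F k in sequentially. \<forall>i\<in>{..<n}. \<bar>a k - c i\<bar> \<le> 1 / of_nat (Suc i)"
        by (rule eventually_ball_finite) (use c in auto)
      then obtain k where k: "\<And>i. i < n \<Longrightarrow> \<bar>a k - c i\<bar> \<le> 1 / of_nat (Suc i)"
        by (auto simp: eventually_sequentially)
      have "0 \<le> a k * of_N \<nu>" using pos \<nu>0 by simp
      then obtain m where m: "m \<in> NN" "of_N m \<le> a k * of_N \<nu>" "a k * of_N \<nu> < of_N m + 1"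
        by (rule hrat_floor)
      have "m \<in> X i" if "i < n" for i
      proof -
        define e where "e = 1 / (of_nat (Suc i) :: 'a hrat)"
        have "0 < e" by (simp add: e_def del: of_nat_Suc)
        have "1 \<le> e * of_N \<nu>" using \<nu>(2)[of "Suc i"] unfolding e_def
          by (simp add: field_simps del: of_nat_Suc)
        moreover have "c i - e \<le> a k" "a k \<le> c i + e" using k[OF that] unfolding e_def[symmetric] by linarith+
        then have "(c i - e) * of_N \<nu> \<le> a k * of_N \<nu>" "a k * of_N \<nu> \<le> (c i + e) * of_N \<nu>"
          using \<nu>0 by (simp_all add: mult_right_mono)
        moreover have "0 < e * of_N \<nu>" using \<open>0 < e\<close> \<nu>0 by simp
        moreover have "(c i - 2 * e) * of_N \<nu> = (c i - e) * of_N \<nu> - e * of_N \<nu>"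
          "(c i + 2 * e) * of_N \<nu> = (c i + e) * of_N \<nu> + e * of_N \<nu>"
          by (simp_all add: algebra_simps)
        ultimately have "(c i - 2 * e) * of_N \<nu> \<le> of_N m" "of_N m \<le> (c i + 2 * e) * of_N \<nu>"
          using m(2,3) by linarith+
        then show ?thesis using m(1) by (simp add: X_def e_def del: of_nat_Suc)
      qed
      then show ?thesis by blast
    qed
  qed
  then obtain m where m: "\<And>n. m \<in> X n" by blast
  define x where "x = of_N m / of_N \<nu>"
  have "m \<in> NN" using m[of 0] by (simp add: X_def)
  then have "0 \<le> x" using \<nu>0 by (simp add: x_def of_N_ge_0)
  moreover have "converges a x"
    unfolding converges_def
  proof (intro allI impI)
    fix M :: nat assume M: "0 < M"
    define n where "n = 3 * M - 1"
    have n: "Suc n = 3 * M" using M by (simp add: n_def)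
    define e where "e = 1 / (of_nat (Suc n) :: 'a hrat)"
    have 1: "c n - 2 * e \<le> x" "x \<le> c n + 2 * e"
      using m[of n] \<nu>0 by (auto simp: X_def x_def e_def pos_le_divide_eq pos_divide_le_eq simp del: of_nat_Suc)
    have e: "3 * e = 1 / of_nat M" using M unfolding e_def n by simp
    show "\<forall>\<^sub>F k in sequentially. \<bar>a k - x\<bar> \<le> 1 / of_nat M"
      using c[of n]
    proof eventually_elim
      case (elim k)
      then have "\<bar>a k - c n\<bar> \<le> e" by (simp add: e_def)
      with 1 show ?case unfolding e[symmetric] by linarith
    qed
  qed
  ultimately show ?thesis using that by blast
qed

lemma converges_divide:
  fixes a b :: "nat \<Rightarrow> 'a::linordered_field"
  assumes a: "converges a x" and b: "converges b y" and x: "\<bar>x\<bar> \<le> of_nat K" and y: "1 / 2 \<le> y"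
  shows "converges (\<lambda>k. a k / b k) (x / y)"
  unfolding converges_def
proof (intro allI impI)
  fix M :: nat assume M: "0 < M"
  \<comment> \<open>Eventually \<open>b k \<ge> 1/4\<close>, so the difference of the quotients is at most \<open>4 e + 8 K e\<close> once both errors are at
    most \<open>e = 1 / N\<close>.\<close>
  define N where "N = (4 + 8 * K) * M"
  have "0 < N" using M by (simp add: N_def)
  have "\<forall>\<^sub>F k in sequentially. \<bar>b k - y\<bar> \<le> 1 / 4"
    using b[unfolded converges_def, rule_format, of 4] by simp
  moreover have "\<forall>\<^sub>F k in sequentially. \<bar>a k - x\<bar> \<le> 1 / of_nat N" "\<forall>\<^sub>F k in sequentially. \<bar>b k - y\<bar> \<le> 1 / of_nat N"
    using a b \<open>0 < N\<close> unfolding converges_def by blast+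
  ultimately show "\<forall>\<^sub>F k in sequentially. \<bar>a k / b k - x / y\<bar> \<le> 1 / of_nat M"
  proof eventually_elim
    case (elim k)
    define e where "e = 1 / (of_nat N :: 'a)"
    have bk: "1 / 4 \<le> b k" using elim(1) y by linarith
    have "a k / b k - x / y = (a k - x) / b k - x * (b k - y) / (b k * y)"
      using bk y by (simp add: field_simps)
    also have "\<bar>\<dots>\<bar> \<le> \<bar>(a k - x) / b k\<bar> + \<bar>x * (b k - y) / (b k * y)\<bar>" by (rule abs_triangle_ineq4)
    also have "\<bar>(a k - x) / b k\<bar> \<le> 4 * e"
    proof -
      have "\<bar>a k - x\<bar> \<le> e" using elim(2) by (simp add: e_def)
      also have "e \<le> 4 * e * b k"
        using mult_left_mono[OF bk, of "4 * e"] by (simp add: e_def)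
      finally show ?thesis using bk by (simp add: abs_divide divide_le_eq)
    qed
    also have "\<bar>x * (b k - y) / (b k * y)\<bar> \<le> 8 * of_nat K * e"
    proof -
      have "\<bar>x\<bar> * \<bar>b k - y\<bar> \<le> of_nat K * e" using x elim(3) by (intro mult_mono) (auto simp: e_def)
      also have "\<dots> \<le> 8 * of_nat K * e * (b k * y)"
      proof -
        have "1 / 4 * (1 / 2) \<le> b k * y" using bk y by (intro mult_mono) auto
        from mult_left_mono[OF this, of "8 * of_nat K * e"] show ?thesis by (simp add: e_def)
      qed
      finally show ?thesis using bk y by (simp add: abs_divide abs_mult divide_le_eq)
    qed
    also have "4 * e + 8 * of_nat K * e = 1 / of_nat M"
    proof -
      have "(4 + 8 * of_nat K :: 'a) \<noteq> 0"
        using of_nat_neq_0[where 'a = 'a, of "3 + 8 * K"] by simp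
      moreover have "4 * e + 8 * of_nat K * e = (4 + 8 * of_nat K) * e" by (simp add: algebra_simps)
      moreover have "e = 1 / ((4 + 8 * of_nat K) * of_nat M)" by (simp add: e_def N_def)
      ultimately show ?thesis by simp
    qed
    finally show ?case by simp
  qed
qed

lemma converges_near:
  assumes "converges a x" "converges a y" "0 < M"
  shows "\<bar>x - y\<bar> \<le> 1 / of_nat M"
proof -
  have "0 < 2 * M" using assms(3) by simp
  then have "\<forall>\<^sub>F k in sequentially. \<bar>a k - x\<bar> \<le> 1 / of_nat (2 * M)" "\<forall>\<^sub>F k in sequentially. \<bar>a k - y\<bar> \<le> 1 / of_nat (2 * M)"
    using assms(1,2) unfolding converges_def by blast+
  then have "\<forall>\<^sub>F k in sequentially. \<bar>x - y\<bar> \<le> 1 / of_nat (2 * M) + 1 / of_nat (2 * M)"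
    by eventually_elim linarith
  then have "\<bar>x - y\<bar> \<le> 1 / of_nat (2 * M) + 1 / of_nat (2 * M)" by simp
  also have "\<dots> = 1 / of_nat M" by simp
  finally show ?thesis .
qed

section \<open>Monads\<close>

lemma BQ_iff: "x \<in> BQ \<longleftrightarrow> (\<exists>K. \<bar>x\<bar> \<le> of_nat K)"
  by (auto simp: BQ_def FN_eq)

lemma fin_eq_vempty [simp]: "fin j = vempty \<longleftrightarrow> j = 0"
  by (cases j) simp_all

lemma FN_nonzero: "FN - {vempty} = fin ` {0<..}"
  by (auto simp: FN_eq)

lemma FQ_iff: "q \<in> FQ \<longleftrightarrow> (\<exists>i j. 0 < j \<and> (q = of_nat i / of_nat j \<or> q = - (of_nat i / of_nat j)))"
proof -
  have "q \<in> FQ \<longleftrightarrow> (\<exists>i j. fin j \<noteq> (vempty :: 'a) \<and>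
      (q = of_N (fin i) / of_N (fin j) \<or> q = - (of_N (fin i) / of_N (fin j))))"
    unfolding FQ_def FN_eq by blast
  then show ?thesis by simp
qed

lemma of_nat_in_FQ: "of_nat k \<in> FQ"
  unfolding FQ_iff by (rule exI[of _ k], rule exI[of _ 1]) simp

lemma inverse_of_nat_in_FQ: "0 < M \<Longrightarrow> 1 / of_nat M \<in> FQ"
  unfolding FQ_iff by (rule exI[of _ 1], rule exI[of _ M]) simp

lemma FQ_less_of_nat: "q \<in> FQ \<Longrightarrow> \<exists>k. \<bar>q\<bar> < of_nat k"
proof -
  assume "q \<in> FQ"
  then obtain i j where ij: "0 < j" "q = of_nat i / of_nat j \<or> q = - (of_nat i / of_nat j)"
    unfolding FQ_iff by blast
  have "of_nat i / of_nat j \<le> (of_nat i :: 'a hrat)"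
    using ij(1) mult_left_mono[of 1 "of_nat j" "of_nat i :: 'a hrat"] by (simp add: divide_le_eq)
  also have "\<dots> < of_nat (Suc i)" by simp
  finally have "\<bar>q\<bar> < of_nat (Suc i)" using ij(2) by (auto simp: abs_divide)
  then show ?thesis by blast
qed

lemma FQ_nonzero_gt: "q \<in> FQ \<Longrightarrow> q \<noteq> 0 \<Longrightarrow> \<exists>M > 0. 1 / of_nat M < \<bar>q\<bar>"
proof -
  assume "q \<in> FQ" "q \<noteq> 0"
  then obtain i j where ij: "0 < j" "q = of_nat i / of_nat j \<or> q = - (of_nat i / of_nat j)"
    unfolding FQ_iff by blast
  then have "0 < i" using \<open>q \<noteq> 0\<close> by (cases i) auto
  have "1 / of_nat (Suc j) < 1 / (of_nat j :: 'a hrat)" using ij(1) by (simp add: frac_less2)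
  also have "\<dots> \<le> of_nat i / of_nat j"
    using \<open>0 < i\<close> of_nat_le_iff[of 1 i, where 'a = "'a hrat"] by (intro divide_right_mono) simp_all
  also have "\<dots> = \<bar>q\<bar>" using ij(2) by (auto simp: abs_divide)
  finally show ?thesis by blast
qed

text \<open>For finite \<open>x\<close> the infinite alternatives in the definition of nearness are excluded, and
  finiteness of \<open>p\<close> is automatic.\<close>

lemma mon_finite:
  fixes x :: "'a::ast hrat"
  assumes "\<bar>x\<bar> \<le> of_nat K"
  shows "p \<in> mon x \<longleftrightarrow> (\<forall>M > 0. \<bar>p - x\<bar> < 1 / of_nat M)"
proof -
  have "\<not> of_nat K < x" "\<not> x < - of_nat K" using assms by (auto simp: abs_le_iff)
  then have "\<not> (\<forall>k. of_nat k < p \<and> of_nat k < x)" "\<not> (\<forall>k. p < - of_nat k \<and> x < - of_nat k)"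
    by blast+
  then have "rat_near p x \<longleftrightarrow> p \<in> BQ \<and> x \<in> BQ \<and> (\<forall>M > 0. \<bar>p - x\<bar> < 1 / of_nat M)"
    unfolding rat_near_def FN_nonzero by (auto simp: FN_eq)
  moreover have "x \<in> BQ" using assms BQ_iff by blast
  moreover have "p \<in> BQ" if "\<forall>M > 0. \<bar>p - x\<bar> < 1 / of_nat M"
  proof -
    have "\<bar>p - x\<bar> < 1" using that by (metis div_by_1 of_nat_1 zero_less_one)
    then have "\<bar>p\<bar> \<le> of_nat (Suc K)" using assms by (simp add: abs_le_iff abs_less_iff)
    then show ?thesis using BQ_iff by blast
  qed
  ultimately show ?thesis unfolding mon_def by auto
qed

lemma mon_infinite:
  fixes x :: "'a::ast hrat"
  assumes "\<And>k. of_nat k < x"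
  shows "mon x = infinite_monad"
proof -
  have "x \<notin> BQ"
  proof
    assume "x \<in> BQ"
    then obtain K where "\<bar>x\<bar> \<le> of_nat K" unfolding BQ_iff by blast
    then show False using assms[of K] by (simp add: abs_le_iff)
  qed
  moreover have "\<not> (\<forall>k. p < - of_nat k \<and> x < - of_nat k)" for p
    using assms[of 0] by (auto intro!: exI[of _ 0])
  ultimately show ?thesis
    unfolding mon_def rat_near_def infinite_monad_def using assms by (simp add: FN_eq) blast
qed

lemma mon_eq:
  fixes x y :: "'a::ast hrat"
  assumes "\<bar>x\<bar> \<le> of_nat K" and near: "\<And>M. 0 < M \<Longrightarrow> \<bar>x - y\<bar> \<le> 1 / of_nat M"
  shows "mon x = mon y"
proof -
  have "\<bar>x - y\<bar> \<le> 1" using near[of 1] by simp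
  then have y: "\<bar>y\<bar> \<le> of_nat (Suc K)" using assms(1) by (simp add: abs_le_iff)
  have shift: "\<bar>p - y\<bar> < 1 / of_nat M"
    if "\<forall>M > 0. \<bar>p - x\<bar> < 1 / of_nat M" "0 < M" "\<bar>x - y\<bar> \<le> 1 / of_nat (2 * M)" for p x y :: "'a hrat" and M
  proof -
    have "\<bar>p - x\<bar> < 1 / of_nat (2 * M)" using that(1,2) by (metis mult_pos_pos zero_less_numeral)
    moreover have "1 / of_nat (2 * M) + 1 / of_nat (2 * M) = 1 / (of_nat M :: 'a hrat)" using that(2) by simp
    ultimately show ?thesis using that(3) by linarith
  qed
  have near2: "\<bar>x - y\<bar> \<le> 1 / of_nat (2 * M)" "\<bar>y - x\<bar> \<le> 1 / of_nat (2 * M)" if "0 < M" for M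
    using near[of "2 * M"] that unfolding abs_minus_commute[of y x] by simp_all
  have "(\<forall>M > 0. \<bar>p - x\<bar> < 1 / of_nat M) \<longleftrightarrow> (\<forall>M > 0. \<bar>p - y\<bar> < 1 / of_nat M)" for p
    using shift[of p x _ y, OF _ _ near2(1)] shift[of p y _ x, OF _ _ near2(2)] by blast
  then show ?thesis unfolding set_eq_iff mon_finite[OF assms(1)] mon_finite[OF y] by (rule allI)
qed

lemma self_in_mon_finite: "\<bar>x\<bar> \<le> of_nat K \<Longrightarrow> x \<in> mon x"
  by (simp add: mon_finite)

lemma eventually_FN:
  "(\<exists>i \<in> FN. \<forall>j \<in> FN. i \<in>\<^sub>V j \<longrightarrow> P j) \<longleftrightarrow> (\<forall>\<^sub>F k in sequentially. P (fin k))"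
proof -
  have "(\<exists>i \<in> FN. \<forall>j \<in> FN. i \<in>\<^sub>V j \<longrightarrow> P j) \<longleftrightarrow> (\<exists>i. \<forall>j. i < j \<longrightarrow> P (fin j))"
    by (simp add: FN_eq mem_elts fin_mem_iff)
  also have "\<dots> \<longleftrightarrow> (\<forall>\<^sub>F k in sequentially. P (fin k))"
    by (simp add: eventually_at_top_dense)
  finally show ?thesis .
qed

text \<open>The limit exists by definition and is unique: a bounded sequence cannot have an infinite
  limit, and two finite limits lie in the same monad.\<close>

lemma mon_lim_converges:
  fixes a :: "'a::ast \<Rightarrow> 'a hrat"
  assumes conv: "converges (\<lambda>k. a (fin k)) x" and x: "\<bar>x\<bar> \<le> of_nat K"
  shows "mon_lim a r \<longleftrightarrow> r = mon x"
proof
  assume "r = mon x"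
  moreover have "seq_lim a x"
    unfolding seq_lim_def eventually_FN
  proof (intro disjI1 ballI)
    fix q :: "'a hrat" assume "q \<in> FQ - {0}"
    then obtain M where M: "0 < M" "1 / of_nat M < \<bar>q\<bar>" using FQ_nonzero_gt by blast
    then have "\<forall>\<^sub>F k in sequentially. \<bar>a (fin k) - x\<bar> \<le> 1 / of_nat M" using conv by (auto simp: converges_def)
    then show "\<forall>\<^sub>F k in sequentially. \<bar>a (fin k) - x\<bar> < \<bar>q\<bar>"
      by eventually_elim (use M(2) in simp)
  qed
  ultimately show "mon_lim a r" unfolding mon_lim_def by blast
next
  assume "mon_lim a r"
  then obtain y where y: "r = mon y" "seq_lim a y" unfolding mon_lim_def by (elim exE conjE)
  have bounded: "\<forall>\<^sub>F k in sequentially. \<bar>a (fin k)\<bar> \<le> of_nat (Suc K)"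
  proof -
    have "\<forall>\<^sub>F k in sequentially. \<bar>a (fin k) - x\<bar> \<le> 1 / of_nat 1"
      by (rule conv[unfolded converges_def, rule_format]) simp
    then show ?thesis
    proof eventually_elim
      case (elim k)
      then have "\<bar>a (fin k) - x\<bar> \<le> 1" by simp
      then show ?case unfolding of_nat_Suc using x by linarith
    qed
  qed
  have "converges (\<lambda>k. a (fin k)) y"
    using y(2) unfolding seq_lim_def eventually_FN
  proof (elim disjE conjE)
    assume *: "\<forall>q\<in>FQ - {0}. \<forall>\<^sub>F k in sequentially. \<bar>a (fin k) - y\<bar> < \<bar>q\<bar>"
    show ?thesis unfolding converges_def
    proof (intro allI impI)
      fix M :: nat assume "0 < M"
      then have "1 / of_nat M \<in> (FQ - {0} :: 'a hrat set)"
        using inverse_of_nat_in_FQ by simp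
      with * have "\<forall>\<^sub>F k in sequentially. \<bar>a (fin k) - y\<bar> < \<bar>1 / of_nat M\<bar>" by blast
      then show "\<forall>\<^sub>F k in sequentially. \<bar>a (fin k) - y\<bar> \<le> 1 / of_nat M"
        by eventually_elim simp
    qed
  next
    assume *: "\<forall>q\<in>FQ. \<forall>\<^sub>F k in sequentially. q < a (fin k)"
    have "\<forall>\<^sub>F k in sequentially. of_nat (Suc K) < a (fin k)" by (rule bspec[OF * of_nat_in_FQ])
    with bounded have "\<forall>\<^sub>F k in sequentially. False"
      by eventually_elim (simp add: abs_le_iff)
    then show ?thesis by simp
  next
    assume *: "\<forall>q\<in>FQ. \<forall>\<^sub>F k in sequentially. a (fin k) < q"
    have "- of_nat (Suc K) \<in> (FQ :: 'a hrat set)"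
      unfolding FQ_iff by (rule exI[of _ "Suc K"], rule exI[of _ 1]) simp
    with * have "\<forall>\<^sub>F k in sequentially. a (fin k) < - of_nat (Suc K)" by blast
    with bounded have "\<forall>\<^sub>F k in sequentially. False"
      by eventually_elim (simp add: abs_le_iff)
    then show ?thesis by simp
  qed
  then have "\<bar>x - y\<bar> \<le> 1 / of_nat M" if "0 < M" for M using converges_near conv that by blast
  from mon_eq[OF x this] y(1) show "r = mon x" by simp
qed

lemma mon_lim_diverges:
  fixes a :: "'a::ast \<Rightarrow> 'a hrat"
  assumes div: "diverges (\<lambda>k. a (fin k))"
  shows "mon_lim a r \<longleftrightarrow> r = infinite_monad"
proof
  assume r: "r = infinite_monad"
  obtain n :: 'a where n: "n \<in> NN" "\<And>k. of_nat k < of_N n" by (rule infinite_natural) blast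
  have "q < of_N n" if "q \<in> FQ" for q
    using FQ_less_of_nat[OF that] n(2) by (metis abs_ge_self order.strict_trans order.strict_trans1)
  moreover have "\<forall>\<^sub>F k in sequentially. q < a (fin k)" if q: "q \<in> FQ" for q
  proof -
    obtain m where m: "\<bar>q\<bar> < of_nat m" using FQ_less_of_nat[OF q] by blast
    have "\<forall>\<^sub>F k in sequentially. of_nat m < a (fin k)" using div unfolding diverges_def by blast
    then show ?thesis by eventually_elim (use m in \<open>simp add: abs_less_iff\<close>)
  qed
  ultimately have "seq_lim a (of_N n)" unfolding seq_lim_def eventually_FN by blast
  moreover have "mon (of_N n) = infinite_monad" by (rule mon_infinite[OF n(2)])
  ultimately show "mon_lim a r" unfolding mon_lim_def using r by metis
next
  assume "mon_lim a r"
  then obtain y where y: "r = mon y" "seq_lim a y" unfolding mon_lim_def by (elim exE conjE)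
  have "of_nat m < y" for m
    using y(2) unfolding seq_lim_def eventually_FN
  proof (elim disjE conjE)
    assume *: "\<forall>q\<in>FQ - {0}. \<forall>\<^sub>F k in sequentially. \<bar>a (fin k) - y\<bar> < \<bar>q\<bar>"
    have "of_nat 1 \<in> (FQ - {0} :: 'a hrat set)" using of_nat_in_FQ[of 1] by simp
    with * have "\<forall>\<^sub>F k in sequentially. \<bar>a (fin k) - y\<bar> < \<bar>of_nat 1\<bar>" by blast
    moreover have "\<forall>\<^sub>F k in sequentially. of_nat (Suc m) < a (fin k)" using div unfolding diverges_def by blast
    ultimately have "\<forall>\<^sub>F k in sequentially. of_nat m < y"
      by eventually_elim (simp add: abs_less_iff)
    then show ?thesis by simp
  next
    assume "\<forall>q\<in>FQ. q < y"
    then show ?thesis using of_nat_in_FQ by blast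
  next
    assume *: "\<forall>q\<in>FQ. \<forall>\<^sub>F k in sequentially. a (fin k) < q"
    have "\<forall>\<^sub>F k in sequentially. a (fin k) < of_nat 0" by (rule bspec[OF * of_nat_in_FQ])
    moreover have "\<forall>\<^sub>F k in sequentially. of_nat 0 < a (fin k)" using div unfolding diverges_def by blast
    ultimately have "\<forall>\<^sub>F k in sequentially. False" by eventually_elim simp
    then show ?thesis by simp
  qed
  then have "mon y = infinite_monad" by (rule mon_infinite)
  with y(1) show "r = infinite_monad" by simp
qed


section \<open>Observability\<close>

text \<open>The lower and the upper limit of the cuts \<open>below (a k)\<close> both contain every nonnegative
  rational that is eventually below the sequence, and none that is eventually an upper bound of
  it. Stated for two such classes, the lemma serves both differences in \<open>cut_near\<close>. In the proof
  take \<open>b = max 0 (x - 2 e)\<close>, which belongs to \<open>Z2\<close> or is the least element \<open>0\<close> of the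
  complement of \<open>Z2 = {}\<close>. Then \<open>y + b \<in> Z1\<close> forces \<open>y < 4 e\<close>.\<close>

lemma internal_diff_infinitesimal:
  fixes a :: "nat \<Rightarrow> 'a::ast hrat"
  assumes a: "converges a x"
    and Z1: "\<And>q. q \<in> Z1 \<Longrightarrow> \<not> (\<forall>\<^sub>F k in sequentially. a k \<le> q)"
    and Z2_pos: "Z2 \<subseteq> Q_plus" and Z2_down: "\<And>p q. q \<in> Z2 \<Longrightarrow> 0 \<le> p \<Longrightarrow> p \<le> q \<Longrightarrow> p \<in> Z2"
    and Z2: "\<And>q. 0 \<le> q \<Longrightarrow> \<forall>\<^sub>F k in sequentially. q < a k \<Longrightarrow> q \<in> Z2"
  shows "Z1 \<ominus> Z2 \<subseteq> inv_FN_cut"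
proof
  fix y assume y: "y \<in> Z1 \<ominus> Z2"
  then have "0 \<le> y" and sum: "\<And>b. b \<in> add_min_compl Z2 \<Longrightarrow> y + b \<in> Z1"
    by (auto simp: internal_diff_def Q_plus_def)
  have "y < 1 / of_nat n" if n: "0 < n" for n
  proof -
    define e where "e = 1 / (of_nat (4 * n) :: 'a hrat)"
    have e: "0 < e" "4 * e = 1 / of_nat n" using n by (simp_all add: e_def)
    have near: "\<forall>\<^sub>F k in sequentially. \<bar>a k - x\<bar> \<le> e"
      unfolding e_def using n by (intro a[unfolded converges_def, rule_format]) simp
    define b where "b = max 0 (x - 2 * e)"
    have "b \<in> add_min_compl Z2"
    proof (cases "b = 0")
      case True
      show ?thesis
      proof (cases "0 \<in> Z2")
        case False
        then have "Z2 = {}" using Z2_pos Z2_down by (fastforce simp: Q_plus_def)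
        then show ?thesis using True by (simp add: add_min_compl_def Q_plus_def)
      qed (simp add: True add_min_compl_def)
    next
      case False
      then have "b = x - 2 * e" "0 \<le> b" by (auto simp: b_def max_def split: if_splits)
      from near have "\<forall>\<^sub>F k in sequentially. b < a k"
        by eventually_elim (use \<open>b = x - 2 * e\<close> e(1) in linarith)
      then show ?thesis using Z2 \<open>0 \<le> b\<close> by (simp add: add_min_compl_def)
    qed
    then have "\<not> (\<forall>\<^sub>F k in sequentially. a k \<le> y + b)" by (intro Z1 sum)
    moreover have "\<forall>\<^sub>F k in sequentially. a k \<le> y + b" if "4 * e \<le> y"
      using near
    proof eventually_elim
      case (elim k)
      have "x - 2 * e \<le> b" by (simp add: b_def)
      then show ?case using elim that e(1) by linarith
    qed
    ultimately show ?thesis unfolding e(2)[symmetric] by (meson not_le)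
  qed
  then show "y \<in> inv_FN_cut"
    using \<open>0 \<le> y\<close> unfolding inv_FN_cut_def FN_nonzero by (simp add: below_def Q_plus_def)
qed

lemma mem_liminf_below_iff:
  "q \<in> liminf_seq (\<lambda>i. below (r i)) \<longleftrightarrow> 0 \<le> q \<and> (\<forall>\<^sub>F k in sequentially. q < r (fin k))"
  by (simp add: mem_liminf_seq_iff below_def Q_plus_def eventually_conj_iff)

lemma mem_limsup_below_iff:
  "q \<in> limsup_seq (\<lambda>i. below (r i)) \<longleftrightarrow> 0 \<le> q \<and> \<not> (\<forall>\<^sub>F k in sequentially. r (fin k) \<le> q)"
proof -
  have "q \<notin> limsup_seq (\<lambda>i. below (r i)) \<longleftrightarrow> (\<forall>\<^sub>F k in sequentially. 0 \<le> q \<longrightarrow> r (fin k) \<le> q)"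
    by (simp add: not_mem_limsup_seq_iff below_def Q_plus_def not_less)
  then show ?thesis by (cases "0 \<le> q") auto
qed

lemma not_eventually_le_if_less:
  fixes a :: "nat \<Rightarrow> 'a::linorder"
  assumes "\<forall>\<^sub>F k in sequentially. q < a k"
  shows "\<not> (\<forall>\<^sub>F k in sequentially. a k \<le> q)"
proof
  assume "\<forall>\<^sub>F k in sequentially. a k \<le> q"
  with assms have "\<forall>\<^sub>F k in sequentially. False" by eventually_elim simp
  then show False by simp
qed

lemma cut_near_if_converges:
  fixes r :: "'a::ast \<Rightarrow> 'a hrat"
  assumes "converges (\<lambda>k. r (fin k)) x"
  shows "cut_near (liminf_seq (\<lambda>i. below (r i))) (limsup_seq (\<lambda>i. below (r i)))"
proof -
  let ?A = "liminf_seq (\<lambda>i. below (r i))" and ?B = "limsup_seq (\<lambda>i. below (r i))"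
  have "?A \<ominus> ?B \<subseteq> inv_FN_cut"
  proof (rule internal_diff_infinitesimal[OF assms])
    fix p q assume "q \<in> ?B" "0 \<le> p" "p \<le> q"
    moreover have "\<forall>\<^sub>F k in sequentially. r (fin k) \<le> q" if "\<forall>\<^sub>F k in sequentially. r (fin k) \<le> p"
      using that by eventually_elim (use \<open>p \<le> q\<close> in simp)
    ultimately show "p \<in> ?B" by (auto simp: mem_limsup_below_iff)
  qed (auto simp: mem_liminf_below_iff mem_limsup_below_iff Q_plus_def not_eventually_le_if_less)
  moreover have "?B \<ominus> ?A \<subseteq> inv_FN_cut"
  proof (rule internal_diff_infinitesimal[OF assms])
    fix p q assume *: "q \<in> ?A" "0 \<le> p" "p \<le> q"
    then have "\<forall>\<^sub>F k in sequentially. q < r (fin k)" by (simp add: mem_liminf_below_iff)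
    then have "\<forall>\<^sub>F k in sequentially. p < r (fin k)" by eventually_elim (use \<open>p \<le> q\<close> in simp)
    with * show "p \<in> ?A" by (simp add: mem_liminf_below_iff)
  qed (auto simp: mem_liminf_below_iff mem_limsup_below_iff Q_plus_def)
  ultimately show ?thesis unfolding cut_near_def by blast
qed

lemma cut_near_if_diverges:
  fixes r :: "'a::ast \<Rightarrow> 'a hrat"
  assumes "diverges (\<lambda>k. r (fin k))"
  shows "cut_near (liminf_seq (\<lambda>i. below (r i))) (limsup_seq (\<lambda>i. below (r i)))"
proof -
  let ?A = "liminf_seq (\<lambda>i. below (r i))" and ?B = "limsup_seq (\<lambda>i. below (r i))"
  have "q \<in> ?A" if "q \<in> FN_cut" for q
  proof -
    from that obtain m where m: "0 \<le> q" "q < of_nat m"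
      by (auto simp: FN_cut_def FN_eq below_def Q_plus_def)
    have "\<forall>\<^sub>F k in sequentially. of_nat m < r (fin k)" using assms unfolding diverges_def by blast
    then have "\<forall>\<^sub>F k in sequentially. q < r (fin k)" by eventually_elim (use m(2) in simp)
    with m(1) show ?thesis by (simp add: mem_liminf_below_iff)
  qed
  moreover have "?A \<subseteq> ?B"
    by (auto simp: mem_liminf_below_iff mem_limsup_below_iff not_eventually_le_if_less)
  ultimately show ?thesis unfolding cut_near_def by blast
qed

section \<open>Convergence of approximating sequences\<close>

lemma converges_le:
  assumes "converges a x" "\<forall>\<^sub>F k in sequentially. a k \<le> c"
  shows "x \<le> c + 1"
proof -
  have "\<forall>\<^sub>F k in sequentially. \<bar>a k - x\<bar> \<le> 1 / of_nat 1"
    by (rule assms(1)[unfolded converges_def, rule_format]) simp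
  with assms(2) have "\<forall>\<^sub>F k in sequentially. x \<le> c + 1"
    by eventually_elim (simp add: abs_le_iff)
  then show ?thesis by simp
qed

text \<open>To find the limit up to \<open>1 / M\<close>, let \<open>\<delta> = t / M\<close> and let \<open>j\<close> be least such that \<open>j \<delta>\<close>
  is not in the lower cut. Then \<open>(j + 1) \<delta>\<close> is not in the upper cut, since otherwise \<open>j \<delta>\<close>
  would be in the lower one. So the terms are eventually between \<open>(j - 1) \<delta>\<close> and
  \<open>(j + 1) \<delta>\<close>.\<close>

lemma scaled_approximation_converges:
  fixes X :: "'a::ast set"
  assumes X: "X \<in> borel_semisets" and a: "approximates a X" and t: "1 \<le> 2 * t"
    and K: "of_nat K * t \<notin> upper_cut X"
  obtains x where "0 \<le> x" "x \<le> of_nat (Suc K)" "converges (\<lambda>k. a k / t) x"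
proof -
  have t0: "0 < t" using t by simp
  have apos: "0 \<le> a k" for k using a by (simp add: approximates_def)
  have lower: "q \<in> lower_cut X \<longleftrightarrow> (\<forall>\<^sub>F k in sequentially. q < a k)" if "0 \<le> q" for q
    using a that by (simp add: approximates_def)
  have upper: "q \<notin> upper_cut X \<longleftrightarrow> (\<forall>\<^sub>F k in sequentially. a k \<le> q)" if "0 \<le> q" for q
    using a that by (simp add: approximates_def)
  have "\<exists>c. \<forall>\<^sub>F k in sequentially. \<bar>a k / t - c\<bar> \<le> 1 / of_nat M" if M: "0 < M" for M
  proof -
    define \<delta> where "\<delta> = t / of_nat M"
    have \<delta>: "0 < \<delta>" "of_nat M * \<delta> = t" using M t0 by (simp_all add: \<delta>_def)
    have eq: "of_nat (K * M) * \<delta> = of_nat K * t" using \<delta>(2) by (simp add: mult.assoc)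
    have notin: "of_nat (K * M) * \<delta> \<notin> lower_cut X" unfolding eq using K lower_cut_subset_upper_cut by blast
    obtain j where j: "of_nat j * \<delta> \<notin> lower_cut X" "\<And>i. i < j \<Longrightarrow> of_nat i * \<delta> \<in> lower_cut X"
      using exists_least_iff[of "\<lambda>j. of_nat j * \<delta> \<notin> lower_cut X"] notin by blast
    have "of_nat (Suc j) * \<delta> \<notin> upper_cut X"
    proof
      assume "of_nat (Suc j) * \<delta> \<in> upper_cut X"
      \<comment> \<open>The summand 1 is a finite multiple of \<open>\<delta>\<close>, namely at most \<open>2 t = 2 M \<delta>\<close>.\<close>
      moreover have "of_nat (Suc j) * \<delta> + 1 \<le> of_nat (Suc j + 2 * M) * \<delta>"
        using t unfolding \<delta>(2)[symmetric] by (simp add: algebra_simps)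
      moreover have diff: "of_nat (Suc j) * \<delta> - \<delta> = of_nat j * \<delta>" by (simp add: algebra_simps)
      moreover have "0 \<le> of_nat (Suc j) * \<delta> - \<delta>" unfolding diff using \<delta>(1) by simp
      ultimately have "of_nat (Suc j) * \<delta> - \<delta> \<in> lower_cut X"
        using upper_cut_near_lower_cut[OF X \<delta>(1)] by blast
      then show False using j(1) diff by simp
    qed
    then have up: "\<forall>\<^sub>F k in sequentially. a k \<le> of_nat (Suc j) * \<delta>"
      using upper \<delta>(1) by simp
    have lo: "\<forall>\<^sub>F k in sequentially. of_nat j * \<delta> - \<delta> \<le> a k"
    proof (cases j)
      case 0
      have "of_nat j * \<delta> - \<delta> \<le> a k" for k using apos[of k] \<delta>(1) by (simp add: 0)
      then show ?thesis by simp
    next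
      case (Suc i)
      then have "\<forall>\<^sub>F k in sequentially. of_nat i * \<delta> < a k" using j(2)[of i] lower \<delta>(1) by simp
      then show ?thesis by eventually_elim (simp add: Suc algebra_simps)
    qed
    from up lo have "\<forall>\<^sub>F k in sequentially. \<bar>a k / t - of_nat j / of_nat M\<bar> \<le> 1 / of_nat M"
    proof eventually_elim
      case (elim k)
      have "\<bar>a k - of_nat j * \<delta>\<bar> \<le> \<delta>" using elim by (simp add: abs_le_iff algebra_simps)
      then have "\<bar>a k - of_nat j * \<delta>\<bar> / t \<le> \<delta> / t" using t0 by (intro divide_right_mono) auto
      moreover have "\<bar>a k - of_nat j * \<delta>\<bar> / t = \<bar>a k / t - of_nat j / of_nat M\<bar>"
      proof -
        have "(a k - of_nat j * \<delta>) / t = a k / t - of_nat j / of_nat M"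
          using t0 by (simp add: \<delta>_def diff_divide_distrib)
        then show ?thesis using t0 by (metis abs_divide abs_of_pos)
      qed
      moreover have "\<delta> / t = 1 / of_nat M" using t0 by (simp add: \<delta>_def)
      ultimately show ?case by simp
    qed
    then show ?thesis by blast
  qed
  moreover have "0 \<le> a k / t" for k using apos t0 by simp
  ultimately obtain x where x: "0 \<le> x" "converges (\<lambda>k. a k / t) x"
    using converges_if_cauchy[of "\<lambda>k. a k / t"] by blast
  have "\<forall>\<^sub>F k in sequentially. a k \<le> of_nat K * t" using K upper[of "of_nat K * t"] t0 by simp
  then have "\<forall>\<^sub>F k in sequentially. a k / t \<le> of_nat K"
    by eventually_elim (use t0 in \<open>simp add: pos_divide_le_eq\<close>)
  from converges_le[OF x(2) this] have "x \<le> of_nat (Suc K)" by simp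
  with x that show ?thesis by blast
qed

lemma scaled_approximation_diverges:
  fixes X :: "'a::ast set"
  assumes X: "X \<in> borel_semisets" and a: "approximates a X" and t: "1 \<le> 2 * t"
    and K: "\<And>K. of_nat K * t \<in> upper_cut X"
  shows "diverges (\<lambda>k. a k / t)"
  unfolding diverges_def
proof
  fix M
  have t0: "0 < t" using t by simp
  have "of_nat (Suc M) * t + 1 \<le> of_nat (M + 3) * t" using t by (simp add: algebra_simps)
  moreover have "of_nat (Suc M) * t - t = of_nat M * t" by (simp add: algebra_simps)
  ultimately have "of_nat M * t \<in> lower_cut X"
    using upper_cut_near_lower_cut[OF X t0 _ K[of "Suc M"], of "M + 3"] t0 by simp
  then have "\<forall>\<^sub>F k in sequentially. of_nat M * t < a k"
    using a t0 by (simp add: approximates_def)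
  then show "\<forall>\<^sub>F k in sequentially. of_nat M < a k / t"
    by eventually_elim (use t0 in \<open>simp add: pos_less_divide_eq\<close>)
qed

text \<open>Only the lower cuts are compared: a number slightly below \<open>\<beta> t\<close> is in the lower cut of \<open>B\<close>,
  hence in that of \<open>C\<close>, and so it is eventually below the terms for \<open>C\<close>.\<close>

lemma scaled_limit_mono:
  fixes B C :: "'a::ast set"
  assumes "B \<subseteq> C" and b: "approximates b B" and c: "approximates c C" and t: "0 < t"
    and beta: "converges (\<lambda>k. b k / t) \<beta>" "0 \<le> \<beta>" and gamma: "converges (\<lambda>k. c k / t) \<gamma>"
    and M: "0 < M"
  shows "\<beta> \<le> \<gamma> + 1 / of_nat M"
proof (rule ccontr)
  assume not_le: "\<not> ?thesis"
  define e where "e = 1 / (of_nat (4 * M) :: 'a hrat)"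
  have e: "0 < e" "4 * e = 1 / of_nat M" using M by (simp_all add: e_def)
  have gt: "\<gamma> + 4 * e < \<beta>" using not_le unfolding e(2) by simp
  have near: "\<forall>\<^sub>F k in sequentially. \<bar>b k / t - \<beta>\<bar> \<le> e" "\<forall>\<^sub>F k in sequentially. \<bar>c k / t - \<gamma>\<bar> \<le> e"
    unfolding e_def using M beta(1) gamma by (simp_all add: converges_def del: of_nat_mult)
  have "0 \<le> \<gamma> + e"
  proof -
    from near(2) have "\<forall>\<^sub>F k in sequentially. 0 \<le> \<gamma> + e"
    proof eventually_elim
      case (elim k)
      have "0 \<le> c k / t" using c t by (simp add: approximates_def)
      with elim show ?case by linarith
    qed
    then show ?thesis by simp
  qed
  then have q: "0 \<le> (\<gamma> + 2 * e) * t" using e(1) t by simp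
  from near(1) have "\<forall>\<^sub>F k in sequentially. (\<gamma> + 2 * e) * t < b k"
  proof eventually_elim
    case (elim k)
    then have "\<gamma> + 2 * e < b k / t" using gt e(1) by linarith
    then show ?case using t by (simp add: pos_less_divide_eq)
  qed
  then have "(\<gamma> + 2 * e) * t \<in> lower_cut B" using b q by (simp add: approximates_def)
  then have "(\<gamma> + 2 * e) * t \<in> lower_cut C" using lower_cut_mono[OF assms(1)] by blast
  then have "\<forall>\<^sub>F k in sequentially. (\<gamma> + 2 * e) * t < c k" using c q by (simp add: approximates_def)
  with near(2) have "\<forall>\<^sub>F k in sequentially. False"
  proof eventually_elim
    case (elim k)
    then have "\<gamma> + 2 * e < c k / t" using t by (simp add: pos_less_divide_eq)
    with elim e(1) show ?case by linarith
  qed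
  then show False by simp
qed

lemma scaled_limit_not_diverges:
  fixes B C :: "'a::ast set"
  assumes "B \<subseteq> C" and b: "approximates b B" and c: "approximates c C" and t: "0 < t"
    and div: "diverges (\<lambda>k. b k / t)" and gamma: "converges (\<lambda>k. c k / t) \<gamma>" "\<gamma> \<le> of_nat K"
  shows False
proof -
  have q: "0 \<le> of_nat (Suc K) * t" using t by simp
  have "\<forall>\<^sub>F k in sequentially. of_nat (Suc K) < b k / t" using div unfolding diverges_def by blast
  then have "\<forall>\<^sub>F k in sequentially. of_nat (Suc K) * t < b k"
    by eventually_elim (use t in \<open>simp add: pos_less_divide_eq\<close>)
  then have "of_nat (Suc K) * t \<in> lower_cut B" using b q by (simp add: approximates_def)
  then have "of_nat (Suc K) * t \<in> lower_cut C" using lower_cut_mono[OF assms(1)] by blast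
  then have "\<forall>\<^sub>F k in sequentially. of_nat (Suc K) * t < c k" using c q by (simp add: approximates_def)
  moreover have "\<forall>\<^sub>F k in sequentially. \<bar>c k / t - \<gamma>\<bar> \<le> 1 / of_nat 1"
    by (rule gamma(1)[unfolded converges_def, rule_format]) simp
  ultimately have "\<forall>\<^sub>F k in sequentially. False"
  proof eventually_elim
    case (elim k)
    then have "of_nat (Suc K) < c k / t" using t by (simp add: pos_less_divide_eq)
    moreover have "\<bar>c k / t - \<gamma>\<bar> \<le> 1" using elim by simp
    ultimately show ?case unfolding of_nat_Suc using gamma(2) by linarith
  qed
  then show False by simp
qed

text \<open>From \<open>2 t\<close> not in the lower cut it follows that \<open>3 t\<close> is not in the upper cut, so the
  terms are eventually between \<open>t\<close> and \<open>3 t\<close>. In particular only finitely many of them vanish.\<close>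

lemma nonadditive_denominator:
  fixes S :: "'a::ast set"
  assumes S: "S \<in> borel_semisets" and n: "approximates n S" and "nonadditive_cut (lower_cut S)"
  obtains t \<sigma> where "1 \<le> 2 * t" "1 / 2 \<le> \<sigma>" "converges (\<lambda>k. n k / t) \<sigma>"
    "\<forall>\<^sub>F k in sequentially. 1 < n k / t \<and> n k / t \<le> 3"
proof -
  obtain t where t: "t \<in> lower_cut S" "2 * t \<notin> lower_cut S" "1 \<le> 2 * t"
    using nonadditive_lower_cut_unit[OF assms(3)] by blast
  have t0: "0 < t" using t(3) by simp
  have notin: "of_nat 3 * t \<notin> upper_cut S"
  proof
    assume "of_nat 3 * t \<in> upper_cut S"
    moreover have "of_nat 3 * t + 1 \<le> of_nat 5 * t" using t(3) by simp
    moreover have diff: "of_nat 3 * t - t = 2 * t" by simp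
    moreover have "0 \<le> of_nat 3 * t - t" unfolding diff using t0 by simp
    ultimately have "of_nat 3 * t - t \<in> lower_cut S"
      using upper_cut_near_lower_cut[OF S t0] by blast
    then show False using t(2) unfolding diff by simp
  qed
  obtain \<sigma> where \<sigma>: "converges (\<lambda>k. n k / t) \<sigma>"
    by (rule scaled_approximation_converges[OF S n t(3) notin])
  have "\<forall>\<^sub>F k in sequentially. t < n k" using n t(1) t0 by (simp add: approximates_def)
  moreover have "\<forall>\<^sub>F k in sequentially. n k \<le> of_nat 3 * t" using n notin t0 by (simp add: approximates_def)
  ultimately have ev: "\<forall>\<^sub>F k in sequentially. 1 < n k / t \<and> n k / t \<le> 3"
    by eventually_elim (use t0 in \<open>simp add: pos_less_divide_eq pos_divide_le_eq\<close>)
  moreover have "\<forall>\<^sub>F k in sequentially. \<bar>n k / t - \<sigma>\<bar> \<le> 1 / of_nat 2"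
    by (rule \<sigma>[unfolded converges_def, rule_format]) simp
  ultimately have "\<forall>\<^sub>F k in sequentially. 1 / 2 \<le> \<sigma>"
  proof eventually_elim
    case (elim k)
    then have "\<bar>n k / t - \<sigma>\<bar> \<le> 1 / 2" by simp
    with elim(1) show ?case by linarith
  qed
  then show ?thesis using that t(3) \<sigma> ev by simp
qed

section \<open>The Kalina measure\<close>

text \<open>For every Borel semiset one of two cases occurs: the scaled sequence converges to some \<open>\<beta>\<close>,
  and then the measure is the monad of \<open>\<beta> / \<sigma>\<close>, or it diverges, and then the measure is \<open>\<infinity>\<close>.
  Each claim is verified in these cases. If \<open>B \<subseteq> C\<close>, then the limit \<open>\<beta>\<close> for \<open>B\<close> may exceed the
  limit \<open>\<gamma>\<close> for \<open>C\<close>, but only by an infinitesimal, and then the monads are equal.\<close>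

theorem theorem29:
  fixes F :: "'a::ast set \<Rightarrow> 'a \<Rightarrow> 'a hrat set"
    and s :: "'a \<Rightarrow> 'a hrat set"
    and S :: "'a set"
  assumes "BAF F"
    and "S \<in> borel_semisets"
    and "approximating_sequence S s"
    and "nonadditive_cut (lower_cut S)"
    and "nonadditive_cut (upper_cut S)"
  shows "\<O> s F = borel_semisets \<and>
    (\<forall>B \<in> \<O> s F. mon_lim (ratio (F B) s) (kalina s F B) \<and>
                 kalina s F B \<in> monad_reals \<union> {infinite_monad}) \<and>
    (\<forall>B \<in> \<O> s F. mon_le (mon 0) (kalina s F B)) \<and>
    (\<forall>B \<in> \<O> s F. \<forall>C \<in> \<O> s F. B \<subseteq> C \<longrightarrow> mon_le (kalina s F B) (kalina s F C))"
proof -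
  define n where "n k = cut_value (s (fin k))" for k
  define b where "b B k = cut_value (F B (fin k))" for B k
  have n: "approximates n S"
    unfolding n_def by (rule approximating_sequence_approximates[OF assms(3)])
  have b: "approximates (b B) B" if "B \<in> borel_semisets" for B
    unfolding b_def using assms(1) that by (intro approximating_sequence_approximates) (simp add: BAF_def)
  obtain t \<sigma> where t: "1 \<le> 2 * t" and \<sigma>: "1 / 2 \<le> \<sigma>" "converges (\<lambda>k. n k / t) \<sigma>"
    and n_bounds: "\<forall>\<^sub>F k in sequentially. 1 < n k / t \<and> n k / t \<le> 3"
    by (rule nonadditive_denominator[OF assms(2) n assms(4)])
  have t0: "0 < t" using t by simp
  have ratio: "ratio (F B) s (fin k) = (b B k / t) / (n k / t)" for B k
    using t0 by (simp add: ratio_def b_def n_def)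
  define finite_case where "finite_case B \<beta> \<longleftrightarrow> 0 \<le> \<beta> \<and> converges (\<lambda>k. b B k / t) \<beta> \<and>
    (\<exists>K. \<beta> \<le> of_nat K \<and> \<beta> / \<sigma> \<le> of_nat K) \<and> converges (\<lambda>k. ratio (F B) s (fin k)) (\<beta> / \<sigma>) \<and>
    kalina s F B = mon (\<beta> / \<sigma>)" for B \<beta>
  define infinite_case where "infinite_case B \<longleftrightarrow> diverges (\<lambda>k. b B k / t) \<and>
    diverges (\<lambda>k. ratio (F B) s (fin k)) \<and> kalina s F B = infinite_monad" for B
  have kalina: "kalina s F B = r" if "\<And>r'. mon_lim (ratio (F B) s) r' \<longleftrightarrow> r' = r" for B r
    unfolding kalina_def that by simp
  have cases: "(\<exists>\<beta>. finite_case B \<beta>) \<or> infinite_case B" if B: "B \<in> borel_semisets" for B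
  proof (cases "\<exists>K. of_nat K * t \<notin> upper_cut B")
    case True
    then obtain K \<beta> where \<beta>: "0 \<le> \<beta>" "\<beta> \<le> of_nat K" "converges (\<lambda>k. b B k / t) \<beta>"
      using scaled_approximation_converges[OF B b[OF B] t] by metis
    have conv: "converges (\<lambda>k. ratio (F B) s (fin k)) (\<beta> / \<sigma>)"
      unfolding ratio using \<beta> by (intro converges_divide[OF \<beta>(3) \<sigma>(2) _ \<sigma>(1), of K]) simp
    have "\<beta> / \<sigma> \<le> of_nat (2 * K)"
    proof -
      have "\<beta> \<le> of_nat (2 * K) * (1 / 2)" using \<beta>(2) by simp
      also have "\<dots> \<le> of_nat (2 * K) * \<sigma>" using \<sigma>(1) by (intro mult_left_mono) auto
      finally show ?thesis using \<sigma>(1) by (simp add: pos_divide_le_eq)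
    qed
    moreover have "of_nat K \<le> (of_nat (2 * K) :: 'a hrat)" by (simp only: of_nat_le_iff)
    moreover have pos: "0 \<le> \<beta> / \<sigma>" using \<beta>(1) \<sigma>(1) by simp
    moreover have "kalina s F B = mon (\<beta> / \<sigma>)"
      by (rule kalina, rule mon_lim_converges[OF conv, of "2 * K"]) (use calculation pos in simp)
    ultimately have "finite_case B \<beta>"
      unfolding finite_case_def using \<beta> conv order.trans by blast
    then show ?thesis by blast
  next
    case False
    then have div: "diverges (\<lambda>k. b B k / t)"
      using scaled_approximation_diverges[OF B b[OF B] t] by blast
    have "diverges (\<lambda>k. ratio (F B) s (fin k))"
      unfolding diverges_def ratio
    proof
      fix M
      have "\<forall>\<^sub>F k in sequentially. of_nat (3 * M) < b B k / t" using div unfolding diverges_def by blast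
      with n_bounds show "\<forall>\<^sub>F k in sequentially. of_nat M < b B k / t / (n k / t)"
      proof eventually_elim
        case (elim k)
        have "of_nat M * (n k / t) \<le> of_nat M * 3" using elim(1) by (intro mult_left_mono) auto
        also have "\<dots> < b B k / t" using elim(2) by (simp add: mult.commute)
        finally have "of_nat M * (n k / t) < b B k / t" .
        moreover have "0 < n k / t" using elim(1) by (auto intro: order.strict_trans[OF zero_less_one])
        ultimately show ?case by (simp only: pos_less_divide_eq)
      qed
    qed
    with div kalina[OF mon_lim_diverges[OF this]] show ?thesis unfolding infinite_case_def by blast
  qed
  have obs: "\<O> s F = borel_semisets"
  proof (intro equalityI subsetI)
    fix B :: "'a set" assume B: "B \<in> borel_semisets"
    from cases[OF B] show "B \<in> \<O> s F"
      using cut_near_if_converges[of "ratio (F B) s"] cut_near_if_diverges[of "ratio (F B) s"] B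
      unfolding observable_def finite_case_def infinite_case_def by blast
  qed (simp add: observable_def)
  obtain \<nu> :: 'a where \<nu>: "\<nu> \<in> NN" "\<And>k. of_nat k < of_N \<nu>" by (rule infinite_natural) blast
  have \<nu>_mem: "of_N \<nu> \<in> infinite_monad" using \<nu>(2) by (simp add: infinite_monad_def FN_eq)
  have finite_mem: "\<beta> / \<sigma> \<in> kalina s F B" "0 \<le> \<beta> / \<sigma>" "\<beta> / \<sigma> < of_N \<nu>"
    "kalina s F B \<in> monad_reals" "mon_lim (ratio (F B) s) (kalina s F B)" if fin: "finite_case B \<beta>" for B \<beta>
  proof -
    from fin obtain K where K: "\<beta> / \<sigma> \<le> of_nat K" unfolding finite_case_def by blast
    show pos: "0 \<le> \<beta> / \<sigma>" using fin \<sigma>(1) by (simp add: finite_case_def)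
    have abs: "\<bar>\<beta> / \<sigma>\<bar> \<le> of_nat K" using K pos by simp
    have kal: "kalina s F B = mon (\<beta> / \<sigma>)" using fin by (simp add: finite_case_def)
    show "\<beta> / \<sigma> \<in> kalina s F B" unfolding kal using abs by (rule self_in_mon_finite)
    show "\<beta> / \<sigma> < of_N \<nu>" using K \<nu>(2)[of K] by simp
    show "kalina s F B \<in> monad_reals" unfolding kal monad_reals_def using abs BQ_iff by blast
    show "mon_lim (ratio (F B) s) (kalina s F B)"
      using mon_lim_converges[OF _ abs] fin by (simp add: finite_case_def)
  qed
  have infinite_mem: "of_N \<nu> \<in> kalina s F B" "kalina s F B = infinite_monad"
    "mon_lim (ratio (F B) s) (kalina s F B)" if "infinite_case B" for B
    using that \<nu>_mem mon_lim_diverges[of "ratio (F B) s"] unfolding infinite_case_def by auto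
  have zero: "0 \<in> mon (0 :: 'a hrat)" by (rule self_in_mon_finite[of _ 0]) simp
  have lim: "mon_lim (ratio (F B) s) (kalina s F B) \<and> kalina s F B \<in> monad_reals \<union> {infinite_monad}"
    and nonneg: "mon_le (mon 0) (kalina s F B)" if B: "B \<in> borel_semisets" for B
  proof -
    show "mon_lim (ratio (F B) s) (kalina s F B) \<and> kalina s F B \<in> monad_reals \<union> {infinite_monad}"
      using cases[OF B] finite_mem(4,5) infinite_mem(2,3) by blast
    have "0 \<le> of_N \<nu>" by (rule of_N_ge_0[OF \<nu>(1)])
    then show "mon_le (mon 0) (kalina s F B)"
      using cases[OF B] finite_mem(1,2) infinite_mem(1) zero unfolding mon_le_def by blast
  qed
  have mono: "mon_le (kalina s F B) (kalina s F C)"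
    if B: "B \<in> borel_semisets" and C: "C \<in> borel_semisets" and sub: "B \<subseteq> C" for B C
    using cases[OF C]
  proof (elim disjE exE)
    assume C_inf: "infinite_case C"
    from cases[OF B] show ?thesis
    proof (elim disjE exE)
      fix \<beta> assume "finite_case B \<beta>"
      then show ?thesis
        using finite_mem(1,3) infinite_mem(1)[OF C_inf] unfolding mon_le_def by (meson less_imp_le)
    next
      assume "infinite_case B"
      then show ?thesis using infinite_mem(1) C_inf unfolding mon_le_def by blast
    qed
  next
    fix \<gamma> assume \<gamma>: "finite_case C \<gamma>"
    from cases[OF B] show ?thesis
    proof (elim disjE exE)
      assume "infinite_case B"
      then show ?thesis
        using scaled_limit_not_diverges[OF sub b[OF B] b[OF C] t0, of \<gamma>] \<gamma>
        unfolding infinite_case_def finite_case_def by blast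
    next
      fix \<beta> assume \<beta>: "finite_case B \<beta>"
      show ?thesis
      proof (cases "\<beta> \<le> \<gamma>")
        case True
        then have "\<beta> / \<sigma> \<le> \<gamma> / \<sigma>" using \<sigma>(1) by (intro divide_right_mono) auto
        then show ?thesis using finite_mem(1) \<beta> \<gamma> unfolding mon_le_def by blast
      next
        case False
        have "\<bar>\<beta> / \<sigma> - \<gamma> / \<sigma>\<bar> \<le> 1 / of_nat M" if M: "0 < M" for M
        proof -
          have "\<beta> \<le> \<gamma> + 1 / of_nat (2 * M)"
            using scaled_limit_mono[OF sub b[OF B] b[OF C] t0, of \<beta> \<gamma> "2 * M"] \<beta> \<gamma> M
            unfolding finite_case_def by simp
          then have "(\<beta> - \<gamma>) / \<sigma> \<le> 1 / of_nat (2 * M) / \<sigma>" using \<sigma>(1) by (intro divide_right_mono) auto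
          also have "\<dots> \<le> 1 / of_nat (2 * M) / (1 / 2)"
            using \<sigma>(1) by (intro divide_left_mono) auto
          finally have "(\<beta> - \<gamma>) / \<sigma> \<le> 1 / of_nat M" by simp
          moreover have "0 \<le> (\<beta> - \<gamma>) / \<sigma>" using False \<sigma>(1) by simp
          ultimately show ?thesis by (simp add: diff_divide_distrib)
        qed
        moreover obtain K where "\<beta> / \<sigma> \<le> of_nat K" using \<beta> unfolding finite_case_def by blast
        then have "\<bar>\<beta> / \<sigma>\<bar> \<le> of_nat K" using finite_mem(2)[OF \<beta>] by simp
        ultimately have "mon (\<beta> / \<sigma>) = mon (\<gamma> / \<sigma>)" by (rule mon_eq[rotated])
        then show ?thesis
          using finite_mem(1)[OF \<beta>] \<beta> \<gamma> unfolding mon_le_def finite_case_def by auto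
      qed
    qed
  qed
  show ?thesis unfolding obs using lim nonneg mono by blast
qed

end
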